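(* For each $n\in\mathbb{N}$, the theories $\mathrm{WR}\Sigma_0(\Sigma_n)$, $\mathrm{WR}(\Sigma_{n+1}\vee\Pi_{n+1})$ and $\mathrm{B}\Sigma_{n+2}$ are equivalent (each proves every axiom of the others).
   Context: All theories contain $\mathrm{PA}^-$; $\mathrm{B}\Sigma_k$ is $\Sigma_k$-collection together with $\mathrm{I}\Delta_0$. $\Sigma_0(\Sigma_n)$ is the closure of $\Sigma_n$ formulas under Boolean operations and bounded quantification; $\Sigma_{k}\vee\Pi_{k}$ is the class of disjunctions of a $\Sigma_k$ and a $\Pi_k$ formula. For a formula $\phi(x,y)$ (possibly with further free variables), $\mathrm{WR}\phi$ is the universal closure of $\forall x\,\exists y<a\,\phi(x,y)\to\exists y<a\,\forall b\,\exists x>b\,\phi(x,y)$, and $\mathrm{WR}\Gamma=\mathrm{I}\Delta_0\cup\{\mathrm{WR}\phi:\phi\in\Gamma\}$. *)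

theory Defs
  imports Main
begin

datatype tm = Var nat | Zero | One | Plus tm tm | Times tm tm

datatype fm = Eq tm tm | Lt tm tm | FF | Neg fm | Conj fm fm | Disj fm fm | Imp fm fm
  | All fm | Ex fm

primrec subt :: "(nat \<Rightarrow> tm) \<Rightarrow> tm \<Rightarrow> tm" where
  "subt \<sigma> (Var n) = \<sigma> n"
| "subt \<sigma> Zero = Zero"
| "subt \<sigma> One = One"
| "subt \<sigma> (Plus s t) = Plus (subt \<sigma> s) (subt \<sigma> t)"
| "subt \<sigma> (Times s t) = Times (subt \<sigma> s) (subt \<sigma> t)"

definition up :: "(nat \<Rightarrow> tm) \<Rightarrow> nat \<Rightarrow> tm" where
  "up \<sigma> n = (case n of 0 \<Rightarrow> Var 0 | Suc m \<Rightarrow> subt (\<lambda>k. Var (Suc k)) (\<sigma> m))"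

primrec sub :: "(nat \<Rightarrow> tm) \<Rightarrow> fm \<Rightarrow> fm" where
  "sub \<sigma> (Eq s t) = Eq (subt \<sigma> s) (subt \<sigma> t)"
| "sub \<sigma> (Lt s t) = Lt (subt \<sigma> s) (subt \<sigma> t)"
| "sub \<sigma> FF = FF"
| "sub \<sigma> (Neg p) = Neg (sub \<sigma> p)"
| "sub \<sigma> (Conj p q) = Conj (sub \<sigma> p) (sub \<sigma> q)"
| "sub \<sigma> (Disj p q) = Disj (sub \<sigma> p) (sub \<sigma> q)"
| "sub \<sigma> (Imp p q) = Imp (sub \<sigma> p) (sub \<sigma> q)"
| "sub \<sigma> (All p) = All (sub (up \<sigma>) p)"
| "sub \<sigma> (Ex p) = Ex (sub (up \<sigma>) p)"

definition liftt :: "tm \<Rightarrow> tm" where "liftt t = subt (\<lambda>k. Var (Suc k)) t"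
definition lift :: "fm \<Rightarrow> fm" where "lift p = sub (\<lambda>k. Var (Suc k)) p"

definition inst :: "fm \<Rightarrow> tm \<Rightarrow> fm" where
  "inst p t = sub (\<lambda>n. case n of 0 \<Rightarrow> t | Suc m \<Rightarrow> Var m) p"

primrec fvt :: "tm \<Rightarrow> nat set" where
  "fvt (Var n) = {n}"
| "fvt Zero = {}"
| "fvt One = {}"
| "fvt (Plus s t) = fvt s \<union> fvt t"
| "fvt (Times s t) = fvt s \<union> fvt t"

primrec fv :: "fm \<Rightarrow> nat set" where
  "fv (Eq s t) = fvt s \<union> fvt t"
| "fv (Lt s t) = fvt s \<union> fvt t"
| "fv FF = {}"
| "fv (Neg p) = fv p"
| "fv (Conj p q) = fv p \<union> fv q"
| "fv (Disj p q) = fv p \<union> fv q"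
| "fv (Imp p q) = fv p \<union> fv q"
| "fv (All p) = {n. Suc n \<in> fv p}"
| "fv (Ex p) = {n. Suc n \<in> fv p}"

definition ucl :: "fm \<Rightarrow> fm" where
  "ucl p = (All ^^ (if fv p = {} then 0 else Suc (Max (fv p)))) p"

inductive deriv :: "fm list \<Rightarrow> fm \<Rightarrow> bool" where
  Hyp: "p \<in> set G \<Longrightarrow> deriv G p"
| FFE: "deriv G FF \<Longrightarrow> deriv G p"
| NegI: "deriv (p # G) FF \<Longrightarrow> deriv G (Neg p)"
| NegE: "deriv G (Neg p) \<Longrightarrow> deriv G p \<Longrightarrow> deriv G FF"
| Class: "deriv (Neg p # G) FF \<Longrightarrow> deriv G p"
| ConjI: "deriv G p \<Longrightarrow> deriv G q \<Longrightarrow> deriv G (Conj p q)"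
| ConjE1: "deriv G (Conj p q) \<Longrightarrow> deriv G p"
| ConjE2: "deriv G (Conj p q) \<Longrightarrow> deriv G q"
| DisjI1: "deriv G p \<Longrightarrow> deriv G (Disj p q)"
| DisjI2: "deriv G q \<Longrightarrow> deriv G (Disj p q)"
| DisjE: "deriv G (Disj p q) \<Longrightarrow> deriv (p # G) r \<Longrightarrow> deriv (q # G) r \<Longrightarrow> deriv G r"
| ImpI: "deriv (p # G) q \<Longrightarrow> deriv G (Imp p q)"
| ImpE: "deriv G (Imp p q) \<Longrightarrow> deriv G p \<Longrightarrow> deriv G q"
| AllI: "deriv (map lift G) p \<Longrightarrow> deriv G (All p)"
| AllE: "deriv G (All p) \<Longrightarrow> deriv G (inst p t)"
| ExI: "deriv G (inst p t) \<Longrightarrow> deriv G (Ex p)"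
| ExE: "deriv G (Ex p) \<Longrightarrow> deriv (p # map lift G) (lift q) \<Longrightarrow> deriv G q"
| Refl: "deriv G (Eq t t)"
| Subst: "deriv G (Eq s t) \<Longrightarrow> deriv G (inst p s) \<Longrightarrow> deriv G (inst p t)"

definition Prov :: "fm set \<Rightarrow> fm \<Rightarrow> bool" where
  "Prov T p \<longleftrightarrow> (\<exists>G. set G \<subseteq> ucl ` T \<and> deriv G p)"

definition EquivTh :: "fm set \<Rightarrow> fm set \<Rightarrow> bool" where
  "EquivTh T U \<longleftrightarrow> (\<forall>p\<in>U. Prov T (ucl p)) \<and> (\<forall>p\<in>T. Prov U (ucl p))"

definition BEx :: "tm \<Rightarrow> fm \<Rightarrow> fm" where
  "BEx t p = Ex (Conj (Lt (Var 0) (liftt t)) p)"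
definition BAll :: "tm \<Rightarrow> fm \<Rightarrow> fm" where
  "BAll t p = All (Imp (Lt (Var 0) (liftt t)) p)"

inductive_set Sigma0_cl :: "fm set \<Rightarrow> fm set" for \<Gamma> where
  base: "p \<in> \<Gamma> \<Longrightarrow> p \<in> Sigma0_cl \<Gamma>"
| eq: "Eq s t \<in> Sigma0_cl \<Gamma>"
| lt: "Lt s t \<in> Sigma0_cl \<Gamma>"
| ff: "FF \<in> Sigma0_cl \<Gamma>"
| neg: "p \<in> Sigma0_cl \<Gamma> \<Longrightarrow> Neg p \<in> Sigma0_cl \<Gamma>"
| conj: "p \<in> Sigma0_cl \<Gamma> \<Longrightarrow> q \<in> Sigma0_cl \<Gamma> \<Longrightarrow> Conj p q \<in> Sigma0_cl \<Gamma>"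
| disj: "p \<in> Sigma0_cl \<Gamma> \<Longrightarrow> q \<in> Sigma0_cl \<Gamma> \<Longrightarrow> Disj p q \<in> Sigma0_cl \<Gamma>"
| imp: "p \<in> Sigma0_cl \<Gamma> \<Longrightarrow> q \<in> Sigma0_cl \<Gamma> \<Longrightarrow> Imp p q \<in> Sigma0_cl \<Gamma>"
| bex: "p \<in> Sigma0_cl \<Gamma> \<Longrightarrow> BEx t p \<in> Sigma0_cl \<Gamma>"
| ball: "p \<in> Sigma0_cl \<Gamma> \<Longrightarrow> BAll t p \<in> Sigma0_cl \<Gamma>"

definition Delta0 :: "fm set" where "Delta0 = Sigma0_cl {}"

fun SigPi :: "nat \<Rightarrow> fm set \<times> fm set" where
  "SigPi 0 = (Delta0, Delta0)"
| "SigPi (Suc n) = ({(Ex ^^ k) p | k p. p \<in> snd (SigPi n)},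
                    {(All ^^ k) p | k p. p \<in> fst (SigPi n)})"

definition Sig :: "nat \<Rightarrow> fm set" where "Sig n = fst (SigPi n)"
definition Pi :: "nat \<Rightarrow> fm set" where "Pi n = snd (SigPi n)"

definition SigOrPi :: "nat \<Rightarrow> fm set" where
  "SigOrPi k = {Disj p q | p q. p \<in> Sig k \<and> q \<in> Pi k}"

abbreviation "x0 \<equiv> Var 0"
abbreviation "x1 \<equiv> Var 1"
abbreviation "x2 \<equiv> Var 2"

text \<open>Kaye's PA-minus (discretely ordered commutative semirings with least element 0).\<close>
definition PAminus :: "fm set" where
  "PAminus = {
    Eq (Plus (Plus x0 x1) x2) (Plus x0 (Plus x1 x2)),
    Eq (Plus x0 x1) (Plus x1 x0),
    Eq (Times (Times x0 x1) x2) (Times x0 (Times x1 x2)),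
    Eq (Times x0 x1) (Times x1 x0),
    Eq (Times x0 (Plus x1 x2)) (Plus (Times x0 x1) (Times x0 x2)),
    Conj (Eq (Plus x0 Zero) x0) (Eq (Times x0 Zero) Zero),
    Eq (Times x0 One) x0,
    Imp (Conj (Lt x0 x1) (Lt x1 x2)) (Lt x0 x2),
    Neg (Lt x0 x0),
    Disj (Lt x0 x1) (Disj (Eq x0 x1) (Lt x1 x0)),
    Imp (Lt x0 x1) (Lt (Plus x0 x2) (Plus x1 x2)),
    Imp (Conj (Lt Zero x2) (Lt x0 x1)) (Lt (Times x0 x2) (Times x1 x2)),
    Imp (Lt x0 x1) (Ex (Eq (Plus x1 (Var 0)) x2)),
    Conj (Lt Zero One) (Imp (Lt Zero x0) (Disj (Lt One x0) (Eq One x0))),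
    Disj (Lt Zero x0) (Eq Zero x0)}"

text \<open>Note: in the axiom x < y --> (EX z. x + z = y) above, under the binder Ex the
  outer variables x, y are Var 1, Var 2 and z is Var 0.\<close>

definition Ind :: "fm \<Rightarrow> fm" where
  "Ind p = Imp (Conj (inst p Zero)
                     (All (Imp p (sub (\<lambda>n. if n = 0 then Plus (Var 0) One else Var n) p))))
               (All p)"

definition IDelta0 :: "fm set" where
  "IDelta0 = PAminus \<union> Ind ` Delta0"

text \<open>Collection for p(x, y, params), x = Var 0, y = Var 1, params = Var (i+2):
  \<open>\<forall>x<a \<exists>y p(x,y) \<longrightarrow> \<exists>b \<forall>x<a \<exists>y<b p(x,y)\<close>, a fresh.\<close>
definition Coll :: "fm \<Rightarrow> fm" where
  "Coll p = Imp
     (BAll (Var 0) (Ex (sub (\<lambda>n. if n = 0 then Var 1 else if n = 1 then Var 0 else Var (n + 1)) p)))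
     (Ex (BAll (Var 1) (BEx (Var 1)
        (sub (\<lambda>n. if n = 0 then Var 1 else if n = 1 then Var 0 else Var (n + 2)) p))))"

definition BSig :: "nat \<Rightarrow> fm set" where
  "BSig k = IDelta0 \<union> Coll ` Sig k"

text \<open>Weak regularity for p(x, y, params), x = Var 0, y = Var 1, params = Var (i+2):
  \<open>\<forall>x \<exists>y<a p(x,y) \<longrightarrow> \<exists>y<a \<forall>b \<exists>x>b p(x,y)\<close>, a and b fresh.\<close>
definition WRax :: "fm \<Rightarrow> fm" where
  "WRax p = Imp
     (All (BEx (Var 1) (sub (\<lambda>n. if n = 0 then Var 1 else if n = 1 then Var 0 else Var (n + 1)) p)))
     (BEx (Var 0) (All (Ex (Conj (Lt (Var 1) (Var 0))
        (sub (\<lambda>n. if n = 0 then Var 0 else if n = 1 then Var 2 else Var (n + 2)) p)))))"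

definition WR :: "fm set \<Rightarrow> fm set" where
  "WR \<Gamma> = IDelta0 \<union> WRax ` \<Gamma>"

end

theory Submission
  imports Defs "HOL-Library.Countable_Set"
begin

text \<open>
  By completeness it suffices to compare models of \<open>I\<Delta>\<^sub>0\<close>; since these are infinite, countable
  models may be taken on the natural numbers.

  From \<open>WR\<Sigma>\<^sub>0(\<Sigma>\<^sub>n)\<close> to \<open>B\<Sigma>\<^bsub>n+2\<^esub>\<close>: given \<open>\<forall>y<a. \<exists>b. \<forall>z. C(y,b,z)\<close>, weak regularity is applied
  to ``at stage \<open>x\<close>, the least apparent witness of \<open>y\<close> is largest among those of all \<open>y' < a\<close>''. It yields
  one \<open>y\<close> that is maximal at unboundedly many stages, and its true witness bounds all the others.

  From \<open>B\<Sigma>\<^bsub>n+2\<^esub>\<close> to \<open>WR(\<Sigma>\<^bsub>n+1\<^esub> \<or> \<Pi>\<^bsub>n+1\<^esub>)\<close>: collection disposes of the \<open>\<Sigma>\<^bsub>n+1\<^esub>\<close> disjunct, leaving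
  \<open>\<forall>x. \<exists>y<a. P(x,y)\<close> with \<open>P\<close> in \<open>\<Pi>\<^bsub>n+1\<^esub>\<close>. Run through all pairs \<open>(b,y)\<close>, greedily committing to
  ``\<open>y\<close> is not used for any \<open>x > b\<close>'' as long as every \<open>x\<close> retains an admissible value. Initial segments of this
  process are coded, by induction for \<open>\<Sigma>\<^sub>0(\<Sigma>\<^bsub>n+1\<^esub>)\<close>. If every \<open>y < a\<close> were committed at some point,
  collection would bound these points and leave some \<open>x\<close> without a value; and if \<open>y\<close> is never
  committed, then each rejection of \<open>(b,y)\<close> produces an \<open>x > b\<close> with \<open>P(x,y)\<close>.
\<close>

section \<open>Substitution\<close>

text \<open>The obstacle in the second direction is one quantifier. If each y < a satisfied P(x,y)
  only up to some b, one would like to bound all these b at once, but "no x > b satisfies P(x,y)" is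
  Pi_(n+2), and collecting it takes BSigma_(n+3). "Some coded greedy segment commits to y" serves
  instead: being greedy is Sigma_0(Sigma_(n+1)), hence Delta_(n+2) under collection, so the new
  statement is Sigma_(n+2). Segments of different lengths can be compared because greedy decisions
  are uniquely determined. In the first direction, checking only z < x at stage x keeps the relation
  in Sigma_0(Sigma_n). The price is that the bound obtained is good at each stage separately;
  exchanging stage and witness needs collection one level below the goal, which is why the argument
  climbs through the levels.\<close>

lemma nat_ext: "f 0 = g 0 \<Longrightarrow> (\<And>n. f (Suc n) = g (Suc n)) \<Longrightarrow> f = g"
  by (rule ext) (metis nat.exhaust)

lemma subt_subt: "subt \<sigma> (subt \<tau> t) = subt (\<lambda>n. subt \<sigma> (\<tau> n)) t"
  by (induction t) auto

lemma subt_Var [simp]: "subt Var t = t"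
  by (induction t) auto

lemma up_simps [simp]: "up \<sigma> 0 = Var 0" "up \<sigma> (Suc n) = liftt (\<sigma> n)"
  by (simp_all add: up_def liftt_def)

lemma up_comp: "(\<lambda>n. subt (up \<sigma>) (up \<tau> n)) = up (\<lambda>n. subt \<sigma> (\<tau> n))"
proof
  fix n show "subt (up \<sigma>) (up \<tau> n) = up (\<lambda>n. subt \<sigma> (\<tau> n)) n"
    by (cases n) (simp_all add: subt_subt liftt_def)
qed

lemma sub_sub: "sub \<sigma> (sub \<tau> p) = sub (\<lambda>n. subt \<sigma> (\<tau> n)) p"
  by (induction p arbitrary: \<sigma> \<tau>) (simp_all add: subt_subt up_comp)

lemma up_Var [simp]: "up Var = Var"
proof
  fix n show "up Var n = Var n" by (cases n) (simp_all add: liftt_def)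
qed

lemma sub_Var [simp]: "sub Var p = p"
  by (induction p) auto

lemma liftt_subt: "subt (up \<sigma>) (liftt t) = liftt (subt \<sigma> t)"
  by (simp add: liftt_def subt_subt)

lemma sub_lift: "sub (up \<sigma>) (lift p) = lift (sub \<sigma> p)"
  by (simp add: lift_def sub_sub liftt_def)

lemma inst_conv: "inst p t = sub (case_nat t Var) p"
  by (simp add: inst_def)

lemma subt_case_liftt: "subt (case_nat t \<sigma>) (liftt s) = subt \<sigma> s"
  by (simp add: liftt_def subt_subt)

text \<open>\<open>case_nat t \<sigma>\<close> mirrors the extension of an environment in the
  semantics; in this form the quantifier clauses of the Henkin set and of satisfaction
  match.\<close>

lemma inst_sub_up: "inst (sub (up \<sigma>) p) t = sub (case_nat t \<sigma>) p"
proof -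
  have "(\<lambda>n. subt (case_nat t Var) (up \<sigma> n)) = case_nat t \<sigma>"
    by (rule nat_ext) (simp_all add: subt_case_liftt)
  then show ?thesis
    by (simp add: inst_conv sub_sub)
qed

lemma sub_inst: "sub \<sigma> (inst p t) = sub (case_nat (subt \<sigma> t) \<sigma>) p"
proof -
  have "(\<lambda>n. subt \<sigma> (case_nat t Var n)) = case_nat (subt \<sigma> t) \<sigma>"
    by (rule nat_ext) simp_all
  then show ?thesis
    by (simp add: inst_conv sub_sub)
qed

lemma subt_cong: "(\<And>n. n \<in> fvt t \<Longrightarrow> \<sigma> n = \<tau> n) \<Longrightarrow> subt \<sigma> t = subt \<tau> t"
  by (induction t) auto

lemma sub_cong: "(\<And>n. n \<in> fv p \<Longrightarrow> \<sigma> n = \<tau> n) \<Longrightarrow> sub \<sigma> p = sub \<tau> p"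
proof (induction p arbitrary: \<sigma> \<tau>)
  case (All p)
  have "sub (up \<sigma>) p = sub (up \<tau>) p"
  proof (rule All.IH)
    fix n assume "n \<in> fv p" then show "up \<sigma> n = up \<tau> n"
      using All.prems by (cases n) simp_all
  qed
  then show ?case by simp
next
  case (Ex p)
  have "sub (up \<sigma>) p = sub (up \<tau>) p"
  proof (rule Ex.IH)
    fix n assume "n \<in> fv p" then show "up \<sigma> n = up \<tau> n"
      using Ex.prems by (cases n) simp_all
  qed
  then show ?case by simp
next
  case (Eq s t) then show ?case by (auto intro!: subt_cong)
next
  case (Lt s t) then show ?case by (auto intro!: subt_cong)
next
  case (Conj p q)
  from Conj.IH(1)[of \<sigma> \<tau>] Conj.IH(2)[of \<sigma> \<tau>] Conj.prems show ?case by simp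
next
  case (Disj p q)
  from Disj.IH(1)[of \<sigma> \<tau>] Disj.IH(2)[of \<sigma> \<tau>] Disj.prems show ?case by simp
next
  case (Imp p q)
  from Imp.IH(1)[of \<sigma> \<tau>] Imp.IH(2)[of \<sigma> \<tau>] Imp.prems show ?case by simp
next
  case (Neg p)
  from Neg.IH[of \<sigma> \<tau>] Neg.prems show ?case by simp
qed simp

lemma finite_fvt [simp]: "finite (fvt t)"
  by (induction t) auto

lemma finite_fv [simp]: "finite (fv p)"
proof (induction p)
  case (All p)
  have "{n. Suc n \<in> fv p} = Suc -` fv p" by auto
  with All show ?case by (simp add: finite_vimageI)
next
  case (Ex p)
  have "{n. Suc n \<in> fv p} = Suc -` fv p" by auto
  with Ex show ?case by (simp add: finite_vimageI)
qed auto

lemma fv_All_funpow: "fv ((All ^^ k) p) = {n. n + k \<in> fv p}"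
  by (induction k) auto

lemma fv_ucl [simp]: "fv (ucl p) = {}"
proof (cases "fv p = {}")
  case False
  have "n + Suc (Max (fv p)) \<notin> fv p" for n
    using Max_ge[OF finite_fv, of "n + Suc (Max (fv p))" p] by linarith
  then show ?thesis using False by (simp add: ucl_def fv_All_funpow del: funpow.simps)
qed (simp add: ucl_def)

section \<open>Derivations and the Henkin construction\<close>

lemma deriv_hyp [simp, intro]:
  "deriv (p # G) p" "deriv (q # p # G) p"
  by (simp_all add: deriv.Hyp)

lemma deriv_weaken: "deriv G p \<Longrightarrow> set G \<subseteq> set G' \<Longrightarrow> deriv G' p"
proof (induction arbitrary: G' rule: deriv.induct)
  case (AllI G p)
  have "deriv (map lift G') p" by (rule AllI.IH) (use AllI.prems in auto)
  then show ?case by (rule deriv.AllI)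
next
  case (ExE G p q)
  have "deriv (p # map lift G') (lift q)" by (rule ExE.IH(2)) (use ExE.prems in auto)
  with ExE show ?case using deriv.ExE by blast
next
  case (DisjE G p q r)
  have "deriv (p # G') r" "deriv (q # G') r"
    by (rule DisjE.IH, use DisjE.prems in auto)+
  with DisjE show ?case using deriv.DisjE by blast
next
  case (NegI p G)
  have "deriv (p # G') FF" by (rule NegI.IH) (use NegI.prems in auto)
  then show ?case by (rule deriv.NegI)
next
  case (Class p G)
  have "deriv (Neg p # G') FF" by (rule Class.IH) (use Class.prems in auto)
  then show ?case by (rule deriv.Class)
next
  case (ImpI p G q)
  have "deriv (p # G') q" by (rule ImpI.IH) (use ImpI.prems in auto)
  then show ?case by (rule deriv.ImpI)
next
  case (NegE G p)
  then show ?case using deriv.NegE by blast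
next
  case (Subst G s t p)
  then show ?case using deriv.Subst by blast
next
  case (ConjE1 G p q) then show ?case using deriv.ConjE1 by blast
next
  case (ConjE2 G p q) then show ?case using deriv.ConjE2 by blast
next
  case (ImpE G p q) then show ?case using deriv.ImpE by blast
next
  case (AllE G p t) then show ?case using deriv.AllE by blast
next
  case (ExI G p t) then show ?case using deriv.ExI by blast
next
  case (Hyp p G) then show ?case using deriv.Hyp by blast
qed (simp_all add: deriv.FFE deriv.ConjI deriv.DisjI1 deriv.DisjI2 deriv.Refl)

text \<open>Allows a derivation that mentions a fresh variable to be renamed until its context has
  the lifted shape required by \<open>ExE\<close>.\<close>

lemma deriv_sub: "deriv G p \<Longrightarrow> deriv (map (sub \<sigma>) G) (sub \<sigma> p)"
proof (induction arbitrary: \<sigma> rule: deriv.induct)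
  case (AllI G p)
  from AllI.IH[of "up \<sigma>"] have "deriv (map lift (map (sub \<sigma>) G)) (sub (up \<sigma>) p)"
    by (simp add: comp_def sub_lift)
  then show ?case by (simp add: deriv.AllI)
next
  case (AllE G p t)
  from deriv.AllE[OF AllE.IH[of \<sigma>, simplified], of "subt \<sigma> t"]
  show ?case by (simp add: inst_sub_up sub_inst)
next
  case (ExI G p t)
  from ExI.IH[of \<sigma>] have "deriv (map (sub \<sigma>) G) (inst (sub (up \<sigma>) p) (subt \<sigma> t))"
    by (simp add: inst_sub_up sub_inst)
  then show ?case by (simp add: deriv.ExI)
next
  case (ExE G p q)
  from ExE.IH(2)[of "up \<sigma>"]
  have "deriv (sub (up \<sigma>) p # map lift (map (sub \<sigma>) G)) (lift (sub \<sigma> q))"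
    by (simp add: comp_def sub_lift)
  with ExE.IH(1)[of \<sigma>] show ?case using deriv.ExE by simp
next
  case (Subst G s t p)
  from Subst.IH(2)[of \<sigma>] have "deriv (map (sub \<sigma>) G) (inst (sub (up \<sigma>) p) (subt \<sigma> s))"
    by (simp add: inst_sub_up sub_inst)
  with Subst.IH(1)[of \<sigma>] have "deriv (map (sub \<sigma>) G) (inst (sub (up \<sigma>) p) (subt \<sigma> t))"
    using deriv.Subst by simp
  then show ?case by (simp add: inst_sub_up sub_inst)
next
  case (Hyp p G) then show ?case by (auto intro: deriv.Hyp)
next
  case (DisjE G p q r)
  from DisjE.IH(1)[of \<sigma>] DisjE.IH(2)[of \<sigma>] DisjE.IH(3)[of \<sigma>]
  show ?case using deriv.DisjE by simp
next
  case (NegE G p) from NegE.IH[of \<sigma>] show ?case using deriv.NegE by simp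
next
  case (Class p G) from Class.IH[of \<sigma>] show ?case using deriv.Class by simp
next
  case (ImpE G p q) from ImpE.IH[of \<sigma>] show ?case using deriv.ImpE by simp
next
  case (ConjE1 G p q) from ConjE1.IH[of \<sigma>] show ?case using deriv.ConjE1 by simp
next
  case (ConjE2 G p q) from ConjE2.IH[of \<sigma>] show ?case using deriv.ConjE2 by simp
next
  case (FFE G p) from FFE.IH[of \<sigma>] show ?case using deriv.FFE by simp
qed (simp_all add: deriv.NegI deriv.ConjI deriv.DisjI1 deriv.DisjI2 deriv.ImpI deriv.Refl)

section \<open>Complete consistent sets with witnesses\<close>

definition consistent :: "fm set \<Rightarrow> bool" where
  "consistent S \<longleftrightarrow> (\<forall>G. set G \<subseteq> S \<longrightarrow> \<not> deriv G FF)"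

definition fresh :: "fm set \<Rightarrow> nat" where
  "fresh S = (SOME m. \<forall>p\<in>S. m \<notin> fv p)"

definition witness :: "fm set \<Rightarrow> fm \<Rightarrow> fm" where
  "witness S p = (case p of Ex q \<Rightarrow> inst q (Var (fresh S)) | _ \<Rightarrow> p)"

text \<open>A consistent existential formula enters together with a witnessing instance. A rejected
  formula leaves the set unchanged: its negation is derivable from the stage that rejected it, and
  so reaches the limit by closure under derivation.\<close>

definition henkin_step :: "fm \<Rightarrow> fm set \<Rightarrow> fm set" where
  "henkin_step p S = (if consistent (insert p S)
     then insert (witness (insert p S) p) (insert p S) else S)"

lemma inconsistent_insert:
  assumes "\<not> consistent (insert p S)"
  obtains G where "set G \<subseteq> S" "deriv (p # G) FF"
proof -
  from assms obtain G where G: "set G \<subseteq> insert p S" "deriv G FF"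
    unfolding consistent_def by blast
  show ?thesis
  proof (rule that)
    show "set (filter (\<lambda>q. q \<noteq> p) G) \<subseteq> S" using G(1) by auto
    show "deriv (p # filter (\<lambda>q. q \<noteq> p) G) FF" by (rule deriv_weaken[OF G(2)]) auto
  qed
qed

lemma consistent_insert_instance:
  assumes S: "consistent S" "Ex q \<in> S" and m: "\<And>p. p \<in> S \<Longrightarrow> m \<notin> fv p"
  shows "consistent (insert (inst q (Var m)) S)"
proof (rule ccontr)
  assume "\<not> ?thesis"
  then obtain G where G: "set G \<subseteq> S" "deriv (inst q (Var m) # G) FF"
    by (rule inconsistent_insert)
  \<comment> \<open>\<open>\<sigma>\<close> sends the fresh variable to index 0, the one that
    \<open>Ex\<close> binds in \<open>q\<close>, and lifts all others: the context becomes a lifted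
    one and the instance becomes \<open>q\<close>, which is the premise of
    \<open>ExE\<close>.\<close>
  define \<sigma> where "\<sigma> n = (if n = m then Var 0 else Var (Suc n))" for n
  have 1: "sub \<sigma> p = lift p" if "p \<in> S" for p
    unfolding lift_def by (rule sub_cong) (use m[OF that] in \<open>auto simp: \<sigma>_def\<close>)
  have "sub \<sigma> (inst q (Var m)) = sub Var q"
    unfolding sub_inst
  proof (rule sub_cong)
    fix n assume "n \<in> fv q"
    with m[OF S(2)] show "case_nat (subt \<sigma> (Var m)) \<sigma> n = Var n"
      by (cases n) (auto simp: \<sigma>_def)
  qed
  moreover have "map (sub \<sigma>) G = map lift G" using 1 G(1) by (simp add: subset_iff)
  ultimately have "deriv (q # map lift G) FF"
    using deriv_sub[OF G(2), of \<sigma>] by (simp only: list.map sub_Var sub.simps(3))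
  then have "deriv (q # map lift (Ex q # G)) (lift FF)"
    unfolding lift_def sub.simps by (rule deriv_weaken) auto
  then have "deriv (Ex q # G) FF" by (rule deriv.ExE[OF deriv_hyp(1)])
  moreover have "set (Ex q # G) \<subseteq> S" using S(2) G(1) by auto
  ultimately show False using S(1) unfolding consistent_def by blast
qed

lemma fresh: "finite (\<Union>(fv ` S)) \<Longrightarrow> p \<in> S \<Longrightarrow> fresh S \<notin> fv p"
proof -
  assume "finite (\<Union>(fv ` S))" "p \<in> S"
  moreover from this obtain m where "m \<notin> \<Union>(fv ` S)" using ex_new_if_finite infinite_UNIV_nat by blast
  then have "\<exists>m. \<forall>p\<in>S. m \<notin> fv p" by auto
  then have "\<forall>p\<in>S. fresh S \<notin> fv p" unfolding fresh_def by (rule someI_ex)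
  ultimately show ?thesis by blast
qed

lemma henkin_step_consistent:
  assumes "consistent S" "finite (\<Union>(fv ` S))"
  shows "consistent (henkin_step p S)"
proof (cases "consistent (insert p S)")
  case True
  have fin: "finite (\<Union>(fv ` insert p S))" using assms(2) by simp
  show ?thesis
  proof (cases "\<exists>q. p = Ex q")
    case ex: True
    then obtain q where q: "p = Ex q" by blast
    have "consistent (insert (inst q (Var (fresh (insert p S)))) (insert p S))"
      by (rule consistent_insert_instance[OF True]) (use q fresh[OF fin] in auto)
    then show ?thesis using True q by (simp add: henkin_step_def witness_def)
  next
    case False
    then have "witness (insert p S) p = p" by (cases p) (auto simp: witness_def)
    with True show ?thesis by (simp add: henkin_step_def)
  qed
qed (use assms in \<open>simp add: henkin_step_def\<close>)

lemma finite_fv_henkin_step: "finite (\<Union>(fv ` S)) \<Longrightarrow> finite (\<Union>(fv ` henkin_step p S))"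
  by (simp add: henkin_step_def)

instance tm :: countable by countable_datatype
instance fm :: countable by countable_datatype

primrec henkin_seq :: "fm set \<Rightarrow> nat \<Rightarrow> fm set" where
  "henkin_seq S 0 = S"
| "henkin_seq S (Suc n) = henkin_step (from_nat n) (henkin_seq S n)"

definition henkin :: "fm set \<Rightarrow> fm set" where
  "henkin S = (\<Union>n. henkin_seq S n)"

lemma henkin_seq_mono: "m \<le> n \<Longrightarrow> henkin_seq S m \<subseteq> henkin_seq S n"
  by (rule lift_Suc_mono_le[of "henkin_seq S"]) (auto simp: henkin_step_def)

lemma finite_subset_henkin: "finite F \<Longrightarrow> F \<subseteq> henkin S \<Longrightarrow> \<exists>n. F \<subseteq> henkin_seq S n"
proof (induction F rule: finite_induct)
  case (insert x F)
  then obtain m n where "x \<in> henkin_seq S m" "F \<subseteq> henkin_seq S n" by (auto simp: henkin_def)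
  then have "insert x F \<subseteq> henkin_seq S (max m n)"
    using henkin_seq_mono[of m "max m n" S] henkin_seq_mono[of n "max m n" S] by auto
  then show ?case by blast
qed simp

locale closed_theory =
  fixes S :: "fm set"
  assumes consistent: "consistent S" and closed: "\<And>p. p \<in> S \<Longrightarrow> fv p = {}"
begin

lemma henkin_seq_consistent: "consistent (henkin_seq S n) \<and> finite (\<Union>(fv ` henkin_seq S n))"
  by (induction n) (use consistent closed in \<open>auto simp: henkin_step_consistent finite_fv_henkin_step simp del: finite_UN\<close>)

abbreviation "H \<equiv> henkin S"

lemma henkin_consistent: "set G \<subseteq> H \<Longrightarrow> \<not> deriv G FF"
  using finite_subset_henkin[of "set G"] henkin_seq_consistent consistent_def by blast

lemma subset_henkin: "S \<subseteq> H"
  unfolding henkin_def using henkin_seq.simps(1) by blast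

text \<open>A formula outside \<open>H\<close> was rejected at its own stage
  \<open>to_nat p\<close>, so it is refutable from members of \<open>H\<close>; deriving it as well
  would make \<open>H\<close> inconsistent.\<close>

lemma henkin_deriv:
  assumes "set G \<subseteq> H" "deriv G p" shows "p \<in> H"
proof (rule ccontr)
  assume p: "p \<notin> H"
  have "\<not> consistent (insert p (henkin_seq S (to_nat p)))"
  proof
    assume "consistent (insert p (henkin_seq S (to_nat p)))"
    then have "p \<in> henkin_seq S (Suc (to_nat p))" by (simp add: henkin_step_def)
    with p show False by (auto simp: henkin_def simp del: henkin_seq.simps)
  qed
  then obtain G' where G': "set G' \<subseteq> henkin_seq S (to_nat p)" "deriv (p # G') FF"
    by (rule inconsistent_insert)
  have "deriv (G @ G') (Neg p)"
    by (rule deriv.NegI, rule deriv_weaken[OF G'(2)]) auto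
  moreover have "deriv (G @ G') p" by (rule deriv_weaken[OF assms(2)]) auto
  ultimately have "deriv (G @ G') FF" by (rule deriv.NegE)
  moreover have "set (G @ G') \<subseteq> H" using assms(1) G'(1) by (auto simp: henkin_def)
  ultimately show False using henkin_consistent by blast
qed

lemma henkin_rule1: "p \<in> H \<Longrightarrow> deriv [p] q \<Longrightarrow> q \<in> H"
  using henkin_deriv[of "[p]" q] by simp

lemma henkin_rule2: "p \<in> H \<Longrightarrow> q \<in> H \<Longrightarrow> deriv [p, q] r \<Longrightarrow> r \<in> H"
  using henkin_deriv[of "[p, q]" r] by simp

lemma henkin_FF: "FF \<notin> H"
  using henkin_consistent[of "[FF]"] deriv_hyp(1)[of FF "[]"] by auto

lemma henkin_Neg: "Neg p \<in> H \<longleftrightarrow> p \<notin> H"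
proof
  assume n: "Neg p \<in> H"
  show "p \<notin> H"
  proof
    assume "p \<in> H"
    with n have "FF \<in> H" by (rule henkin_rule2) (rule deriv.NegE[of _ p]; rule deriv_hyp)
    with henkin_FF show False ..
  qed
next
  assume p: "p \<notin> H"
  have "\<not> consistent (insert p (henkin_seq S (to_nat p)))"
  proof
    assume "consistent (insert p (henkin_seq S (to_nat p)))"
    then have "p \<in> henkin_seq S (Suc (to_nat p))" by (simp add: henkin_step_def)
    with p show False by (auto simp: henkin_def simp del: henkin_seq.simps)
  qed
  then obtain G where G: "set G \<subseteq> henkin_seq S (to_nat p)" "deriv (p # G) FF"
    by (rule inconsistent_insert)
  show "Neg p \<in> H"
  proof (rule henkin_deriv)
    show "set G \<subseteq> H" using G(1) unfolding henkin_def by blast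
    show "deriv G (Neg p)" using G(2) by (rule deriv.NegI)
  qed
qed

lemma henkin_Conj: "Conj p q \<in> H \<longleftrightarrow> p \<in> H \<and> q \<in> H"
proof safe
  assume pq: "Conj p q \<in> H"
  show "p \<in> H" by (rule henkin_rule1[OF pq], rule deriv.ConjE1, rule deriv_hyp)
  show "q \<in> H" by (rule henkin_rule1[OF pq], rule deriv.ConjE2, rule deriv_hyp)
next
  assume "p \<in> H" "q \<in> H"
  then show "Conj p q \<in> H" by (rule henkin_rule2) (rule deriv.ConjI; rule deriv_hyp)
qed

lemma henkin_Disj: "Disj p q \<in> H \<longleftrightarrow> p \<in> H \<or> q \<in> H"
proof
  assume d: "Disj p q \<in> H"
  show "p \<in> H \<or> q \<in> H"
  proof (rule ccontr)
    assume "\<not> ?thesis"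
    then have n: "Neg p \<in> H" "Neg q \<in> H" by (simp_all add: henkin_Neg)
    let ?G = "[Disj p q, Neg p, Neg q]"
    have "deriv (p # ?G) FF" by (rule deriv.NegE[of _ p]; rule deriv.Hyp) auto
    moreover have "deriv (q # ?G) FF" by (rule deriv.NegE[of _ q]; rule deriv.Hyp) auto
    ultimately have "deriv ?G FF" using deriv.DisjE deriv_hyp(1) by blast
    with n d henkin_consistent[of ?G] show False by simp
  qed
next
  assume "p \<in> H \<or> q \<in> H"
  then show "Disj p q \<in> H"
  proof
    assume "p \<in> H"
    then show ?thesis by (rule henkin_rule1) (rule deriv.DisjI1, rule deriv_hyp)
  next
    assume "q \<in> H"
    then show ?thesis by (rule henkin_rule1) (rule deriv.DisjI2, rule deriv_hyp)
  qed
qed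

lemma henkin_Imp: "Imp p q \<in> H \<longleftrightarrow> (p \<in> H \<longrightarrow> q \<in> H)"
proof
  assume pq: "Imp p q \<in> H"
  show "p \<in> H \<longrightarrow> q \<in> H"
  proof
    assume "p \<in> H"
    with pq show "q \<in> H" by (rule henkin_rule2) (rule deriv.ImpE[of _ p]; rule deriv_hyp)
  qed
next
  assume pq: "p \<in> H \<longrightarrow> q \<in> H"
  show "Imp p q \<in> H"
  proof (cases "q \<in> H")
    case True
    then show ?thesis by (rule henkin_rule1) (rule deriv.ImpI, rule deriv_hyp)
  next
    case False
    with pq have n: "Neg p \<in> H" by (simp add: henkin_Neg)
    have "deriv [p, Neg p] FF" by (rule deriv.NegE[of _ p]; rule deriv_hyp)
    then show ?thesis
      by - (rule henkin_rule1[OF n], rule deriv.ImpI, rule deriv.FFE)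
  qed
qed

lemma henkin_Ex: "Ex q \<in> H \<longleftrightarrow> (\<exists>t. inst q t \<in> H)"
proof
  assume ex: "Ex q \<in> H"
  let ?n = "to_nat (Ex q)"
  have "consistent (insert (Ex q) (henkin_seq S ?n))"
    unfolding consistent_def
  proof (intro allI impI)
    fix G assume "set G \<subseteq> insert (Ex q) (henkin_seq S ?n)"
    with ex have "set G \<subseteq> H" by (auto simp: henkin_def)
    then show "\<not> deriv G FF" by (rule henkin_consistent)
  qed
  then have "\<exists>t. inst q t \<in> henkin_seq S (Suc ?n)"
    by (auto simp: henkin_step_def witness_def)
  then show "\<exists>t. inst q t \<in> H" by (auto simp: henkin_def simp del: henkin_seq.simps)
next
  assume "\<exists>t. inst q t \<in> H"
  then obtain t where "inst q t \<in> H" by blast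
  then show "Ex q \<in> H" by (rule henkin_rule1) (rule deriv.ExI, rule deriv_hyp)
qed

lemma henkin_All: "All q \<in> H \<longleftrightarrow> (\<forall>t. inst q t \<in> H)"
proof
  assume a: "All q \<in> H"
  show "\<forall>t. inst q t \<in> H"
    by (rule allI, rule henkin_rule1[OF a], rule deriv.AllE, rule deriv_hyp)
next
  assume all: "\<forall>t. inst q t \<in> H"
  show "All q \<in> H"
  proof (rule ccontr)
    assume "All q \<notin> H"
    then have n: "Neg (All q) \<in> H" by (simp add: henkin_Neg)
    \<comment> \<open>Classical detour: \<open>Neg (All q)\<close> yields \<open>Ex (Neg q)\<close>,
      and for an existential formula \<open>H\<close> contains an instance.\<close>
    let ?E = "Ex (Neg q)"
    have "inst (sub (up (\<lambda>k. Var (Suc k))) q) (Var 0) = sub (case_nat (Var 0) (\<lambda>k. Var (Suc k))) q"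
      by (rule inst_sub_up)
    also have "case_nat (Var 0) (\<lambda>k. Var (Suc k)) = Var" by (rule nat_ext) simp_all
    finally have q: "inst (sub (up (\<lambda>k. Var (Suc k))) (Neg q)) (Var 0) = Neg q"
      by (simp add: inst_def)
    let ?G = "map lift [Neg ?E, Neg (All q)]"
    have "deriv (Neg q # ?G) (lift ?E)"
      unfolding lift_def sub.simps(9) by (rule deriv.ExI[of _ _ "Var 0"], subst q) (simp add: deriv.Hyp)
    moreover have "deriv (Neg q # ?G) (Neg (lift ?E))"
      by (rule deriv.Hyp) (simp add: lift_def)
    ultimately have "deriv (Neg q # ?G) FF" by (rule deriv.NegE[rotated])
    then have "deriv [Neg ?E, Neg (All q)] (All q)" by - (rule deriv.AllI, rule deriv.Class)
    then have "deriv [Neg ?E, Neg (All q)] FF" by (rule deriv.NegE[OF deriv_hyp(2)])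
    then have "deriv [Neg (All q)] ?E" by (rule deriv.Class)
    with n have "?E \<in> H" by (rule henkin_rule1)
    then obtain t where "inst (Neg q) t \<in> H" by (auto simp: henkin_Ex)
    then have "Neg (inst q t) \<in> H" by (simp add: inst_def)
    with all show False by (simp add: henkin_Neg)
  qed
qed

lemma henkin_Eq_refl: "Eq t t \<in> H"
  by (rule henkin_deriv[of "[]"]) (simp_all add: deriv.Refl)

lemma henkin_subst:
  assumes "Eq s t \<in> H" "inst p s \<in> H" shows "inst p t \<in> H"
  by (rule henkin_rule2[OF assms]) (rule deriv.Subst; rule deriv_hyp)

lemma henkin_sub_simps:
  "sub \<sigma> (All q) \<in> H \<longleftrightarrow> (\<forall>t. sub (case_nat t \<sigma>) q \<in> H)"
  "sub \<sigma> (Ex q) \<in> H \<longleftrightarrow> (\<exists>t. sub (case_nat t \<sigma>) q \<in> H)"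
  by (simp_all add: henkin_All henkin_Ex inst_sub_up)

lemma henkin_All_funpow:
  "(\<And>\<sigma>. sub \<sigma> ((All ^^ k) q) \<in> H) \<Longrightarrow> sub \<sigma> q \<in> H"
proof (induction k arbitrary: \<sigma>)
  case (Suc k)
  show ?case
  proof (rule Suc.IH)
    fix \<sigma>
    have "sub (\<lambda>n. \<sigma> (Suc n)) (All ((All ^^ k) q)) \<in> H" using Suc.prems by simp
    then have "sub (case_nat (\<sigma> 0) (\<lambda>n. \<sigma> (Suc n))) ((All ^^ k) q) \<in> H"
      by (simp only: henkin_sub_simps)
    also have "case_nat (\<sigma> 0) (\<lambda>n. \<sigma> (Suc n)) = \<sigma>" by (rule nat_ext) simp_all
    finally show "sub \<sigma> ((All ^^ k) q) \<in> H" .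
  qed
qed simp

text \<open>A closed formula is fixed by every substitution, so the quantifiers of the closure can
  be peeled off with arbitrary terms.\<close>

lemma henkin_ucl:
  assumes "ucl q \<in> H" shows "sub \<sigma> q \<in> H"
proof (rule henkin_All_funpow)
  fix \<sigma>
  have "sub \<sigma> (ucl q) = sub Var (ucl q)" by (rule sub_cong) simp
  with assms show "sub \<sigma> ((All ^^ (if fv q = {} then 0 else Suc (Max (fv q)))) q) \<in> H"
    by (simp add: ucl_def del: funpow.simps)
qed

end

section \<open>Semantics and completeness\<close>

locale interp =
  fixes zero one :: 'a and plus times :: "'a \<Rightarrow> 'a \<Rightarrow> 'a" and lt :: "'a \<Rightarrow> 'a \<Rightarrow> bool"
begin

primrec evalt :: "(nat \<Rightarrow> 'a) \<Rightarrow> tm \<Rightarrow> 'a" where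
  "evalt e (Var n) = e n"
| "evalt e Zero = zero"
| "evalt e One = one"
| "evalt e (Plus s t) = plus (evalt e s) (evalt e t)"
| "evalt e (Times s t) = times (evalt e s) (evalt e t)"

primrec sat :: "(nat \<Rightarrow> 'a) \<Rightarrow> fm \<Rightarrow> bool" where
  "sat e (Eq s t) \<longleftrightarrow> evalt e s = evalt e t"
| "sat e (Lt s t) \<longleftrightarrow> lt (evalt e s) (evalt e t)"
| "sat e FF \<longleftrightarrow> False"
| "sat e (Neg p) \<longleftrightarrow> \<not> sat e p"
| "sat e (Conj p q) \<longleftrightarrow> sat e p \<and> sat e q"
| "sat e (Disj p q) \<longleftrightarrow> sat e p \<or> sat e q"
| "sat e (Imp p q) \<longleftrightarrow> (sat e p \<longrightarrow> sat e q)"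
| "sat e (All p) \<longleftrightarrow> (\<forall>x. sat (case_nat x e) p)"
| "sat e (Ex p) \<longleftrightarrow> (\<exists>x. sat (case_nat x e) p)"

lemma evalt_subt: "evalt e (subt \<sigma> t) = evalt (\<lambda>n. evalt e (\<sigma> n)) t"
  by (induction t) auto

lemma evalt_liftt [simp]: "evalt (case_nat x e) (liftt t) = evalt e t"
  by (simp add: liftt_def evalt_subt)

lemma evalt_up: "(\<lambda>n. evalt (case_nat x e) (up \<sigma> n)) = case_nat x (\<lambda>n. evalt e (\<sigma> n))"
  by (rule nat_ext) simp_all

lemma sat_sub: "sat e (sub \<sigma> p) \<longleftrightarrow> sat (\<lambda>n. evalt e (\<sigma> n)) p"
  by (induction p arbitrary: e \<sigma>) (simp_all add: evalt_subt evalt_up)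

lemma sat_All_funpow: "(\<And>e. sat e p) \<Longrightarrow> sat e ((All ^^ k) p)"
  by (induction k arbitrary: e) auto

lemma sat_ucl: "(\<And>e. sat e p) \<Longrightarrow> sat e (ucl p)"
  unfolding ucl_def by (rule sat_All_funpow)

end

text \<open>The arithmetical axioms make the numerals pairwise distinct; this is what makes the term
  model infinite, so that it can be carried by \<open>nat\<close>.\<close>

locale arith_theory = closed_theory +
  assumes PA: "q \<in> PAminus \<Longrightarrow> ucl q \<in> S"
begin

lemma PA_instance: "q \<in> PAminus \<Longrightarrow> sub (case_nat r (case_nat s (case_nat t \<sigma>))) q \<in> H"
  using PA subset_henkin by (blast intro: henkin_ucl)

lemma henkin_Eq_subst:
  assumes "Eq s t \<in> H" "sub (case_nat s Var) p \<in> H"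
  shows "sub (case_nat t Var) p \<in> H"
  using henkin_subst[OF assms(1), of p] assms(2) by (simp add: inst_conv)

lemma henkin_sym: "Eq s t \<in> H \<Longrightarrow> Eq t s \<in> H"
  using henkin_Eq_subst[of s t "Eq (Var 0) (liftt s)"] henkin_Eq_refl
  by (simp add: subt_case_liftt)

lemma henkin_trans: "Eq r s \<in> H \<Longrightarrow> Eq s t \<in> H \<Longrightarrow> Eq r t \<in> H"
  using henkin_Eq_subst[of s t "Eq (liftt r) (Var 0)"] by (simp add: subt_case_liftt)

lemma henkin_cong_Plus:
  assumes "Eq s s' \<in> H" "Eq t t' \<in> H" shows "Eq (Plus s t) (Plus s' t') \<in> H"
proof -
  have "Eq (Plus s t) (Plus s' t) \<in> H"
    using henkin_Eq_subst[OF assms(1), of "Eq (liftt (Plus s t)) (Plus (Var 0) (liftt t))"]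
    by (simp add: subt_case_liftt henkin_Eq_refl)
  then show ?thesis
    using henkin_Eq_subst[OF assms(2), of "Eq (liftt (Plus s t)) (Plus (liftt s') (Var 0))"]
    by (simp add: subt_case_liftt)
qed

lemma henkin_cong_Times:
  assumes "Eq s s' \<in> H" "Eq t t' \<in> H" shows "Eq (Times s t) (Times s' t') \<in> H"
proof -
  have "Eq (Times s t) (Times s' t) \<in> H"
    using henkin_Eq_subst[OF assms(1), of "Eq (liftt (Times s t)) (Times (Var 0) (liftt t))"]
    by (simp add: subt_case_liftt henkin_Eq_refl)
  then show ?thesis
    using henkin_Eq_subst[OF assms(2), of "Eq (liftt (Times s t)) (Times (liftt s') (Var 0))"]
    by (simp add: subt_case_liftt)
qed

lemma henkin_cong_Lt:
  assumes "Eq s s' \<in> H" "Eq t t' \<in> H" "Lt s t \<in> H" shows "Lt s' t' \<in> H"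
proof -
  have "Lt s' t \<in> H"
    using henkin_Eq_subst[OF assms(1), of "Lt (Var 0) (liftt t)"] assms(3)
    by (simp add: subt_case_liftt)
  then show ?thesis
    using henkin_Eq_subst[OF assms(2), of "Lt (liftt s') (Var 0)"]
    by (simp add: subt_case_liftt)
qed

lemma henkin_Lt_trans: "Lt r s \<in> H \<Longrightarrow> Lt s t \<in> H \<Longrightarrow> Lt r t \<in> H"
  using PA_instance[of "Imp (Conj (Lt x0 x1) (Lt x1 x2)) (Lt x0 x2)" r s t Var]
  by (simp add: PAminus_def henkin_Imp henkin_Conj numeral_2_eq_2)

lemma henkin_Lt_irrefl: "Lt t t \<notin> H"
  using PA_instance[of "Neg (Lt x0 x0)" t t t Var] by (simp add: PAminus_def henkin_Neg)

lemma henkin_Lt_succ: "Lt t (Plus t One) \<in> H"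
proof -
  have "Lt Zero One \<in> H"
    using PA_instance[of "Conj (Lt Zero One) (Imp (Lt Zero x0) (Disj (Lt One x0) (Eq One x0)))" t t t Var]
    by (simp add: PAminus_def henkin_Conj)
  then have "Lt (Plus Zero t) (Plus One t) \<in> H"
    using PA_instance[of "Imp (Lt x0 x1) (Lt (Plus x0 x2) (Plus x1 x2))" Zero One t Var]
    by (simp add: PAminus_def henkin_Imp numeral_2_eq_2)
  moreover have comm: "Eq (Plus s t) (Plus t s) \<in> H" for s
    using PA_instance[of "Eq (Plus x0 x1) (Plus x1 x0)" s t t Var] by (simp add: PAminus_def)
  moreover have "Eq (Plus t Zero) t \<in> H"
    using PA_instance[of "Conj (Eq (Plus x0 Zero) x0) (Eq (Times x0 Zero) Zero)" t t t Var]
    by (simp add: PAminus_def henkin_Conj)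
  ultimately show ?thesis
    by (blast intro: henkin_cong_Lt henkin_trans)
qed

primrec num :: "nat \<Rightarrow> tm" where
  "num 0 = Zero"
| "num (Suc n) = Plus (num n) One"

lemma henkin_num_less: "i < j \<Longrightarrow> Lt (num i) (num j) \<in> H"
proof (induction j)
  case (Suc j)
  then show ?case
    using henkin_Lt_succ[of "num j"] henkin_Lt_trans by (cases "i = j") auto
qed simp

definition eqclass :: "tm \<Rightarrow> tm set" where
  "eqclass t = {s. Eq s t \<in> H}"

lemma eqclass_eq: "eqclass s = eqclass t \<longleftrightarrow> Eq s t \<in> H"
  unfolding eqclass_def using henkin_Eq_refl henkin_sym henkin_trans by blast

lemma infinite_eqclass: "infinite (range eqclass)"
proof -
  have "inj (\<lambda>n. eqclass (num n))"
  proof (rule linorder_injI)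
    fix i j :: nat assume "i < j"
    then have "Lt (num i) (num j) \<in> H" by (rule henkin_num_less)
    then show "eqclass (num i) \<noteq> eqclass (num j)"
      using henkin_cong_Lt[OF henkin_Eq_refl, of "num j" "num i" "num i"] henkin_Lt_irrefl
      by (auto simp: eqclass_eq dest: henkin_sym)
  qed
  then have "infinite (range (\<lambda>n. eqclass (num n)))" by (rule range_inj_infinite)
  then show ?thesis by (rule infinite_super[rotated]) auto
qed

text \<open>Numbering infinitely many classes by \<open>to_nat_on\<close> is onto, so
  \<open>val\<close> maps the terms onto all of \<open>nat\<close>, identifying two of them exactly
  when \<open>H\<close> contains their equation.\<close>

definition val :: "tm \<Rightarrow> nat" where
  "val t = to_nat_on (range eqclass) (eqclass t)"

definition rep :: "nat \<Rightarrow> tm" where "rep = inv val"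

lemma val_eq: "val s = val t \<longleftrightarrow> Eq s t \<in> H"
proof -
  have "inj_on (to_nat_on (range eqclass)) (range eqclass)" by (rule inj_on_to_nat_on) simp
  then show ?thesis unfolding val_def eqclass_eq[symmetric]
    by (rule inj_on_eq_iff) auto
qed

lemma surj_val: "surj val"
proof -
  have "range val = to_nat_on (range eqclass) ` range eqclass"
    by (auto simp: val_def)
  also have "\<dots> = UNIV"
    using to_nat_on_infinite[OF _ infinite_eqclass] by (simp add: bij_betw_def)
  finally show ?thesis .
qed

lemma Eq_rep_val: "Eq (rep (val t)) t \<in> H"
  using surj_f_inv_f[OF surj_val, of "val t"] by (simp add: rep_def val_eq)

definition "plus_of i j = val (Plus (rep i) (rep j))"
definition "times_of i j = val (Times (rep i) (rep j))"
definition "lt_of i j \<longleftrightarrow> Lt (rep i) (rep j) \<in> H"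

lemma ops_val [simp]:
  "plus_of (val s) (val t) = val (Plus s t)"
  "times_of (val s) (val t) = val (Times s t)"
  "lt_of (val s) (val t) \<longleftrightarrow> Lt s t \<in> H"
  using henkin_cong_Lt[OF Eq_rep_val Eq_rep_val, of s t]
    henkin_cong_Lt[OF henkin_sym[OF Eq_rep_val] henkin_sym[OF Eq_rep_val], of s t]
  by (auto simp: plus_of_def times_of_def lt_of_def val_eq henkin_cong_Plus henkin_cong_Times Eq_rep_val)

sublocale M: interp "val Zero" "val One" plus_of times_of lt_of .

lemma evalt_val: "M.evalt (\<lambda>n. val (\<sigma> n)) t = val (subt \<sigma> t)"
  by (induction t) simp_all

lemma all_val: "(\<forall>x. P x) \<longleftrightarrow> (\<forall>t. P (val t))"
  using surj_val by (metis surjD)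

lemma ex_val: "(\<exists>x. P x) \<longleftrightarrow> (\<exists>t. P (val t))"
  using surj_val by (metis surjD)

lemma case_nat_val: "case_nat (val t) (\<lambda>n. val (\<sigma> n)) = (\<lambda>n. val (case_nat t \<sigma> n))"
  by (rule nat_ext) simp_all

text \<open>The truth lemma. Since \<open>val\<close> is onto, quantifiers over the model are
  quantifiers over terms, which the Henkin clauses control.\<close>

lemma sat_val: "M.sat (\<lambda>n. val (\<sigma> n)) p \<longleftrightarrow> sub \<sigma> p \<in> H"
proof (induction p arbitrary: \<sigma>)
  case (All p)
  have "M.sat (\<lambda>n. val (\<sigma> n)) (All p) \<longleftrightarrow> (\<forall>t. M.sat (case_nat (val t) (\<lambda>n. val (\<sigma> n))) p)"
    by (subst M.sat.simps, subst all_val) (rule refl)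
  then show ?case unfolding henkin_sub_simps case_nat_val All.IH .
next
  case (Ex p)
  have "M.sat (\<lambda>n. val (\<sigma> n)) (Ex p) \<longleftrightarrow> (\<exists>t. M.sat (case_nat (val t) (\<lambda>n. val (\<sigma> n))) p)"
    by (subst M.sat.simps, subst ex_val) (rule refl)
  then show ?case unfolding henkin_sub_simps case_nat_val Ex.IH .
qed (simp_all add: evalt_val val_eq henkin_FF henkin_Neg henkin_Conj henkin_Disj henkin_Imp)

lemma sat_ucl_mem:
  assumes "ucl q \<in> S" shows "M.sat e q"
proof -
  have "e = (\<lambda>n. val (rep (e n)))" using surj_f_inv_f[OF surj_val] by (simp add: rep_def)
  then show ?thesis
    using sat_val[of "\<lambda>n. rep (e n)" q] henkin_ucl[of q "\<lambda>n. rep (e n)"] assms subset_henkin by auto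
qed

lemma not_sat_Neg_mem: "Neg p \<in> S \<Longrightarrow> \<not> M.sat (\<lambda>n. val (Var n)) p"
  using sat_val[of Var p] henkin_Neg[of p] subset_henkin by auto

end

theorem completeness:
  assumes PA: "PAminus \<subseteq> T"
    and models: "\<And>zero one plus times lt e. (\<And>q e. q \<in> T \<Longrightarrow> interp.sat (zero::nat) one plus times lt e q)
      \<Longrightarrow> interp.sat zero one plus times lt e p"
  shows "Prov T (ucl p)"
proof (rule ccontr)
  assume np: "\<not> Prov T (ucl p)"
  define S where "S = insert (Neg (ucl p)) (ucl ` T)"
  have "consistent S"
  proof (rule ccontr)
    assume "\<not> consistent S"
    then obtain G where "set G \<subseteq> ucl ` T" "deriv (Neg (ucl p) # G) FF"
      unfolding S_def by (rule inconsistent_insert)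
    then show False using np deriv.Class unfolding Prov_def by blast
  qed
  then interpret arith_theory S
    by unfold_locales (use PA in \<open>auto simp: S_def\<close>)
  have "M.sat e p" for e
    by (rule models) (rule sat_ucl_mem, simp add: S_def)
  then have "M.sat (\<lambda>n. val (Var n)) (ucl p)" by (rule M.sat_ucl)
  with not_sat_Neg_mem show False by (simp add: S_def)
qed

section \<open>Definable predicates\<close>

lemma nat_ext2:
  "f 0 = g 0 \<Longrightarrow> f 1 = g 1 \<Longrightarrow> (\<And>n. f (Suc (Suc n)) = g (Suc (Suc n))) \<Longrightarrow> f = g"
  by (rule ext) (metis One_nat_def nat.exhaust)

lemma sub_BEx: "sub \<sigma> (BEx t p) = BEx (subt \<sigma> t) (sub (up \<sigma>) p)"
  and sub_BAll: "sub \<sigma> (BAll t p) = BAll (subt \<sigma> t) (sub (up \<sigma>) p)"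
  by (simp_all add: BEx_def BAll_def liftt_subt)

definition sub_closed :: "fm set \<Rightarrow> bool" where
  "sub_closed \<Gamma> \<longleftrightarrow> (\<forall>p\<in>\<Gamma>. \<forall>\<sigma>. sub \<sigma> p \<in> \<Gamma>)"

context interp
begin

lemma sat_BEx [simp]: "sat e (BEx t p) \<longleftrightarrow> (\<exists>x. lt x (evalt e t) \<and> sat (case_nat x e) p)"
  and sat_BAll [simp]: "sat e (BAll t p) \<longleftrightarrow> (\<forall>x. lt x (evalt e t) \<longrightarrow> sat (case_nat x e) p)"
  by (simp_all add: BEx_def BAll_def)

lemma sat_Coll:
  "sat (case_nat a e) (Coll p) \<longleftrightarrow>
    ((\<forall>x. lt x a \<longrightarrow> (\<exists>y. sat (case_nat x (case_nat y e)) p)) \<longrightarrow>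
     (\<exists>b. \<forall>x. lt x a \<longrightarrow> (\<exists>y. lt y b \<and> sat (case_nat x (case_nat y e)) p)))"
proof -
  have "(\<lambda>n. evalt (case_nat y (case_nat x (case_nat a e)))
      (if n = 0 then Var 1 else if n = 1 then Var 0 else Var (n + 1))) = case_nat x (case_nat y e)" for x y
    by (rule nat_ext2; simp)
  moreover have "(\<lambda>n. evalt (case_nat y (case_nat x (case_nat b (case_nat a e))))
      (if n = 0 then Var 1 else if n = 1 then Var 0 else Var (n + 2))) = case_nat x (case_nat y e)" for x y b
    by (rule nat_ext2; simp)
  ultimately show ?thesis by (simp add: Coll_def sat_sub)
qed

lemma sat_WRax:
  "sat (case_nat a e) (WRax p) \<longleftrightarrow>
    ((\<forall>x. \<exists>y. lt y a \<and> sat (case_nat x (case_nat y e)) p) \<longrightarrow>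
     (\<exists>y. lt y a \<and> (\<forall>b. \<exists>x. lt b x \<and> sat (case_nat x (case_nat y e)) p)))"
proof -
  have "(\<lambda>n. evalt (case_nat y (case_nat x (case_nat a e)))
      (if n = 0 then Var 1 else if n = 1 then Var 0 else Var (n + 1))) = case_nat x (case_nat y e)" for x y
    by (rule nat_ext2; simp)
  moreover have "(\<lambda>n. evalt (case_nat x (case_nat b (case_nat y (case_nat a e))))
      (if n = 0 then Var 0 else if n = 1 then Var 2 else Var (n + 2))) = case_nat x (case_nat y e)" for x y b
    by (rule nat_ext2; simp add: numeral_2_eq_2)
  ultimately show ?thesis by (simp add: WRax_def sat_sub)
qed

lemma sat_Ind:
  "sat e (Ind p) \<longleftrightarrow> (sat (case_nat zero e) p \<and>
    (\<forall>x. sat (case_nat x e) p \<longrightarrow> sat (case_nat (plus x one) e) p) \<longrightarrow> (\<forall>x. sat (case_nat x e) p))"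
proof -
  have "(\<lambda>n. evalt (case_nat x e) (if n = 0 then Plus (Var 0) One else Var n))
      = case_nat (plus x one) e" for x
    by (rule nat_ext; simp)
  moreover have "(\<lambda>n. evalt e (case_nat Zero Var n)) = case_nat zero e"
    by (rule nat_ext; simp)
  ultimately show ?thesis by (simp add: Ind_def sat_sub inst_conv)
qed

text \<open>Environments of definable predicates interleave variables (even indices) and
  parameters (odd indices), so that constants of the model may occur freely below.\<close>

definition mix :: "(nat \<Rightarrow> 'a) \<Rightarrow> (nat \<Rightarrow> 'a) \<Rightarrow> nat \<Rightarrow> 'a" where
  "mix e c n = (if even n then e (n div 2) else c (n div 2))"

text \<open>Definability with parameters. Complexity calculations become syntax-directed
  applications of closure rules to HOL predicates, and the arithmetic can be done without reference
  to de Bruijn indices.\<close>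

definition dfn :: "fm set \<Rightarrow> ((nat \<Rightarrow> 'a) \<Rightarrow> bool) \<Rightarrow> bool" where
  "dfn \<Gamma> P \<longleftrightarrow> (\<exists>p\<in>\<Gamma>. \<exists>c. \<forall>e. P e \<longleftrightarrow> sat (mix e c) p)"

definition tfn :: "((nat \<Rightarrow> 'a) \<Rightarrow> 'a) \<Rightarrow> bool" where
  "tfn f \<longleftrightarrow> (\<exists>t c. \<forall>e. f e = evalt (mix e c) t)"

definition efn :: "((nat \<Rightarrow> 'a) \<Rightarrow> nat \<Rightarrow> 'a) \<Rightarrow> bool" where
  "efn g \<longleftrightarrow> (\<exists>t c. \<forall>e n. g e n = evalt (mix e c) (t n))"

text \<open>Two formulas usually come with different parameter environments \<open>c\<close> and
  \<open>d\<close>; \<open>lft\<close> and \<open>rgt\<close> read either of them off the merged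
  environment \<open>mix c d\<close>.\<close>

definition lft :: "nat \<Rightarrow> tm" where "lft n = (if even n then Var n else Var (2 * n - 1))"
definition rgt :: "nat \<Rightarrow> tm" where "rgt n = (if even n then Var n else Var (2 * n + 1))"
definition sft :: "nat \<Rightarrow> tm" where
  "sft n = (if n = 0 then Var 0 else if even n then Var (n - 1) else Var (Suc n))"

lemma mix_lft: "(\<lambda>n. evalt (mix e (mix c d)) (lft n)) = mix e c"
proof
  fix n show "evalt (mix e (mix c d)) (lft n) = mix e c n"
  proof (cases "even n")
    case False
    then obtain j where j: "n = 2 * j + 1" by (rule oddE)
    then have "2 * n - 1 = 2 * (2 * j) + 1" by simp
    with j show ?thesis by (simp add: mix_def lft_def)
  qed (simp add: mix_def lft_def)
qed

lemma mix_rgt: "(\<lambda>n. evalt (mix e (mix c d)) (rgt n)) = mix e d"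
  by (rule ext) (simp add: mix_def rgt_def)

lemma mix_sft: "(\<lambda>n. evalt (case_nat y (mix e c)) (sft n)) = mix (case_nat y e) c"
proof
  fix n
  show "evalt (case_nat y (mix e c)) (sft n) = mix (case_nat y e) c n"
  proof (cases "even n")
    case True
    then obtain m where m: "n = 2 * m" by (elim evenE)
    show ?thesis
    proof (cases m)
      case (Suc k)
      then have "n - 1 = Suc (2 * k)" "n div 2 = Suc k" using m by simp_all
      then show ?thesis using True m Suc by (simp add: mix_def sft_def)
    qed (use m in \<open>simp add: mix_def sft_def\<close>)
  qed (auto simp: mix_def sft_def)
qed

lemma mix_lft_sat: "sat (mix e c) p = sat (mix e (mix c d)) (sub lft p)"
  by (simp add: sat_sub mix_lft)

lemma mix_rgt_sat: "sat (mix e d) p = sat (mix e (mix c d)) (sub rgt p)"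
  by (simp add: sat_sub mix_rgt)

lemma mix_lft_evalt: "evalt (mix e c) t = evalt (mix e (mix c d)) (subt lft t)"
  by (simp add: evalt_subt mix_lft)

lemma mix_rgt_evalt: "evalt (mix e d) t = evalt (mix e (mix c d)) (subt rgt t)"
  by (simp add: evalt_subt mix_rgt)

lemma tfn_var: "tfn (\<lambda>e. e k)"
  unfolding tfn_def by (rule exI[of _ "Var (2 * k)"]) (simp add: mix_def)

lemma tfn_const: "tfn (\<lambda>e. c)"
  unfolding tfn_def by (rule exI[of _ "Var 1"], rule exI[of _ "\<lambda>_. c"]) (simp add: mix_def)

lemma tfn_op2:
  assumes "tfn f" "tfn g" "\<And>e s t. evalt e (T s t) = h (evalt e s) (evalt e t)"
  shows "tfn (\<lambda>e. h (f e) (g e))"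
proof -
  obtain s c t d where "\<And>e. f e = evalt (mix e c) s" "\<And>e. g e = evalt (mix e d) t"
    using assms(1,2) unfolding tfn_def by blast
  then have "h (f e) (g e) = evalt (mix e (mix c d)) (T (subt lft s) (subt rgt t))" for e
    by (simp add: assms(3) mix_lft_evalt[symmetric] mix_rgt_evalt[symmetric])
  then show ?thesis unfolding tfn_def by blast
qed

lemma tfn_plus: "tfn f \<Longrightarrow> tfn g \<Longrightarrow> tfn (\<lambda>e. plus (f e) (g e))"
  by (rule tfn_op2[where T = Plus]) simp_all

lemma tfn_times: "tfn f \<Longrightarrow> tfn g \<Longrightarrow> tfn (\<lambda>e. times (f e) (g e))"
  by (rule tfn_op2[where T = Times]) simp_all

lemmas tfn_intros = tfn_var tfn_const tfn_plus tfn_times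

lemma efn_const: "efn (\<lambda>e. c)"
  unfolding efn_def by (rule exI[of _ "\<lambda>n. Var (2 * n + 1)"], rule exI[of _ c]) (simp add: mix_def)

lemma efn_id: "efn (\<lambda>e. e)"
  unfolding efn_def by (rule exI[of _ "\<lambda>n. Var (2 * n)"]) (simp add: mix_def)

lemma efn_ren: "efn (\<lambda>e n. e (s n))"
  unfolding efn_def by (rule exI[of _ "\<lambda>n. Var (2 * s n)"]) (simp add: mix_def)

lemma efn_case:
  assumes "tfn f" "efn g" shows "efn (\<lambda>e. case_nat (f e) (g e))"
proof -
  obtain s c t d where 1: "\<And>e. f e = evalt (mix e c) s" "\<And>e n. g e n = evalt (mix e d) (t n)"
    using assms unfolding efn_def tfn_def by blast
  have "case_nat (f e) (g e) n
      = evalt (mix e (mix c d)) (case_nat (subt lft s) (\<lambda>n. subt rgt (t n)) n)" for e n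
    by (cases n) (simp_all add: 1 mix_lft_evalt[symmetric] mix_rgt_evalt[symmetric])
  then show ?thesis unfolding efn_def by (intro exI allI) assumption
qed

lemma dfn_mono: "\<Gamma> \<subseteq> \<Delta> \<Longrightarrow> dfn \<Gamma> P \<Longrightarrow> dfn \<Delta> P"
  unfolding dfn_def by blast

lemma dfn_sat:
  assumes "sub_closed \<Gamma>" "p \<in> \<Gamma>" shows "dfn \<Gamma> (\<lambda>e. sat e p)"
proof -
  have "sat e p \<longleftrightarrow> sat (mix e e) (sub (\<lambda>n. Var (2 * n)) p)" for e
    by (simp add: sat_sub mix_def)
  moreover have "mix e e = mix e c \<or> sat (mix e e) (sub (\<lambda>n. Var (2 * n)) p)
      = sat (mix e c) (sub (\<lambda>n. Var (2 * n)) p)" for e c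
    by (simp add: sat_sub mix_def)
  ultimately show ?thesis
    using assms unfolding dfn_def sub_closed_def by (metis (no_types, lifting))
qed

lemma dfn_subst:
  assumes "sub_closed \<Gamma>" "dfn \<Gamma> P" "efn g" shows "dfn \<Gamma> (\<lambda>e. P (g e))"
proof -
  obtain p c where p: "p \<in> \<Gamma>" "\<And>e. P e \<longleftrightarrow> sat (mix e c) p"
    using assms(2) unfolding dfn_def by blast
  obtain t d where t: "\<And>e n. g e n = evalt (mix e d) (t n)"
    using assms(3) unfolding efn_def by blast
  define \<rho> where "\<rho> n = (if even n then subt rgt (t (n div 2)) else lft n)" for n
  have "(\<lambda>n. evalt (mix e (mix c d)) (\<rho> n)) = mix (g e) c" for e
  proof
    fix n show "evalt (mix e (mix c d)) (\<rho> n) = mix (g e) c n"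
      using fun_cong[OF mix_lft[of e c d], of n]
      by (simp add: \<rho>_def t mix_rgt_evalt[symmetric] mix_def[of _ c])
  qed
  then have "P (g e) \<longleftrightarrow> sat (mix e (mix c d)) (sub \<rho> p)" for e
    by (simp add: p(2) sat_sub)
  moreover have "sub \<rho> p \<in> \<Gamma>" using assms(1) p(1) by (simp add: sub_closed_def)
  ultimately show ?thesis unfolding dfn_def by blast
qed

lemma dfn_cong: "dfn \<Gamma> P \<Longrightarrow> (\<And>e. P e \<longleftrightarrow> Q e) \<Longrightarrow> dfn \<Gamma> Q"
  unfolding dfn_def by simp

lemma dfn_op1:
  assumes "dfn \<Gamma> P" "\<And>p. p \<in> \<Gamma> \<Longrightarrow> F p \<in> \<Delta>" "\<And>e p. sat e (F p) \<longleftrightarrow> h (sat e p)"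
  shows "dfn \<Delta> (\<lambda>e. h (P e))"
proof -
  obtain p c where "p \<in> \<Gamma>" "\<And>e. P e \<longleftrightarrow> sat (mix e c) p"
    using assms(1) unfolding dfn_def by blast
  then show ?thesis
    unfolding dfn_def by (intro bexI[of _ "F p"] exI[of _ c]) (simp_all add: assms(2,3))
qed

lemma dfn_op2:
  assumes "dfn \<Gamma> P" "dfn \<Delta> Q" "sub_closed \<Gamma>" "sub_closed \<Delta>"
    "\<And>p q. p \<in> \<Gamma> \<Longrightarrow> q \<in> \<Delta> \<Longrightarrow> F p q \<in> \<Theta>"
    "\<And>e p q. sat e (F p q) \<longleftrightarrow> h (sat e p) (sat e q)"
  shows "dfn \<Theta> (\<lambda>e. h (P e) (Q e))"
proof -
  obtain p c q d where 1: "p \<in> \<Gamma>" "q \<in> \<Delta>" "\<And>e. P e \<longleftrightarrow> sat (mix e c) p" "\<And>e. Q e \<longleftrightarrow> sat (mix e d) q"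
    using assms(1,2) unfolding dfn_def by blast
  then have "h (P e) (Q e) \<longleftrightarrow> sat (mix e (mix c d)) (F (sub lft p) (sub rgt q))" for e
    by (simp add: assms(6) mix_lft_sat[symmetric] mix_rgt_sat[symmetric])
  moreover have "F (sub lft p) (sub rgt q) \<in> \<Theta>"
    using 1 assms(3,4,5) by (simp add: sub_closed_def)
  ultimately show ?thesis unfolding dfn_def by blast
qed

text \<open>A quantifier pushes its value in front of the whole interleaved environment, whereas a
  predicate expects it in front of the variables only; the renaming \<open>sft\<close>
  mediates.\<close>

lemma dfn_binder_form:
  assumes "sub_closed \<Gamma>" "dfn \<Gamma> (\<lambda>e. R (e 0) (\<lambda>n. e (Suc n)))"
  obtains p c where "p \<in> \<Gamma>" "\<And>y e. R y e \<longleftrightarrow> sat (case_nat y (mix e c)) p"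
proof -
  obtain p c where p: "p \<in> \<Gamma>" "\<And>e. R (e 0) (\<lambda>n. e (Suc n)) \<longleftrightarrow> sat (mix e c) p"
    using assms(2) unfolding dfn_def by blast
  have "R y e \<longleftrightarrow> sat (case_nat y (mix e c)) (sub sft p)" for y e
    using p(2)[of "case_nat y e"] by (simp add: sat_sub mix_sft)
  then show ?thesis using that[of "sub sft p" c] assms(1) p(1) by (simp add: sub_closed_def)
qed

lemma dfn_ex:
  assumes "sub_closed \<Gamma>" "\<And>p. p \<in> \<Gamma> \<Longrightarrow> Ex p \<in> \<Delta>" "dfn \<Gamma> (\<lambda>e. R (e 0) (\<lambda>n. e (Suc n)))"
  shows "dfn \<Delta> (\<lambda>e. \<exists>y. R y e)"
proof -
  obtain p c where "p \<in> \<Gamma>" "\<And>y e. R y e \<longleftrightarrow> sat (case_nat y (mix e c)) p"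
    using dfn_binder_form[OF assms(1,3)] by blast
  then show ?thesis unfolding dfn_def by (intro bexI[of _ "Ex p"] exI[of _ c]) (simp_all add: assms(2))
qed

lemma dfn1:
  assumes "sub_closed \<Gamma>" "dfn \<Gamma> (\<lambda>e. A (e 0))" "tfn f"
  shows "dfn \<Gamma> (\<lambda>e. A (f e))"
proof -
  have "efn (\<lambda>e. case_nat (f e) e)" by (intro efn_case efn_id assms(3))
  from dfn_subst[OF assms(1,2) this] show ?thesis by simp
qed

lemma dfn2:
  assumes "sub_closed \<Gamma>" "dfn \<Gamma> (\<lambda>e. A (e 0) (e 1))" "tfn f" "tfn g"
  shows "dfn \<Gamma> (\<lambda>e. A (f e) (g e))"
proof -
  have "efn (\<lambda>e. case_nat (f e) (case_nat (g e) e))" by (intro efn_case efn_id assms(3,4))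
  from dfn_subst[OF assms(1,2) this] show ?thesis by simp
qed

lemma dfn3:
  assumes "sub_closed \<Gamma>" "dfn \<Gamma> (\<lambda>e. A (e 0) (e 1) (e 2))" "tfn f" "tfn g" "tfn h"
  shows "dfn \<Gamma> (\<lambda>e. A (f e) (g e) (h e))"
proof -
  have "efn (\<lambda>e. case_nat (f e) (case_nat (g e) (case_nat (h e) e)))"
    by (intro efn_case efn_id assms(3-5))
  from dfn_subst[OF assms(1,2) this] show ?thesis by (simp add: numeral_2_eq_2)
qed

lemma dfn4:
  assumes "sub_closed \<Gamma>" "dfn \<Gamma> (\<lambda>e. A (e 0) (e 1) (e 2) (e 3))" "tfn f" "tfn g" "tfn h" "tfn k"
  shows "dfn \<Gamma> (\<lambda>e. A (f e) (g e) (h e) (k e))"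
proof -
  have "efn (\<lambda>e. case_nat (f e) (case_nat (g e) (case_nat (h e) (case_nat (k e) e))))"
    by (intro efn_case efn_id assms(3-6))
  from dfn_subst[OF assms(1,2) this] show ?thesis by (simp add: numeral_2_eq_2 numeral_3_eq_3)
qed

lemma dfn1_formula:
  assumes "sub_closed \<Gamma>" "dfn \<Gamma> (\<lambda>e. A (e 0))"
  obtains p c where "p \<in> \<Gamma>" "\<And>x. A x \<longleftrightarrow> sat (case_nat x c) p"
proof -
  obtain p c where "p \<in> \<Gamma>" "\<And>x e. A x \<longleftrightarrow> sat (case_nat x (mix e c)) p"
    using dfn_binder_form[of \<Gamma> "\<lambda>x e. A x"] assms by blast
  then show ?thesis using that by blast
qed

lemma dfn2_formula:
  assumes "sub_closed \<Gamma>" "dfn \<Gamma> (\<lambda>e. A (e 0) (e 1))"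
  obtains p c where "p \<in> \<Gamma>" "\<And>x y. A x y \<longleftrightarrow> sat (case_nat x (case_nat y c)) p"
proof -
  obtain p c where p: "p \<in> \<Gamma>" "\<And>e. A (e 0) (e 1) \<longleftrightarrow> sat (mix e c) p"
    using assms(2) unfolding dfn_def by blast
  \<comment> \<open>Back to the layout of \<open>Coll\<close> and \<open>WRax\<close>: the second
    variable moves from index 2 to index 1, and everything else lies behind these two, the variables
    beyond the second being valued \<open>zero\<close>.\<close>
  define \<rho> where "\<rho> n = (if n = 0 then Var 0 else if n = 2 then Var 1 else Var (n + 2))" for n
  have "(\<lambda>n. evalt (case_nat x (case_nat y (mix (\<lambda>_. zero) c))) (\<rho> n))
      = mix (case_nat x (case_nat y (\<lambda>_. zero))) c" for x y
  proof
    fix n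
    consider "n = 0" | "n = 2" | "odd n" | m where "n = 2 * Suc (Suc m)"
      by (metis One_nat_def Suc_1 dvdE mult_0_right nat.exhaust nat_mult_1_right)
    then show "evalt (case_nat x (case_nat y (mix (\<lambda>_. zero) c))) (\<rho> n)
      = mix (case_nat x (case_nat y (\<lambda>_. zero))) c n"
      by cases (auto simp: \<rho>_def mix_def)
  qed
  then have "A x y \<longleftrightarrow> sat (case_nat x (case_nat y (mix (\<lambda>_. zero) c))) (sub \<rho> p)" for x y
    using p(2)[of "case_nat x (case_nat y (\<lambda>_. zero))"] by (simp add: sat_sub)
  then show ?thesis using that[of "sub \<rho> p"] assms(1) p(1) by (simp add: sub_closed_def)
qed

end

section \<open>The arithmetical hierarchy\<close>

lemma sub_closed_Sigma0_cl:
  assumes "sub_closed \<Gamma>" shows "sub_closed (Sigma0_cl \<Gamma>)"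
proof -
  have "sub \<sigma> p \<in> Sigma0_cl \<Gamma>" if "p \<in> Sigma0_cl \<Gamma>" for p \<sigma>
    using that
  proof (induction arbitrary: \<sigma>)
    case (base p)
    then show ?case using assms by (auto simp: sub_closed_def intro: Sigma0_cl.base)
  qed (auto simp: sub_BEx sub_BAll intro: Sigma0_cl.intros)
  then show ?thesis by (simp add: sub_closed_def)
qed

lemma sub_closed_Delta0: "sub_closed Delta0"
  unfolding Delta0_def by (rule sub_closed_Sigma0_cl) (simp add: sub_closed_def)

lemma sub_funpow_Ex: "\<exists>\<tau>. sub \<sigma> ((Ex ^^ k) p) = (Ex ^^ k) (sub \<tau> p)"
proof (induction k arbitrary: \<sigma>)
  case (Suc k)
  from Suc[of "up \<sigma>"] show ?case by simp
qed auto

lemma sub_funpow_All: "\<exists>\<tau>. sub \<sigma> ((All ^^ k) p) = (All ^^ k) (sub \<tau> p)"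
proof (induction k arbitrary: \<sigma>)
  case (Suc k)
  from Suc[of "up \<sigma>"] show ?case by simp
qed auto

lemma Sig_0 [simp]: "Sig 0 = Delta0" and Pi_0 [simp]: "Pi 0 = Delta0"
  by (simp_all add: Sig_def Pi_def)

lemma Sig_Suc: "Sig (Suc n) = {(Ex ^^ k) p | k p. p \<in> Pi n}"
  and Pi_Suc: "Pi (Suc n) = {(All ^^ k) p | k p. p \<in> Sig n}"
  by (simp_all add: Sig_def Pi_def)

lemma sub_closed_Sig_Pi: "sub_closed (Sig n) \<and> sub_closed (Pi n)"
proof (induction n)
  case 0 then show ?case by (simp add: sub_closed_Delta0)
next
  case (Suc n)
  show ?case
    unfolding sub_closed_def
  proof (intro conjI ballI allI)
    fix p \<sigma> assume "p \<in> Sig (Suc n)"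
    then obtain k q where q: "p = (Ex ^^ k) q" "q \<in> Pi n" unfolding Sig_Suc by blast
    obtain \<tau> where "sub \<sigma> p = (Ex ^^ k) (sub \<tau> q)" using sub_funpow_Ex q(1) by blast
    moreover have "sub \<tau> q \<in> Pi n" using Suc q(2) unfolding sub_closed_def by blast
    ultimately show "sub \<sigma> p \<in> Sig (Suc n)" unfolding Sig_Suc by blast
  next
    fix p \<sigma> assume "p \<in> Pi (Suc n)"
    then obtain k q where q: "p = (All ^^ k) q" "q \<in> Sig n" unfolding Pi_Suc by blast
    obtain \<tau> where "sub \<sigma> p = (All ^^ k) (sub \<tau> q)" using sub_funpow_All q(1) by blast
    moreover have "sub \<tau> q \<in> Sig n" using Suc q(2) unfolding sub_closed_def by blast
    ultimately show "sub \<sigma> p \<in> Pi (Suc n)" unfolding Pi_Suc by blast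
  qed
qed

lemma sub_closed_classes [simp]:
  "sub_closed Delta0" "sub_closed (Sig n)" "sub_closed (Pi n)" "sub_closed (Sigma0_cl (Sig n))"
  using sub_closed_Sig_Pi sub_closed_Delta0 sub_closed_Sigma0_cl by blast+

lemma Pi_subset_Sig_Suc: "Pi n \<subseteq> Sig (Suc n)"
proof
  fix p assume "p \<in> Pi n"
  then have "(Ex ^^ 0) p \<in> Sig (Suc n)" unfolding Sig_Suc by blast
  then show "p \<in> Sig (Suc n)" by simp
qed

lemma Sig_subset_Pi_Suc: "Sig n \<subseteq> Pi (Suc n)"
proof
  fix p assume "p \<in> Sig n"
  then have "(All ^^ 0) p \<in> Pi (Suc n)" unfolding Pi_Suc by blast
  then show "p \<in> Pi (Suc n)" by simp
qed

lemma Sig_Pi_mono_Suc: "Sig n \<subseteq> Sig (Suc n) \<and> Pi n \<subseteq> Pi (Suc n)"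
proof (induction n)
  case 0
  then show ?case using Pi_subset_Sig_Suc[of 0] Sig_subset_Pi_Suc[of 0] by simp
next
  case (Suc n)
  then show ?case unfolding Sig_Suc Pi_Suc by blast
qed

lemma Sig_subset_Sig_Suc: "Sig n \<subseteq> Sig (Suc n)"
  using Sig_Pi_mono_Suc by auto

lemma Delta0_subset: "Delta0 \<subseteq> Sig n" "Delta0 \<subseteq> Pi n"
  using lift_Suc_mono_le[of Sig 0 n] lift_Suc_mono_le[of Pi 0 n] Sig_Pi_mono_Suc by auto

lemma Sigma0_cl_mono: "\<Gamma> \<subseteq> \<Delta> \<Longrightarrow> Sigma0_cl \<Gamma> \<subseteq> Sigma0_cl \<Delta>"
proof
  fix p assume "\<Gamma> \<subseteq> \<Delta>" "p \<in> Sigma0_cl \<Gamma>"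
  from this(2,1) show "p \<in> Sigma0_cl \<Delta>" by induction (auto intro: Sigma0_cl.intros)
qed

lemma Sigma0_cl_Delta0: "Sigma0_cl Delta0 = Delta0"
proof
  show "Sigma0_cl Delta0 \<subseteq> Delta0"
  proof
    fix p assume "p \<in> Sigma0_cl Delta0"
    then show "p \<in> Delta0"
    proof induction
      case (base p) then show ?case .
    qed (auto simp: Delta0_def intro: Sigma0_cl.intros)
  qed
qed (auto intro: Sigma0_cl.base)

lemma Delta0_subset_Sigma0_cl: "Delta0 \<subseteq> Sigma0_cl \<Gamma>"
  unfolding Delta0_def by (rule Sigma0_cl_mono) simp

lemma Ex_Sig_Suc: "p \<in> Sig (Suc n) \<Longrightarrow> Ex p \<in> Sig (Suc n)"
proof -
  assume "p \<in> Sig (Suc n)"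
  then obtain k q where "p = (Ex ^^ k) q" "q \<in> Pi n" unfolding Sig_Suc by blast
  then have "Ex p = (Ex ^^ Suc k) q" "q \<in> Pi n" by simp_all
  then show ?thesis unfolding Sig_Suc by blast
qed

context interp
begin

lemma sat_neg_ex: "(\<And>e. sat e q \<longleftrightarrow> \<not> sat e p) \<Longrightarrow> sat e ((All ^^ k) q) \<longleftrightarrow> \<not> sat e ((Ex ^^ k) p)"
  by (induction k arbitrary: e) auto

text \<open>\<open>Sig\<close> and \<open>Pi\<close> are literal prenex classes, which
  \<open>Neg\<close> leaves once there are quantifiers in front; negation is recovered up to truth
  in the structure, by a formula of the dual class.\<close>

lemma neg_Sig_Pi:
  "(\<forall>p\<in>Sig n. \<exists>q\<in>Pi n. \<forall>e. sat e q \<longleftrightarrow> \<not> sat e p) \<and> (\<forall>p\<in>Pi n. \<exists>q\<in>Sig n. \<forall>e. sat e q \<longleftrightarrow> \<not> sat e p)"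
proof (induction n)
  case 0
  have "\<exists>q\<in>Delta0. \<forall>e. sat e q \<longleftrightarrow> \<not> sat e p" if "p \<in> Delta0" for p
    by (rule bexI[of _ "Neg p"]) (use that in \<open>auto simp: Delta0_def intro: Sigma0_cl.neg\<close>)
  then show ?case by simp
next
  case (Suc n)
  show ?case
  proof (intro conjI ballI)
    fix p assume "p \<in> Sig (Suc n)"
    then obtain k r where r: "p = (Ex ^^ k) r" "r \<in> Pi n" unfolding Sig_Suc by blast
    then obtain q where q: "q \<in> Sig n" "\<forall>e. sat e q \<longleftrightarrow> \<not> sat e r" using Suc by blast
    then have "(All ^^ k) q \<in> Pi (Suc n)" unfolding Pi_Suc by blast
    moreover have "\<forall>e. sat e ((All ^^ k) q) \<longleftrightarrow> \<not> sat e p"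
      using sat_neg_ex[of q r] q(2) r(1) by blast
    ultimately show "\<exists>q\<in>Pi (Suc n). \<forall>e. sat e q \<longleftrightarrow> \<not> sat e p" by blast
  next
    fix p assume "p \<in> Pi (Suc n)"
    then obtain k r where r: "p = (All ^^ k) r" "r \<in> Sig n" unfolding Pi_Suc by blast
    then obtain q where q: "q \<in> Pi n" "\<forall>e. sat e q \<longleftrightarrow> \<not> sat e r" using Suc by blast
    then have "(Ex ^^ k) q \<in> Sig (Suc n)" unfolding Sig_Suc by blast
    moreover have "\<forall>e. sat e ((Ex ^^ k) q) \<longleftrightarrow> \<not> sat e p"
      using sat_neg_ex[of r q] q(2) r(1) by blast
    ultimately show "\<exists>q\<in>Sig (Suc n). \<forall>e. sat e q \<longleftrightarrow> \<not> sat e p" by blast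
  qed
qed

lemma dfn_neg_Sig: "dfn (Sig n) P \<Longrightarrow> dfn (Pi n) (\<lambda>e. \<not> P e)"
  and dfn_neg_Pi: "dfn (Pi n) P \<Longrightarrow> dfn (Sig n) (\<lambda>e. \<not> P e)"
proof -
  show "dfn (Pi n) (\<lambda>e. \<not> P e)" if "dfn (Sig n) P"
  proof -
    obtain p c where p: "p \<in> Sig n" "\<And>e. P e \<longleftrightarrow> sat (mix e c) p"
      using \<open>dfn (Sig n) P\<close> unfolding dfn_def by blast
    obtain q where "q \<in> Pi n" "\<And>e. sat e q \<longleftrightarrow> \<not> sat e p" using neg_Sig_Pi p(1) by blast
    then show ?thesis unfolding dfn_def by (intro bexI[of _ q] exI[of _ c]) (simp_all add: p(2))
  qed
  show "dfn (Sig n) (\<lambda>e. \<not> P e)" if "dfn (Pi n) P"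
  proof -
    obtain p c where p: "p \<in> Pi n" "\<And>e. P e \<longleftrightarrow> sat (mix e c) p"
      using \<open>dfn (Pi n) P\<close> unfolding dfn_def by blast
    obtain q where "q \<in> Sig n" "\<And>e. sat e q \<longleftrightarrow> \<not> sat e p" using neg_Sig_Pi p(1) by blast
    then show ?thesis unfolding dfn_def by (intro bexI[of _ q] exI[of _ c]) (simp_all add: p(2))
  qed
qed

lemma dfn_Pi_iff: "dfn (Pi n) P \<longleftrightarrow> dfn (Sig n) (\<lambda>e. \<not> P e)"
  using dfn_neg_Sig[of n "\<lambda>e. \<not> P e"] dfn_neg_Pi[of n P] by auto

text \<open>Induction on the length of the leading existential block, phrased for predicates so that
  each step removes one quantifier and the change of environments stays inside this proof.\<close>

lemma dfn_Sig_induct [consumes 1, case_names base step]: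
  assumes "dfn (Sig (Suc n)) P"
    and base: "\<And>P. dfn (Pi n) P \<Longrightarrow> X P"
    and step: "\<And>R. dfn (Sig (Suc n)) (\<lambda>e. R (e 0) (\<lambda>n. e (Suc n))) \<Longrightarrow>
      X (\<lambda>e. R (e 0) (\<lambda>n. e (Suc n))) \<Longrightarrow> X (\<lambda>e. \<exists>y. R y e)"
  shows "X P"
proof -
  have "X (\<lambda>e. sat (mix e c) ((Ex ^^ k) p))" if "p \<in> Pi n" for k p c
    using that
  proof (induction k arbitrary: p)
    case 0
    then have "dfn (Pi n) (\<lambda>e. sat (mix e c) p)" unfolding dfn_def by blast
    then show ?case by (simp add: base)
  next
    case (Suc k)
    define \<rho> where "\<rho> = case_nat (Var 0) (\<lambda>m. if even m then Var (Suc (Suc m)) else Var m)"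
    have "(\<lambda>m. evalt (mix e c) (\<rho> m)) = case_nat (e 0) (mix (\<lambda>m. e (Suc m)) c)" for e
      by (rule nat_ext) (simp_all add: \<rho>_def mix_def)
    then have \<rho>: "sat (case_nat (e 0) (mix (\<lambda>m. e (Suc m)) c)) q \<longleftrightarrow> sat (mix e c) (sub \<rho> q)" for e q
      by (simp add: sat_sub)
    obtain \<tau> where \<tau>: "sub \<rho> ((Ex ^^ k) p) = (Ex ^^ k) (sub \<tau> p)" using sub_funpow_Ex by blast
    have q: "sub \<tau> p \<in> Pi n" using Suc.prems sub_closed_classes(3)[of n] by (simp add: sub_closed_def)
    then have "(Ex ^^ k) (sub \<tau> p) \<in> Sig (Suc n)" unfolding Sig_Suc by blast
    then have "dfn (Sig (Suc n)) (\<lambda>e. sat (mix e c) ((Ex ^^ k) (sub \<tau> p)))"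
      unfolding dfn_def by blast
    moreover have "X (\<lambda>e. sat (mix e c) ((Ex ^^ k) (sub \<tau> p)))" by (rule Suc.IH[OF q])
    ultimately have "X (\<lambda>e. \<exists>y. sat (case_nat y (mix e c)) ((Ex ^^ k) p))"
      by - (rule step, simp_all only: \<rho> \<tau>)
    then show ?case by simp
  qed
  moreover obtain k p c where "p \<in> Pi n" "P = (\<lambda>e. sat (mix e c) ((Ex ^^ k) p))"
    using assms(1) unfolding dfn_def Sig_Suc by blast
  ultimately show ?thesis by blast
qed

lemma dfn_shift: "sub_closed \<Gamma> \<Longrightarrow> dfn \<Gamma> P \<Longrightarrow> dfn \<Gamma> (\<lambda>e. P (\<lambda>n. e (s n)))"
  by (rule dfn_subst[OF _ _ efn_ren])

text \<open>Conjunction and disjunction are treated at once: both commute with an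
  existential quantifier in one argument.\<close>

lemma dfn_Sig_op2:
  assumes h: "\<And>R b. h (\<exists>y::'a. R y) b \<longleftrightarrow> (\<exists>y. h (R y) b)" "\<And>R b. h b (\<exists>y::'a. R y) \<longleftrightarrow> (\<exists>y. h b (R y))"
    and Pi: "\<And>P Q. dfn (Pi n) P \<Longrightarrow> dfn (Pi n) Q \<Longrightarrow> dfn (Pi n) (\<lambda>e. h (P e) (Q e))"
    and PQ: "dfn (Sig (Suc n)) P" "dfn (Sig (Suc n)) Q"
  shows "dfn (Sig (Suc n)) (\<lambda>e. h (P e) (Q e))"
proof -
  have ex: "dfn (Sig (Suc n)) (\<lambda>e. \<exists>y. R y e)"
    if "dfn (Sig (Suc n)) (\<lambda>e. R (e 0) (\<lambda>n. e (Suc n)))" for R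
    by (rule dfn_ex[where R = R, OF _ Ex_Sig_Suc that]) simp
  have half: "dfn (Sig (Suc n)) (\<lambda>e. h (P e) (Q e))" if "dfn (Sig (Suc n)) P" "dfn (Pi n) Q" for P Q
    using that(1) that(2)
  proof (induct P arbitrary: Q rule: dfn_Sig_induct)
    case (base P)
    show ?case by (rule dfn_mono[OF Pi_subset_Sig_Suc Pi[OF base]])
  next
    case (step R)
    have "dfn (Sig (Suc n)) (\<lambda>e. h (R (e 0) (\<lambda>n. e (Suc n))) (Q (\<lambda>n. e (Suc n))))"
      by (rule step(2)) (rule dfn_shift[OF sub_closed_classes(3) step(3)])
    from ex[where R = "\<lambda>y e. h (R y e) (Q e)", OF this] show ?case unfolding h .
  qed
  from PQ(2,1) show ?thesis
  proof (induct Q arbitrary: P rule: dfn_Sig_induct)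
    case (base Q)
    show ?case by (rule half[OF base(2,1)])
  next
    case (step R)
    have "dfn (Sig (Suc n)) (\<lambda>e. h (P (\<lambda>n. e (Suc n))) (R (e 0) (\<lambda>n. e (Suc n))))"
      by (rule step(2)) (rule dfn_shift[OF sub_closed_classes(2) step(3)])
    from ex[where R = "\<lambda>y e. h (P e) (R y e)", OF this] show ?case unfolding h .
  qed
qed

lemma dfn_Sigma0_op2:
  assumes "sub_closed (Sigma0_cl \<Gamma>)" "dfn (Sigma0_cl \<Gamma>) P" "dfn (Sigma0_cl \<Gamma>) Q"
  shows dfn_Sigma0_conj: "dfn (Sigma0_cl \<Gamma>) (\<lambda>e. P e \<and> Q e)"
    and dfn_Sigma0_disj: "dfn (Sigma0_cl \<Gamma>) (\<lambda>e. P e \<or> Q e)"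
    and dfn_Sigma0_imp: "dfn (Sigma0_cl \<Gamma>) (\<lambda>e. P e \<longrightarrow> Q e)"
proof -
  note * = dfn_op2[OF assms(2,3,1,1), where \<Theta> = "Sigma0_cl \<Gamma>"]
  show "dfn (Sigma0_cl \<Gamma>) (\<lambda>e. P e \<and> Q e)"
    by (rule *[where h = "(\<and>)" and F = Conj]) (simp_all add: Sigma0_cl.conj)
  show "dfn (Sigma0_cl \<Gamma>) (\<lambda>e. P e \<or> Q e)"
    by (rule *[where h = "(\<or>)" and F = Disj]) (simp_all add: Sigma0_cl.disj)
  show "dfn (Sigma0_cl \<Gamma>) (\<lambda>e. P e \<longrightarrow> Q e)"
    by (rule *[where h = "(\<longrightarrow>)" and F = Imp]) (simp_all add: Sigma0_cl.imp)
qed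

lemma dfn_Sig_Pi_conj_disj:
  "(\<forall>P Q. dfn (Sig n) P \<longrightarrow> dfn (Sig n) Q \<longrightarrow> dfn (Sig n) (\<lambda>e. P e \<and> Q e) \<and> dfn (Sig n) (\<lambda>e. P e \<or> Q e)) \<and>
   (\<forall>P Q. dfn (Pi n) P \<longrightarrow> dfn (Pi n) Q \<longrightarrow> dfn (Pi n) (\<lambda>e. P e \<and> Q e) \<and> dfn (Pi n) (\<lambda>e. P e \<or> Q e))"
proof (induction n)
  case 0
  show ?case
    using dfn_Sigma0_conj[of "{}"] dfn_Sigma0_disj[of "{}"] sub_closed_Delta0 by (simp add: Delta0_def)
next
  case (Suc n)
  have 1: "dfn (Sig (Suc n)) (\<lambda>e. P e \<and> Q e)"
    if "dfn (Sig (Suc n)) P" "dfn (Sig (Suc n)) Q" for P Q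
    by (rule dfn_Sig_op2[where h = "(\<and>)", OF _ _ _ that]) (use Suc in blast)+
  have 2: "dfn (Sig (Suc n)) (\<lambda>e. P e \<or> Q e)"
    if "dfn (Sig (Suc n)) P" "dfn (Sig (Suc n)) Q" for P Q
    by (rule dfn_Sig_op2[where h = "(\<or>)", OF _ _ _ that]) (use Suc in blast)+
  have "dfn (Pi (Suc n)) (\<lambda>e. P e \<and> Q e)" if "dfn (Pi (Suc n)) P" "dfn (Pi (Suc n)) Q" for P Q
    using 2[OF that[unfolded dfn_Pi_iff]] unfolding dfn_Pi_iff by (rule dfn_cong) blast
  moreover have "dfn (Pi (Suc n)) (\<lambda>e. P e \<or> Q e)" if "dfn (Pi (Suc n)) P" "dfn (Pi (Suc n)) Q" for P Q
    using 1[OF that[unfolded dfn_Pi_iff]] unfolding dfn_Pi_iff by (rule dfn_cong) blast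
  ultimately show ?case using 1 2 by blast
qed

lemma dfn_Sig_conj: "dfn (Sig n) P \<Longrightarrow> dfn (Sig n) Q \<Longrightarrow> dfn (Sig n) (\<lambda>e. P e \<and> Q e)"
  and dfn_Sig_disj: "dfn (Sig n) P \<Longrightarrow> dfn (Sig n) Q \<Longrightarrow> dfn (Sig n) (\<lambda>e. P e \<or> Q e)"
  and dfn_Pi_conj: "dfn (Pi n) P \<Longrightarrow> dfn (Pi n) Q \<Longrightarrow> dfn (Pi n) (\<lambda>e. P e \<and> Q e)"
  and dfn_Pi_disj: "dfn (Pi n) P \<Longrightarrow> dfn (Pi n) Q \<Longrightarrow> dfn (Pi n) (\<lambda>e. P e \<or> Q e)"
  using dfn_Sig_Pi_conj_disj[of n] by blast+

lemma dfn_Sig_ex: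
  "dfn (Sig (Suc n)) (\<lambda>e. R (e 0) (\<lambda>n. e (Suc n))) \<Longrightarrow> dfn (Sig (Suc n)) (\<lambda>e. \<exists>y. R y e)"
  by (rule dfn_ex[OF _ Ex_Sig_Suc]) simp_all

lemma dfn_Pi_all:
  "dfn (Pi (Suc n)) (\<lambda>e. R (e 0) (\<lambda>n. e (Suc n))) \<Longrightarrow> dfn (Pi (Suc n)) (\<lambda>e. \<forall>y. R y e)"
  using dfn_Sig_ex[of n "\<lambda>y e. \<not> R y e"] by (simp add: dfn_Pi_iff)

lemma dfn_Sigma0_not: "dfn (Sigma0_cl \<Gamma>) P \<Longrightarrow> dfn (Sigma0_cl \<Gamma>) (\<lambda>e. \<not> P e)"
  by (erule dfn_op1[where F = Neg and h = Not]) (rule Sigma0_cl.neg, assumption, rule sat.simps)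

lemma dfn_eq: "tfn f \<Longrightarrow> tfn g \<Longrightarrow> dfn Delta0 (\<lambda>e. f e = g e)"
  and dfn_lt: "tfn f \<Longrightarrow> tfn g \<Longrightarrow> dfn Delta0 (\<lambda>e. lt (f e) (g e))"
proof -
  assume "tfn f" "tfn g"
  then obtain s c t d where "\<And>e. f e = evalt (mix e c) s" "\<And>e. g e = evalt (mix e d) t"
    unfolding tfn_def by blast
  then have "f e = g e \<longleftrightarrow> sat (mix e (mix c d)) (Eq (subt lft s) (subt rgt t))"
    "lt (f e) (g e) \<longleftrightarrow> sat (mix e (mix c d)) (Lt (subt lft s) (subt rgt t))" for e
    by (simp_all add: mix_lft_evalt[symmetric] mix_rgt_evalt[symmetric])
  then show "dfn Delta0 (\<lambda>e. f e = g e)" "dfn Delta0 (\<lambda>e. lt (f e) (g e))"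
    unfolding dfn_def Delta0_def using Sigma0_cl.eq Sigma0_cl.lt by blast+
qed

lemma dfn_bounded_ex:
  assumes \<Gamma>: "sub_closed \<Gamma>" "\<And>t p. p \<in> \<Gamma> \<Longrightarrow> BEx t p \<in> \<Gamma>"
    and "tfn f" "dfn \<Gamma> (\<lambda>e. R (e 0) (\<lambda>n. e (Suc n)))"
  shows "dfn \<Gamma> (\<lambda>e. \<exists>y. lt y (f e) \<and> R y e)"
proof -
  obtain t d where t: "\<And>e. f e = evalt (mix e d) t" using assms(3) unfolding tfn_def by blast
  obtain p c where p: "p \<in> \<Gamma>" "\<And>y e. R y e \<longleftrightarrow> sat (case_nat y (mix e c)) p"
    using dfn_binder_form[OF \<Gamma>(1) assms(4)] by blast
  have "(\<exists>y. lt y (f e) \<and> R y e) \<longleftrightarrow> sat (mix e (mix c d)) (BEx (subt rgt t) (sub (up lft) p))" for e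
    by (simp add: t p(2) mix_rgt_evalt[symmetric] sat_sub evalt_up mix_lft)
  moreover have "BEx (subt rgt t) (sub (up lft) p) \<in> \<Gamma>"
    using \<Gamma> p(1) by (simp add: sub_closed_def)
  ultimately show ?thesis unfolding dfn_def by blast
qed

lemma dfn_Sigma0_bex:
  assumes "sub_closed (Sigma0_cl \<Gamma>)" "tfn f" "dfn (Sigma0_cl \<Gamma>) (\<lambda>e. R (e 0) (\<lambda>n. e (Suc n)))"
  shows "dfn (Sigma0_cl \<Gamma>) (\<lambda>e. \<exists>y. lt y (f e) \<and> R y e)"
  by (rule dfn_bounded_ex[OF assms(1) _ assms(2,3)]) (rule Sigma0_cl.bex)

lemma dfn_Sigma0_ball:
  assumes "sub_closed (Sigma0_cl \<Gamma>)" "tfn f" "dfn (Sigma0_cl \<Gamma>) (\<lambda>e. R (e 0) (\<lambda>n. e (Suc n)))"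
  shows "dfn (Sigma0_cl \<Gamma>) (\<lambda>e. \<forall>y. lt y (f e) \<longrightarrow> R y e)"
proof -
  have "dfn (Sigma0_cl \<Gamma>) (\<lambda>e. \<not> (\<exists>y. lt y (f e) \<and> \<not> R y e))"
    by (intro dfn_Sigma0_not dfn_Sigma0_bex assms)
  then show ?thesis by (rule dfn_cong) blast
qed

lemma dfn_Sigma0_eq: "tfn f \<Longrightarrow> tfn g \<Longrightarrow> dfn (Sigma0_cl \<Gamma>) (\<lambda>e. f e = g e)"
  and dfn_Sigma0_lt: "tfn f \<Longrightarrow> tfn g \<Longrightarrow> dfn (Sigma0_cl \<Gamma>) (\<lambda>e. lt (f e) (g e))"
  by (rule dfn_mono[OF Delta0_subset_Sigma0_cl], rule dfn_eq dfn_lt, assumption, assumption)+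

lemma tfn_shift: assumes "tfn f" shows "tfn (\<lambda>e. f (\<lambda>n. e (Suc n)))"
proof -
  obtain t c where t: "\<And>e. f e = evalt (mix e c) t" using assms unfolding tfn_def by blast
  define \<rho> where "\<rho> n = (if even n then Var (Suc (Suc n)) else Var n)" for n
  have "(\<lambda>n. evalt (mix e c) (\<rho> n)) = mix (\<lambda>n. e (Suc n)) c" for e
    by (rule ext) (simp add: mix_def \<rho>_def)
  then have "f (\<lambda>n. e (Suc n)) = evalt (mix e c) (subt \<rho> t)" for e
    by (simp add: t evalt_subt)
  then show ?thesis unfolding tfn_def by blast
qed

lemma dfn_Sig_bex:
  assumes "tfn f" "dfn (Sig n) (\<lambda>e. R (e 0) (\<lambda>n. e (Suc n)))"
  shows "dfn (Sig n) (\<lambda>e. \<exists>y. lt y (f e) \<and> R y e)"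
proof (cases n)
  case 0
  then show ?thesis using assms dfn_Sigma0_bex[of "{}" f R] sub_closed_Delta0 by (simp add: Delta0_def)
next
  case (Suc m)
  from tfn_shift[OF assms(1)] show ?thesis
    using assms(2) unfolding Suc
    by (intro dfn_Sig_ex dfn_Sig_conj dfn_mono[OF Delta0_subset(1) dfn_lt] tfn_var)
qed

lemma dfn_Pi_ball:
  assumes "tfn f" "dfn (Pi n) (\<lambda>e. R (e 0) (\<lambda>n. e (Suc n)))"
  shows "dfn (Pi n) (\<lambda>e. \<forall>y. lt y (f e) \<longrightarrow> R y e)"
  using dfn_Sig_bex[OF assms(1), of n "\<lambda>y e. \<not> R y e"] assms(2) by (simp add: dfn_Pi_iff)

lemma case_nat_eta [simp]: "case_nat (e 0) (\<lambda>n. e (Suc n)) = e"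
  by (rule nat_ext) simp_all

lemma tfn_evalt: "tfn (\<lambda>e. evalt e t)"
  unfolding tfn_def by (rule exI[of _ "subt (\<lambda>n. Var (2 * n)) t"]) (simp add: evalt_subt mix_def)

text \<open>Reduces a complexity bound for predicates to an induction on formulas:
  \<open>mix e c\<close> is itself a definable environment, so it can be substituted into the bound
  for \<open>sat e p\<close>.\<close>

lemma dfn_transfer:
  assumes "sub_closed \<Delta>" "\<And>p. p \<in> \<Gamma> \<Longrightarrow> dfn \<Delta> (\<lambda>e. sat e p)" "dfn \<Gamma> P"
  shows "dfn \<Delta> P"
proof -
  obtain p c where p: "p \<in> \<Gamma>" "\<And>e. P e \<longleftrightarrow> sat (mix e c) p"
    using assms(3) unfolding dfn_def by blast
  have "efn (\<lambda>e. mix e c)" unfolding efn_def by (rule exI[of _ Var], rule exI[of _ c]) simp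
  from dfn_subst[OF assms(1) assms(2)[OF p(1)] this] show ?thesis
    by (rule dfn_cong) (simp add: p(2))
qed

lemma dfn_const_pred: "dfn Delta0 (\<lambda>e. b)"
proof -
  have "dfn Delta0 (\<lambda>e::nat \<Rightarrow> 'a. e 0 = e 0)" by (intro dfn_eq tfn_var)
  moreover have "dfn Delta0 (\<lambda>e::nat \<Rightarrow> 'a. \<not> (e 0 = e 0))"
    unfolding Delta0_def by (intro dfn_Sigma0_not dfn_Sigma0_eq tfn_var)
  ultimately show ?thesis by (cases b) simp_all
qed

end

section \<open>Models of bounded induction\<close>

locale arith = interp zero one plus times lt
  for zero :: 'a ("\<zero>") and one :: 'a ("\<one>") and plus :: "'a \<Rightarrow> 'a \<Rightarrow> 'a" (infixl "\<oplus>" 65)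
    and times :: "'a \<Rightarrow> 'a \<Rightarrow> 'a" (infixl "\<otimes>" 70) and lt :: "'a \<Rightarrow> 'a \<Rightarrow> bool" (infix "\<prec>" 50) +
  assumes IDelta0: "q \<in> IDelta0 \<Longrightarrow> sat e q"
begin

lemma PA: "q \<in> PAminus \<Longrightarrow> sat (case_nat x (case_nat y (case_nat z (\<lambda>_. \<zero>)))) q"
  by (rule IDelta0) (simp add: IDelta0_def)

lemma add_assoc: "x \<oplus> y \<oplus> z = x \<oplus> (y \<oplus> z)"
  using PA[of "Eq (Plus (Plus x0 x1) x2) (Plus x0 (Plus x1 x2))" x y z]
  by (simp add: PAminus_def numeral_2_eq_2)

lemma add_commute: "x \<oplus> y = y \<oplus> x"
  using PA[of "Eq (Plus x0 x1) (Plus x1 x0)" x y] by (simp add: PAminus_def)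

lemma mult_assoc: "x \<otimes> y \<otimes> z = x \<otimes> (y \<otimes> z)"
  using PA[of "Eq (Times (Times x0 x1) x2) (Times x0 (Times x1 x2))" x y z]
  by (simp add: PAminus_def numeral_2_eq_2)

lemma mult_commute: "x \<otimes> y = y \<otimes> x"
  using PA[of "Eq (Times x0 x1) (Times x1 x0)" x y] by (simp add: PAminus_def)

lemma distrib_left: "x \<otimes> (y \<oplus> z) = x \<otimes> y \<oplus> x \<otimes> z"
  using PA[of "Eq (Times x0 (Plus x1 x2)) (Plus (Times x0 x1) (Times x0 x2))" x y z]
  by (simp add: PAminus_def numeral_2_eq_2)

lemma add_zero [simp]: "x \<oplus> \<zero> = x" and mult_zero [simp]: "x \<otimes> \<zero> = \<zero>"
  using PA[of "Conj (Eq (Plus x0 Zero) x0) (Eq (Times x0 Zero) Zero)" x] by (simp_all add: PAminus_def)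

lemma mult_one [simp]: "x \<otimes> \<one> = x"
  using PA[of "Eq (Times x0 One) x0" x] by (simp add: PAminus_def)

lemma lt_trans: "x \<prec> y \<Longrightarrow> y \<prec> z \<Longrightarrow> x \<prec> z"
  using PA[of "Imp (Conj (Lt x0 x1) (Lt x1 x2)) (Lt x0 x2)" x y z]
  by (simp add: PAminus_def numeral_2_eq_2)

lemma lt_irrefl [simp]: "\<not> x \<prec> x"
  using PA[of "Neg (Lt x0 x0)" x] by (simp add: PAminus_def)

lemma lt_linear: "x \<prec> y \<or> x = y \<or> y \<prec> x"
  using PA[of "Disj (Lt x0 x1) (Disj (Eq x0 x1) (Lt x1 x0))" x y] by (simp add: PAminus_def)

lemma add_lt_mono: "x \<prec> y \<Longrightarrow> x \<oplus> z \<prec> y \<oplus> z"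
  using PA[of "Imp (Lt x0 x1) (Lt (Plus x0 x2) (Plus x1 x2))" x y z]
  by (simp add: PAminus_def numeral_2_eq_2)

lemma mult_lt_mono: "\<zero> \<prec> z \<Longrightarrow> x \<prec> y \<Longrightarrow> x \<otimes> z \<prec> y \<otimes> z"
  using PA[of "Imp (Conj (Lt Zero x2) (Lt x0 x1)) (Lt (Times x0 x2) (Times x1 x2))" x y z]
  by (simp add: PAminus_def numeral_2_eq_2)

lemma lt_imp_diff: "x \<prec> y \<Longrightarrow> \<exists>z. x \<oplus> z = y"
  using PA[of "Imp (Lt x0 x1) (Ex (Eq (Plus x1 (Var 0)) x2))" x y]
  by (simp add: PAminus_def numeral_2_eq_2)

lemma zero_lt_one [simp]: "\<zero> \<prec> \<one>" and pos_imp_ge_one: "\<zero> \<prec> x \<Longrightarrow> \<one> \<prec> x \<or> \<one> = x"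
  using PA[of "Conj (Lt Zero One) (Imp (Lt Zero x0) (Disj (Lt One x0) (Eq One x0)))" x]
  by (simp_all add: PAminus_def)

lemma zero_le: "\<zero> \<prec> x \<or> x = \<zero>"
  using PA[of "Disj (Lt Zero x0) (Eq Zero x0)" x] by (auto simp: PAminus_def)

definition le (infix "\<preceq>" 50) where "x \<preceq> y \<longleftrightarrow> x \<prec> y \<or> x = y"

sublocale ord: linorder "(\<preceq>)" "(\<prec>)"
proof unfold_locales
  fix x y z
  show "x \<prec> y \<longleftrightarrow> x \<preceq> y \<and> \<not> y \<preceq> x"
    using lt_trans[of x y x] lt_linear[of x y] by (auto simp: le_def)
  show "x \<preceq> y \<or> y \<preceq> x" using lt_linear[of x y] by (auto simp: le_def)
  show "x \<preceq> y \<Longrightarrow> y \<preceq> x \<Longrightarrow> x = y" using lt_trans[of x y x] by (auto simp: le_def)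
  show "x \<preceq> y \<Longrightarrow> y \<preceq> z \<Longrightarrow> x \<preceq> z" using lt_trans[of x y z] by (auto simp: le_def)
qed (simp add: le_def)

sublocale ring: comm_semiring_1 where one = "\<one>" and times = "(\<otimes>)" and plus = "(\<oplus>)" and zero = "\<zero>"
proof unfold_locales
  fix x y z
  show "x \<oplus> y \<oplus> z = x \<oplus> (y \<oplus> z)" by (rule add_assoc)
  show "x \<oplus> y = y \<oplus> x" by (rule add_commute)
  show "x \<otimes> y \<otimes> z = x \<otimes> (y \<otimes> z)" by (rule mult_assoc)
  show "x \<otimes> y = y \<otimes> x" by (rule mult_commute)
  show "\<zero> \<oplus> x = x" by (subst add_commute) simp
  show "\<one> \<otimes> x = x" by (subst mult_commute) simp
  show "(x \<oplus> y) \<otimes> z = x \<otimes> z \<oplus> y \<otimes> z"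
    by (simp add: mult_commute[of _ z] distrib_left)
  show "\<zero> \<otimes> x = \<zero>" by (subst mult_commute) simp
  show "x \<otimes> \<zero> = \<zero>" by simp
  show "\<zero> \<noteq> \<one>" using zero_lt_one lt_irrefl by metis
qed

lemma add_cancel: "x \<oplus> z = y \<oplus> z \<Longrightarrow> x = y"
  using lt_linear[of x y] add_lt_mono[of x y z] add_lt_mono[of y x z] by auto

lemma add_lt_cancel [simp]: "x \<oplus> z \<prec> y \<oplus> z \<longleftrightarrow> x \<prec> y"
  using lt_linear[of x y] add_lt_mono[of x y z] add_lt_mono[of y x z] ord.less_asym by auto

lemma add_lt_cancel' [simp]: "z \<oplus> x \<prec> z \<oplus> y \<longleftrightarrow> x \<prec> y"
  using add_lt_cancel[of x z y] by (simp only: add_commute)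

lemma not_lt_zero [simp]: "\<not> x \<prec> \<zero>"
  using zero_le[of x] lt_trans lt_irrefl by blast

lemma lt_add_one [simp]: "x \<prec> x \<oplus> \<one>"
  using add_lt_cancel'[of x \<zero> \<one>] by (simp del: add_lt_cancel')

lemma le_add [simp]: "x \<preceq> x \<oplus> y"
  using add_lt_cancel'[of x \<zero> y] zero_le[of y] by (auto simp: le_def simp del: add_lt_cancel')

lemma le_add' [simp]: "x \<preceq> y \<oplus> x"
  using le_add[of x y] by (simp only: add_commute)

lemma lt_succ_iff: "x \<prec> y \<oplus> \<one> \<longleftrightarrow> x \<preceq> y"
proof
  assume 1: "x \<prec> y \<oplus> \<one>"
  show "x \<preceq> y"
  proof (rule ccontr)
    assume "\<not> x \<preceq> y"
    then have "y \<prec> x" by simp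
    then obtain z where z: "y \<oplus> z = x" using lt_imp_diff by blast
    with \<open>y \<prec> x\<close> have "\<zero> \<prec> z" using zero_le[of z] lt_irrefl[of y] by fastforce
    then have "\<one> \<preceq> z" using pos_imp_ge_one[of z] by (auto simp: le_def)
    then have "y \<oplus> \<one> \<preceq> x" using z by (auto simp: le_def)
    with 1 show False using ord.leD by blast
  qed
next
  assume "x \<preceq> y"
  then show "x \<prec> y \<oplus> \<one>" using lt_add_one[of y] by (rule ord.le_less_trans)
qed

lemma zero_le' [simp]: "\<zero> \<preceq> x"
  using zero_le by (auto simp: le_def)

lemma pos_iff: "\<zero> \<prec> x \<longleftrightarrow> x \<noteq> \<zero>"
  using zero_le[of x] by auto

lemma le_imp_diff: "x \<preceq> y \<Longrightarrow> \<exists>z. x \<oplus> z = y"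
  using lt_imp_diff[of x y] by (auto simp: le_def intro: exI[of _ \<zero>])

lemma eq_zero_or_succ: "x = \<zero> \<or> (\<exists>y. x = y \<oplus> \<one>)"
proof (cases "x = \<zero>")
  case False
  then have "\<one> \<preceq> x" using pos_imp_ge_one[of x] by (auto simp: le_def pos_iff)
  then obtain z where "\<one> \<oplus> z = x" using le_imp_diff by blast
  then show ?thesis using add_commute by metis
qed simp

lemma ex_upper2: "\<exists>z. x \<prec> z \<and> y \<prec> z"
  by (rule exI[of _ "x \<oplus> y \<oplus> \<one>"]) (simp add: lt_succ_iff)

section \<open>Collection and induction for definable predicates\<close>

definition coll :: "nat \<Rightarrow> bool" where
  "coll n \<longleftrightarrow> (\<forall>A a. dfn (Sig n) (\<lambda>e. A (e 0) (e 1)) \<longrightarrow> (\<forall>x. x \<prec> a \<longrightarrow> (\<exists>y. A x y)) \<longrightarrow>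
     (\<exists>b. \<forall>x. x \<prec> a \<longrightarrow> (\<exists>y. y \<prec> b \<and> A x y)))"

definition indn :: "fm set \<Rightarrow> bool" where
  "indn \<Gamma> \<longleftrightarrow> (\<forall>A. dfn \<Gamma> (\<lambda>e. A (e 0)) \<longrightarrow> A \<zero> \<longrightarrow> (\<forall>x. A x \<longrightarrow> A (x \<oplus> \<one>)) \<longrightarrow> (\<forall>x. A x))"

lemma collD:
  assumes "coll n" "dfn (Sig n) (\<lambda>e. A (e 0) (e 1))" "\<forall>x. x \<prec> a \<longrightarrow> (\<exists>y. A x y)"
  shows "\<exists>b. \<forall>x. x \<prec> a \<longrightarrow> (\<exists>y. y \<prec> b \<and> A x y)"
  using spec[OF spec[OF assms(1)[unfolded coll_def], of A], of a] assms(2,3) by simp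

lemma indnD:
  assumes "indn \<Gamma>" "dfn \<Gamma> (\<lambda>e. A (e 0))" "A \<zero>" "\<And>x. A x \<Longrightarrow> A (x \<oplus> \<one>)"
  shows "A x"
  using spec[OF assms(1)[unfolded indn_def], of A] assms(2-4) by simp

lemma indn_mono: assumes "\<Gamma> \<subseteq> \<Delta>" "indn \<Delta>" shows "indn \<Gamma>"
  unfolding indn_def
proof (intro allI impI)
  fix A x assume A: "dfn \<Gamma> (\<lambda>e. A (e 0))" "A \<zero>" "\<forall>x. A x \<longrightarrow> A (x \<oplus> \<one>)"
  show "A x" by (rule indnD[where A = A, OF assms(2) dfn_mono[OF assms(1) A(1)] A(2)]) (use A(3) in blast)
qed

lemma coll_antimono: assumes "coll (Suc n)" shows "coll n"
  unfolding coll_def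
proof (intro allI impI)
  fix A a assume "dfn (Sig n) (\<lambda>e. A (e 0) (e 1))" "\<forall>x. x \<prec> a \<longrightarrow> (\<exists>y. A x y)"
  then show "\<exists>b. \<forall>x. x \<prec> a \<longrightarrow> (\<exists>y. y \<prec> b \<and> A x y)"
    by (rule collD[where A = A, OF assms dfn_mono[OF Sig_subset_Sig_Suc]])
qed

lemma coll_if_sat_Coll:
  assumes "\<And>p e. p \<in> Sig n \<Longrightarrow> sat e (Coll p)" shows "coll n"
  unfolding coll_def
proof (intro allI impI)
  fix A a assume "dfn (Sig n) (\<lambda>e. A (e 0) (e 1))" and ex: "\<forall>x. x \<prec> a \<longrightarrow> (\<exists>y. A x y)"
  then obtain p c where p: "p \<in> Sig n" "\<And>x y. A x y \<longleftrightarrow> sat (case_nat x (case_nat y c)) p"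
    using dfn2_formula[where A = A, OF sub_closed_classes(2)] by blast
  from assms[OF p(1), of "case_nat a c"] ex show "\<exists>b. \<forall>x. x \<prec> a \<longrightarrow> (\<exists>y. y \<prec> b \<and> A x y)"
    unfolding sat_Coll p(2) by blast
qed

lemma sat_Coll_if_coll:
  assumes "coll n" "p \<in> Sig n" shows "sat e (Coll p)"
proof -
  define a c where "a = e 0" and "c = (\<lambda>n. e (Suc n))"
  have e: "e = case_nat a c" by (rule nat_ext) (simp_all add: a_def c_def)
  have "efn (\<lambda>e. case_nat (e 0) (case_nat (e 1) c))" by (intro efn_case tfn_var efn_const)
  then have d: "dfn (Sig n) (\<lambda>e. sat (case_nat (e 0) (case_nat (e 1) c)) p)"
    by (rule dfn_subst[OF _ dfn_sat[OF _ assms(2)], rotated 2]) simp_all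
  show ?thesis unfolding e sat_Coll
    using collD[where A = "\<lambda>x y. sat (case_nat x (case_nat y c)) p", OF assms(1) d, of a] by blast
qed

lemma indn_if_sat_Ind:
  assumes "sub_closed \<Gamma>" "\<And>p e. p \<in> \<Gamma> \<Longrightarrow> sat e (Ind p)" shows "indn \<Gamma>"
  unfolding indn_def
proof (intro allI impI)
  fix A x assume "dfn \<Gamma> (\<lambda>e. A (e 0))" and ind: "A \<zero>" "\<forall>x. A x \<longrightarrow> A (x \<oplus> \<one>)"
  then obtain p c where p: "p \<in> \<Gamma>" "\<And>x. A x \<longleftrightarrow> sat (case_nat x c) p"
    using dfn1_formula[where A = A, OF assms(1)] by blast
  from assms(2)[OF p(1), of c] ind show "A x" unfolding sat_Ind p(2) by blast
qed

lemma indn_Delta0: "indn Delta0"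
  by (rule indn_if_sat_Ind) (simp_all add: IDelta0 IDelta0_def)

text \<open>A separate notion because two facts depend on each other: contracting quantifiers at
  level n+1 needs this closure at level n, and this closure at level n+1 needs the
  contraction.\<close>

definition ball_closed :: "nat \<Rightarrow> bool" where
  "ball_closed n \<longleftrightarrow> (\<forall>f R. tfn f \<longrightarrow> dfn (Sig n) (\<lambda>e. R (e 0) (\<lambda>n. e (Suc n))) \<longrightarrow>
     dfn (Sig n) (\<lambda>e. \<forall>y. y \<prec> f e \<longrightarrow> R y e))"

lemma dfn_Sig_ball:
  "ball_closed n \<Longrightarrow> tfn f \<Longrightarrow> dfn (Sig n) (\<lambda>e. R (e 0) (\<lambda>n. e (Suc n))) \<Longrightarrow>
    dfn (Sig n) (\<lambda>e. \<forall>y. y \<prec> f e \<longrightarrow> R y e)"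
  unfolding ball_closed_def by blast

lemma dfn_Pi_bex:
  assumes "ball_closed n" "tfn f" "dfn (Pi n) (\<lambda>e. R (e 0) (\<lambda>n. e (Suc n)))"
  shows "dfn (Pi n) (\<lambda>e. \<exists>y. y \<prec> f e \<and> R y e)"
  using dfn_Sig_ball[OF assms(1,2), of "\<lambda>y e. \<not> R y e"] assms(3) by (simp add: dfn_Pi_iff)

text \<open>A block of existential quantifiers is contracted to a single one by bounding all
  witnesses at once; no pairing function is needed.\<close>

lemma contraction:
  assumes bc: "ball_closed n" and P: "dfn (Sig (Suc n)) P"
  shows "\<exists>A. dfn (Pi n) (\<lambda>e. A (e 0) (\<lambda>n. e (Suc n))) \<and> (\<forall>e. P e \<longleftrightarrow> (\<exists>w. A w e))"
  using P
proof (induct P rule: dfn_Sig_induct)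
  case (base P)
  have "dfn (Pi n) (\<lambda>e. P (\<lambda>n. e (Suc n)))" by (rule dfn_shift[OF _ base]) simp
  then show ?case by (intro exI[of _ "\<lambda>w e. P e"]) simp
next
  case (step R)
  then obtain A where A: "dfn (Pi n) (\<lambda>e. A (e 0) (\<lambda>n. e (Suc n)))"
    "\<And>e. R (e 0) (\<lambda>n. e (Suc n)) \<longleftrightarrow> (\<exists>w. A w e)" by blast
  have R: "R y e \<longleftrightarrow> (\<exists>w. A w (case_nat y e))" for y e
    using A(2)[of "case_nat y e"] by simp
  \<comment> \<open>Under the common bound \<open>z\<close> both quantifiers are bounded, and a
    bounded existential quantifier preserves Pi_n by the dual of
    \<open>ball_closed n\<close>.\<close>
  define B where "B z e \<longleftrightarrow> (\<exists>y. y \<prec> z \<and> (\<exists>w. w \<prec> z \<and> A w (case_nat y e)))" for z e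
  have "efn (\<lambda>e. case_nat (e 0) (case_nat (e 1) (\<lambda>n. e (Suc (Suc (Suc n))))))"
    by (intro efn_case tfn_var efn_ren)
  from dfn_subst[OF _ A(1) this]
  have "dfn (Pi n) (\<lambda>e. A (e 0) (case_nat (e 1) (\<lambda>n. e (Suc (Suc (Suc n))))))" by simp
  then have "dfn (Pi n) (\<lambda>e. B (e 0) (\<lambda>n. e (Suc n)))"
    unfolding B_def by (intro dfn_Pi_bex[OF bc] tfn_var) simp
  moreover have "(\<exists>y. R y e) \<longleftrightarrow> (\<exists>z. B z e)" for e
    unfolding R B_def using ex_upper2 by blast
  ultimately show ?case by blast
qed

lemma ball_closed_0: "ball_closed 0"
  using dfn_Sigma0_ball[of "{}"] sub_closed_Delta0 by (auto simp: ball_closed_def Delta0_def)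

text \<open>After contraction there is a single existential quantifier under the bounded universal
  one; collection moves it outside as a bound \<open>b\<close>, leaving a Pi_n matrix.\<close>

lemma ball_closed_if_coll: "n = 0 \<or> coll n \<Longrightarrow> ball_closed n"
proof (induction n)
  case (Suc n)
  then have bc: "ball_closed n" and c: "coll (Suc n)" using coll_antimono by auto
  show ?case unfolding ball_closed_def
  proof (intro allI impI)
    fix f R assume f: "tfn f" and R: "dfn (Sig (Suc n)) (\<lambda>e. R (e 0) (\<lambda>n. e (Suc n)))"
    obtain A where A: "dfn (Pi n) (\<lambda>e. A (e 0) (\<lambda>n. e (Suc n)))"
      "\<And>e. R (e 0) (\<lambda>n. e (Suc n)) \<longleftrightarrow> (\<exists>w. A w e)"
      using contraction[OF bc R] by blast
    have R': "R y e \<longleftrightarrow> (\<exists>w. A w (case_nat y e))" for y e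
      using A(2)[of "case_nat y e"] by simp
    have "(\<forall>y. y \<prec> f e \<longrightarrow> R y e) \<longleftrightarrow> (\<exists>b. \<forall>y. y \<prec> f e \<longrightarrow> (\<exists>w. w \<prec> b \<and> A w (case_nat y e)))" for e
    proof -
      have "efn (\<lambda>e'. case_nat (e' 1) (case_nat (e' 0) e))" by (intro efn_case tfn_var efn_const)
      from dfn_subst[OF _ A(1) this]
      have "dfn (Sig (Suc n)) (\<lambda>e'. A (e' 1) (case_nat (e' 0) e))"
        by (intro dfn_mono[OF Pi_subset_Sig_Suc]) simp
      from collD[where A = "\<lambda>y w. A w (case_nat y e)", OF c this, of "f e"]
      show ?thesis unfolding R' by blast
    qed
    moreover have "dfn (Sig (Suc n)) (\<lambda>e. \<exists>b. \<forall>y. y \<prec> f e \<longrightarrow> (\<exists>w. w \<prec> b \<and> A w (case_nat y e)))"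
    proof -
      have "efn (\<lambda>e. case_nat (e 0) (case_nat (e 1) (\<lambda>n. e (Suc (Suc (Suc n))))))"
        by (intro efn_case tfn_var efn_ren)
      from dfn_subst[OF _ A(1) this]
      have 1: "dfn (Pi n) (\<lambda>e. A (e 0) (case_nat (e 1) (\<lambda>n. e (Suc (Suc (Suc n))))))" by simp
      have f': "tfn (\<lambda>e. f (\<lambda>n. e (Suc n)))" by (rule tfn_shift[OF f])
      have "dfn (Pi n) (\<lambda>e. \<forall>y. y \<prec> f (\<lambda>n. e (Suc n)) \<longrightarrow>
          (\<exists>w. w \<prec> e 0 \<and> A w (case_nat y (\<lambda>n. e (Suc n)))))"
        by (intro dfn_Pi_ball dfn_Pi_bex[OF bc] tfn_var f') (use 1 in simp)
      then show ?thesis by (intro dfn_Sig_ex dfn_mono[OF Pi_subset_Sig_Suc])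
    qed
    ultimately show "dfn (Sig (Suc n)) (\<lambda>e. \<forall>y. y \<prec> f e \<longrightarrow> R y e)" by simp
  qed
qed (simp add: ball_closed_0)

lemma dfn_Sigma0_le: "tfn f \<Longrightarrow> tfn g \<Longrightarrow> dfn (Sigma0_cl \<Gamma>) (\<lambda>e. f e \<preceq> g e)"
  unfolding lt_succ_iff[symmetric] by (intro dfn_Sigma0_lt tfn_plus tfn_const)

lemmas dfn_intros =
  dfn_Sigma0_not dfn_Sigma0_conj[OF sub_closed_classes(4)] dfn_Sigma0_disj[OF sub_closed_classes(4)]
  dfn_Sigma0_imp[OF sub_closed_classes(4)] dfn_Sigma0_bex[OF sub_closed_classes(4)]
  dfn_Sigma0_ball[OF sub_closed_classes(4)] dfn_Sigma0_eq dfn_Sigma0_lt dfn_Sigma0_le tfn_intros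

text \<open>Under BSigma_(n+1), Sigma_0(Sigma_n) formulas are Delta_(n+1). Both forms are carried
  through the induction together because negation exchanges them.\<close>

lemma Sigma0_formula_Sig_Pi:
  assumes "coll (Suc n)" "p \<in> Sigma0_cl (Sig n)"
  shows "dfn (Sig (Suc n)) (\<lambda>e. sat e p) \<and> dfn (Pi (Suc n)) (\<lambda>e. sat e p)"
proof -
  have bc: "ball_closed (Suc n)" using ball_closed_if_coll assms(1) by blast
  have D: "dfn (Sig (Suc n)) (\<lambda>e. sat e p) \<and> dfn (Pi (Suc n)) (\<lambda>e. sat e p)" if "p \<in> Delta0" for p
    using dfn_mono[OF Delta0_subset(1) dfn_sat[OF sub_closed_classes(1) that]]
      dfn_mono[OF Delta0_subset(2) dfn_sat[OF sub_closed_classes(1) that]] by blast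
  from assms(2) show ?thesis
  proof induction
    case (base p)
    have "dfn (Sig n) (\<lambda>e. sat e p)" by (rule dfn_sat[OF sub_closed_classes(2) base])
    then show ?case using dfn_mono[OF Sig_subset_Sig_Suc] dfn_mono[OF Sig_subset_Pi_Suc] by blast
  next
    case (neg p)
    then show ?case by (simp add: dfn_neg_Sig dfn_neg_Pi)
  next
    case (conj p q)
    then show ?case by (simp add: dfn_Sig_conj dfn_Pi_conj)
  next
    case (disj p q)
    then show ?case by (simp add: dfn_Sig_disj dfn_Pi_disj)
  next
    case (imp p q)
    then have "dfn (Sig (Suc n)) (\<lambda>e. \<not> sat e p \<or> sat e q)" "dfn (Pi (Suc n)) (\<lambda>e. \<not> sat e p \<or> sat e q)"
      by (intro dfn_Sig_disj dfn_Pi_disj dfn_neg_Sig dfn_neg_Pi; simp)+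
    then show ?case unfolding sat.simps imp_conv_disj by blast
  next
    case (bex p t)
    then have "dfn (Sig (Suc n)) (\<lambda>e. \<exists>y. y \<prec> evalt e t \<and> sat (case_nat y e) p)"
      "dfn (Pi (Suc n)) (\<lambda>e. \<exists>y. y \<prec> evalt e t \<and> sat (case_nat y e) p)"
      by (intro dfn_Sig_bex dfn_Pi_bex[OF bc] tfn_evalt, simp)+
    then show ?case by simp
  next
    case (ball p t)
    then have "dfn (Sig (Suc n)) (\<lambda>e. \<forall>y. y \<prec> evalt e t \<longrightarrow> sat (case_nat y e) p)"
      "dfn (Pi (Suc n)) (\<lambda>e. \<forall>y. y \<prec> evalt e t \<longrightarrow> sat (case_nat y e) p)"
      by (intro dfn_Sig_ball[OF bc] dfn_Pi_ball tfn_evalt, simp)+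
    then show ?case by simp
  qed (rule D, simp add: Delta0_def Sigma0_cl.intros)+
qed

lemma dfn_Sigma0_Sig: "coll (Suc n) \<Longrightarrow> dfn (Sigma0_cl (Sig n)) P \<Longrightarrow> dfn (Sig (Suc n)) P"
  and dfn_Sigma0_Pi: "coll (Suc n) \<Longrightarrow> dfn (Sigma0_cl (Sig n)) P \<Longrightarrow> dfn (Pi (Suc n)) P"
proof -
  assume c: "coll (Suc n)" and P: "dfn (Sigma0_cl (Sig n)) P"
  show "dfn (Sig (Suc n)) P"
    by (rule dfn_transfer[OF sub_closed_classes(2) _ P]) (use Sigma0_formula_Sig_Pi[OF c] in blast)
  show "dfn (Pi (Suc n)) P"
    by (rule dfn_transfer[OF sub_closed_classes(3) _ P]) (use Sigma0_formula_Sig_Pi[OF c] in blast)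
qed

section \<open>Lowering complexity on initial segments, and induction from collection\<close>

lemma contraction2:
  assumes "ball_closed n" "dfn (Sig (Suc n)) (\<lambda>e. A (e 0) (e 1))"
  obtains B where "dfn (Pi n) (\<lambda>e. B (e 0) (e 1) (e 2))" "\<And>x y. A x y \<longleftrightarrow> (\<exists>w. B w x y)"
proof -
  obtain B where B: "dfn (Pi n) (\<lambda>e. B (e 0) (\<lambda>n. e (Suc n)))" "\<forall>e. A (e 0) (e 1) \<longleftrightarrow> (\<exists>w. B w e)"
    using contraction[OF assms] by blast
  have "efn (\<lambda>e. case_nat (e 0) (case_nat (e 1) (case_nat (e 2) (\<lambda>_. \<zero>))))"
    by (intro efn_case tfn_var efn_const)
  from dfn_subst[OF sub_closed_classes(3) B(1) this]
  have "dfn (Pi n) (\<lambda>e. B (e 0) (case_nat (e 1) (case_nat (e 2) (\<lambda>_. \<zero>))))"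
    by (simp only: nat.case)
  moreover have "A x y \<longleftrightarrow> (\<exists>w. B w (case_nat x (case_nat y (\<lambda>_. \<zero>))))" for x y
    using spec[OF B(2), of "case_nat x (case_nat y (\<lambda>_. \<zero>))"] by simp
  ultimately show ?thesis by (rule that[of "\<lambda>w x y. B w (case_nat x (case_nat y (\<lambda>_. \<zero>)))"])
qed

lemma contraction2_Pi:
  assumes "ball_closed n" "dfn (Pi (Suc n)) (\<lambda>e. A (e 0) (e 1))"
  obtains B where "dfn (Sig n) (\<lambda>e. B (e 0) (e 1) (e 2))" "\<And>x y. A x y \<longleftrightarrow> (\<forall>w. B w x y)"
proof -
  obtain B where B: "dfn (Pi n) (\<lambda>e. B (e 0) (e 1) (e 2))" "\<And>x y. \<not> A x y \<longleftrightarrow> (\<exists>w. B w x y)"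
    using contraction2[where A = "\<lambda>x y. \<not> A x y", OF assms(1) assms(2)[unfolded dfn_Pi_iff]] by blast
  show ?thesis
    by (rule that[of "\<lambda>w x y. \<not> B w x y"]) (use B in \<open>simp_all add: dfn_neg_Pi, blast\<close>)
qed

text \<open>Below \<open>c\<close> the witnesses for \<open>A\<close> can be bounded uniformly, and
  a bounded existential quantifier does not leave Pi_n; thus \<open>A\<close> loses its unbounded
  quantifier there.\<close>

lemma restrict_to_Pi:
  assumes coll: "coll m" and bc: "ball_closed n" and sub: "Pi n \<subseteq> Sig m"
    and A: "dfn (Sig (Suc n)) (\<lambda>e. A (e 0))" "dfn (Sig m) (\<lambda>e. \<not> A (e 0))"
  obtains B where "dfn (Pi n) (\<lambda>e. B (e 0))" "\<And>x. x \<prec> c \<Longrightarrow> A x \<longleftrightarrow> B x"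
proof -
  obtain C where C: "dfn (Pi n) (\<lambda>e. C (e 0) (e 1) (e 2))" "\<And>x y::'a. A x \<longleftrightarrow> (\<exists>w. C w x y)"
    using contraction2[where A = "\<lambda>x y. A x", OF bc A(1)] by blast
  have D: "dfn (Pi n) (\<lambda>e. C (f e) (g e) (h e))" if "tfn f" "tfn g" "tfn h" for f g h
    by (rule dfn3[where A = C, OF sub_closed_classes(3) C(1) that])
  \<comment> \<open>The disjunct \<open>\<not> A\<close> gives every \<open>x\<close> a witness, so
    that collection applies to all of them at once.\<close>
  have "dfn (Sig m) (\<lambda>e. C (e 1) (e 0) \<zero> \<or> \<not> A (e 0))"
    by (intro dfn_Sig_disj A(2) dfn_mono[OF sub D] tfn_intros)
  moreover have "\<forall>x. x \<prec> c \<longrightarrow> (\<exists>w. C w x \<zero> \<or> \<not> A x)"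
    using C(2) by blast
  ultimately obtain b where b: "\<forall>x. x \<prec> c \<longrightarrow> (\<exists>w. w \<prec> b \<and> (C w x \<zero> \<or> \<not> A x))"
    using collD[where A = "\<lambda>x w. C w x \<zero> \<or> \<not> A x", OF coll] by blast
  show ?thesis
  proof (rule that[of "\<lambda>x. \<exists>w. w \<prec> b \<and> C w x \<zero>"])
    show "dfn (Pi n) (\<lambda>e. \<exists>w. w \<prec> b \<and> C w (e 0) \<zero>)"
      by (intro dfn_Pi_bex[OF bc] D tfn_intros)
    show "A x \<longleftrightarrow> (\<exists>w. w \<prec> b \<and> C w x \<zero>)" if "x \<prec> c" for x
      using b that C(2)[of x \<zero>] by blast
  qed
qed

text \<open>On a fixed initial segment a Sigma_0(Sigma_(n+1)) predicate is Delta_(n+2), hence agrees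
  with a Pi_(n+1) predicate \<open>B\<close>; the negation of \<open>B\<close> in turn agrees there
  with a Pi_n predicate \<open>C\<close>. So \<open>A\<close> agrees with the Sigma_n predicate
  \<open>\<not> C\<close>, and induction two levels lower is enough.\<close>

lemma indn_if_coll: "coll (Suc n) \<Longrightarrow> indn (Sigma0_cl (Sig n))"
proof (induction n)
  case 0
  then show ?case using indn_Delta0 by (simp add: Sigma0_cl_Delta0)
next
  case (Suc n)
  note c2 = \<open>coll (Suc (Suc n))\<close>
  have c1: "coll (Suc n)" by (rule coll_antimono[OF c2])
  have bc1: "ball_closed (Suc n)" using ball_closed_if_coll c1 by blast
  have bc0: "ball_closed n" using ball_closed_if_coll coll_antimono[OF c1] by blast
  note IH = Suc.IH[OF c1]
  show ?case
    unfolding indn_def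
  proof (intro allI impI)
    fix A a assume A: "dfn (Sigma0_cl (Sig (Suc n))) (\<lambda>e. A (e 0))" "A \<zero>" "\<forall>x. A x \<longrightarrow> A (x \<oplus> \<one>)"
    \<comment> \<open>One more than \<open>a\<close>, so that the strict bound in
      \<open>restrict_to_Pi\<close> covers \<open>a\<close> itself.\<close>
    let ?c = "a \<oplus> \<one>"
    obtain B where B: "dfn (Pi (Suc n)) (\<lambda>e. B (e 0))" "\<And>x. x \<prec> ?c \<Longrightarrow> A x \<longleftrightarrow> B x"
      using restrict_to_Pi[where A = A, OF c2 bc1 Pi_subset_Sig_Suc dfn_Sigma0_Sig[OF c2 A(1)]
          dfn_neg_Pi[OF dfn_Sigma0_Pi[OF c2 A(1)]]] by blast
    have "dfn (Sig (Suc (Suc n))) (\<lambda>e. \<not> \<not> B (e 0))"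
      using dfn_mono[OF Pi_subset_Sig_Suc B(1)] by simp
    then obtain C where C: "dfn (Pi n) (\<lambda>e. C (e 0))" "\<And>x. x \<prec> ?c \<Longrightarrow> \<not> B x \<longleftrightarrow> C x"
      using restrict_to_Pi[where A = "\<lambda>x. \<not> B x" and c = ?c, OF c2 bc0
          subset_trans[OF Pi_subset_Sig_Suc Sig_subset_Sig_Suc] dfn_neg_Pi[OF B(1)]] by blast
    have AC: "A x \<longleftrightarrow> \<not> C x" if "x \<preceq> a" for x
      using B(2)[of x] C(2)[of x] that by (auto simp: lt_succ_iff)
    have "dfn (Sig n) (\<lambda>e. \<not> C (e 0))" by (rule dfn_neg_Pi[OF C(1)])
    then have "dfn (Sigma0_cl (Sig n)) (\<lambda>e. \<not> C (e 0))"
      by (rule dfn_mono[rotated]) (auto intro: Sigma0_cl.base)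
    then have "dfn (Sigma0_cl (Sig n)) (\<lambda>e. e 0 \<preceq> a \<longrightarrow> \<not> C (e 0))"
      by (intro dfn_Sigma0_imp[OF sub_closed_classes(4)] dfn_Sigma0_le tfn_intros)
    then have "a \<preceq> a \<longrightarrow> \<not> C a"
    proof (rule indnD[where A = "\<lambda>x. x \<preceq> a \<longrightarrow> \<not> C x", OF IH])
      show "\<zero> \<preceq> a \<longrightarrow> \<not> C \<zero>" using AC A(2) by blast
      fix x assume x: "x \<preceq> a \<longrightarrow> \<not> C x"
      show "x \<oplus> \<one> \<preceq> a \<longrightarrow> \<not> C (x \<oplus> \<one>)"
      proof
        assume le: "x \<oplus> \<one> \<preceq> a"
        then have "x \<preceq> a" using le_add ord.order_trans by blast
        with x AC A(3) le show "\<not> C (x \<oplus> \<one>)" by blast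
      qed
    qed
    then show "A a" using AC[of a] by (simp add: le_def)
  qed
qed

lemma least_number:
  assumes "indn (Sigma0_cl (Sig n))" "dfn (Sigma0_cl (Sig n)) (\<lambda>e. A (e 0))" "A x"
  obtains m where "A m" "\<And>k. k \<prec> m \<Longrightarrow> \<not> A k"
proof (rule ccontr)
  assume "\<not> thesis"
  then have no: "\<not> (A m \<and> (\<forall>k. k \<prec> m \<longrightarrow> \<not> A k))" for m using that by blast
  have D: "dfn (Sigma0_cl (Sig n)) (\<lambda>e. A (f e))" if "tfn f" for f
    by (rule dfn1[where A = A, OF sub_closed_classes(4) assms(2) that])
  have "\<forall>k. k \<prec> x \<oplus> \<one> \<longrightarrow> \<not> A k"
  proof (rule indnD[where A = "\<lambda>x. \<forall>k. k \<prec> x \<longrightarrow> \<not> A k", OF assms(1)])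
    show "dfn (Sigma0_cl (Sig n)) (\<lambda>e. \<forall>k. k \<prec> e 0 \<longrightarrow> \<not> A k)"
      by (intro dfn_intros D)
    fix x assume "\<forall>k. k \<prec> x \<longrightarrow> \<not> A k"
    moreover from this have "\<not> A x" using no by blast
    ultimately show "\<forall>k. k \<prec> x \<oplus> \<one> \<longrightarrow> \<not> A k" by (auto simp: lt_succ_iff le_def)
  qed simp
  with assms(3) show False by simp
qed

section \<open>Weak regularity implies collection\<close>

definition wr :: "fm set \<Rightarrow> bool" where
  "wr \<Gamma> \<longleftrightarrow> (\<forall>A a. dfn \<Gamma> (\<lambda>e. A (e 0) (e 1)) \<longrightarrow> (\<forall>x. \<exists>y. y \<prec> a \<and> A x y) \<longrightarrow>
     (\<exists>y. y \<prec> a \<and> (\<forall>b. \<exists>x. b \<prec> x \<and> A x y)))"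

lemma wrD:
  assumes "wr \<Gamma>" "dfn \<Gamma> (\<lambda>e. A (e 0) (e 1))" "\<forall>x. \<exists>y. y \<prec> a \<and> A x y"
  shows "\<exists>y. y \<prec> a \<and> (\<forall>b. \<exists>x. b \<prec> x \<and> A x y)"
  using spec[OF spec[OF assms(1)[unfolded wr_def], of A], of a] assms(2,3) by blast

lemma wr_if_sat_WRax:
  assumes "sub_closed \<Gamma>" "\<And>p e. p \<in> \<Gamma> \<Longrightarrow> sat e (WRax p)" shows "wr \<Gamma>"
  unfolding wr_def
proof (intro allI impI)
  fix A a assume "dfn \<Gamma> (\<lambda>e. A (e 0) (e 1))" and ex: "\<forall>x. \<exists>y. y \<prec> a \<and> A x y"
  then obtain p c where p: "p \<in> \<Gamma>" "\<And>x y. A x y \<longleftrightarrow> sat (case_nat x (case_nat y c)) p"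
    using dfn2_formula[where A = A, OF assms(1)] by blast
  from assms(2)[OF p(1), of "case_nat a c"] ex
  show "\<exists>y. y \<prec> a \<and> (\<forall>b. \<exists>x. b \<prec> x \<and> A x y)"
    unfolding sat_WRax p(2) by blast
qed

lemma sat_WRax_if_wr:
  assumes "sub_closed \<Gamma>" "wr \<Gamma>" "p \<in> \<Gamma>" shows "sat e (WRax p)"
proof -
  define a c where "a = e 0" and "c = (\<lambda>n. e (Suc n))"
  have e: "e = case_nat a c" by (rule nat_ext) (simp_all add: a_def c_def)
  have "efn (\<lambda>e. case_nat (e 0) (case_nat (e 1) c))" by (intro efn_case tfn_var efn_const)
  from dfn_subst[OF assms(1) dfn_sat[OF assms(1,3)] this]
  have d: "dfn \<Gamma> (\<lambda>e. sat (case_nat (e 0) (case_nat (e 1) c)) p)" .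
  show ?thesis unfolding e sat_WRax
    using wrD[where A = "\<lambda>x y. sat (case_nat x (case_nat y c)) p", OF assms(2) d, of a] by blast
qed

lemma wr_cong:
  assumes "\<And>P. dfn \<Gamma> P \<Longrightarrow> dfn \<Delta> P" "wr \<Delta>" shows "wr \<Gamma>"
  unfolding wr_def
proof (intro allI impI)
  fix A a assume "dfn \<Gamma> (\<lambda>e. A (e 0) (e 1))" "\<forall>x. \<exists>y. y \<prec> a \<and> A x y"
  then show "\<exists>y. y \<prec> a \<and> (\<forall>b. \<exists>x. b \<prec> x \<and> A x y)"
    by (rule wrD[where A = A, OF assms(2) assms(1)])
qed

text \<open>Think of \<open>T x y b\<close> as the statement that \<open>b\<close> still looks, at stage \<open>x\<close>, like a witness
  for \<open>\<exists>b. \<forall>z. C y b z\<close>. Weak regularity is applied to the relation saying that at stage \<open>x\<close>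
  the least apparent witness of \<open>y\<close> dominates those of all other \<open>y' \<prec> a\<close>; the true
  witness of the resulting \<open>y\<close> then bounds all of them.\<close>

lemma wr_bound:
  assumes ind: "indn (Sigma0_cl (Sig n))" and wr: "wr (Sigma0_cl (Sig n))"
    and C: "dfn (Sigma0_cl (Sig n)) (\<lambda>e. C (e 0) (e 1) (e 2))"
    and ex: "\<And>y. y \<prec> a \<Longrightarrow> \<exists>b. \<forall>z. C y b z"
  shows "\<exists>\<beta>. \<forall>x y. y \<prec> a \<longrightarrow> (\<exists>b. b \<prec> \<beta> \<and> (\<forall>z. z \<prec> x \<longrightarrow> C y b z))"
proof (cases "a = \<zero>")
  case False
  define T where "T x y b \<longleftrightarrow> (\<forall>z. z \<prec> x \<longrightarrow> C y b z)" for x y b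
  \<comment> \<open>The guard \<open>b \<prec> x\<close> keeps the quantifier over \<open>b\<close>
    bounded; a \<open>y\<close> without apparent witness below \<open>x\<close> dominates
    vacuously.\<close>
  define F where "F x y \<longleftrightarrow> (\<forall>b. b \<prec> x \<longrightarrow> T x y b \<longrightarrow>
    (\<forall>y'. y' \<prec> a \<longrightarrow> (\<exists>b'. b' \<prec> b \<oplus> \<one> \<and> T x y' b')))" for x y
  have D: "dfn (Sigma0_cl (Sig n)) (\<lambda>e. C (f e) (g e) (h e))" if "tfn f" "tfn g" "tfn h" for f g h
    by (rule dfn3[where A = C, OF sub_closed_classes(4) C that])
  have dF: "dfn (Sigma0_cl (Sig n)) (\<lambda>e. F (e 0) (e 1))"
    unfolding F_def T_def by (intro dfn_intros D)
  have "\<exists>y. y \<prec> a \<and> F x y" for x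
  proof -
    \<comment> \<open>\<open>?G m\<close> caps the least apparent witness of each \<open>y\<close>
      at \<open>x\<close> and bounds all capped values by \<open>m\<close>. Because of the cap
      \<open>?G x\<close> holds outright, so the least \<open>m\<close> exists without any appeal to
      collection.\<close>
    let ?G = "\<lambda>m. \<forall>y. y \<prec> a \<longrightarrow> (\<exists>b. b \<prec> m \<oplus> \<one> \<and> (T x y b \<or> x \<preceq> b))"
    have "dfn (Sigma0_cl (Sig n)) (\<lambda>e. ?G (e 0))"
      unfolding T_def by (intro dfn_intros D)
    moreover have "?G x" by (auto simp: lt_succ_iff)
    ultimately obtain m where m: "?G m" "\<And>k. k \<prec> m \<Longrightarrow> \<not> ?G k"
      using least_number[where A = ?G, OF ind] by blast
    \<comment> \<open>This \<open>y\<close> attains the maximum \<open>m\<close>: there is nothing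
      below \<open>\<zero>\<close>, and for a successor \<open>?G\<close> fails at the
      predecessor.\<close>
    have "\<exists>y. y \<prec> a \<and> (\<forall>b. b \<prec> m \<longrightarrow> \<not> T x y b)"
    proof (cases "m = \<zero>")
      case True
      then show ?thesis using False by (auto simp: pos_iff[symmetric])
    next
      case False
      then obtain k where "m = k \<oplus> \<one>" using eq_zero_or_succ by blast
      with m(2)[of k] show ?thesis by auto
    qed
    then obtain y where y: "y \<prec> a" "\<And>b. b \<prec> m \<Longrightarrow> \<not> T x y b" by blast
    have "F x y" unfolding F_def
    proof (intro allI impI)
      fix b y' assume b: "b \<prec> x" "T x y b" and y': "y' \<prec> a"
      have "m \<preceq> b" using y(2) b(2) by (meson ord.not_le)
      obtain b' where b': "b' \<prec> m \<oplus> \<one>" "T x y' b' \<or> x \<preceq> b'" using m(1) y' by blast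
      then have "b' \<preceq> b" using \<open>m \<preceq> b\<close> by (auto simp: lt_succ_iff)
      then have "\<not> x \<preceq> b'" using b(1) by auto
      with b' \<open>b' \<preceq> b\<close> show "\<exists>b'. b' \<prec> b \<oplus> \<one> \<and> T x y' b'" by (auto simp: lt_succ_iff)
    qed
    with y(1) show ?thesis by blast
  qed
  then obtain y where y: "y \<prec> a" "\<And>b. \<exists>x. b \<prec> x \<and> F x y"
    using wrD[where A = F, OF wr dF] by blast
  obtain b where b: "\<And>z. C y b z" using ex[OF y(1)] by blast
  have "\<exists>b'. b' \<prec> b \<oplus> \<one> \<and> T x y' b'" if y': "y' \<prec> a" for x y'
  proof -
    \<comment> \<open>The stage must exceed \<open>b\<close>, for \<open>F\<close> to say anything
      about the true witness \<open>b\<close>, and \<open>x\<close>, since apparent witnesses at a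
      later stage remain apparent at \<open>x\<close>.\<close>
    obtain s where s: "x \<prec> s" "b \<prec> s" using ex_upper2 by blast
    obtain x' where x': "s \<prec> x'" "F x' y" using y(2) by blast
    have "T x' y b" using b by (simp add: T_def)
    moreover have "b \<prec> x'" using s(2) x'(1) by (rule lt_trans)
    ultimately obtain b' where "b' \<prec> b \<oplus> \<one>" "T x' y' b'" using x'(2) y' unfolding F_def by blast
    moreover have "z \<prec> x'" if "z \<prec> x" for z using that s(1) x'(1) lt_trans by blast
    ultimately show ?thesis unfolding T_def by blast
  qed
  then show ?thesis unfolding T_def by blast
qed simp

text \<open>The value \<open>y\<close> and its contracted witness \<open>w\<close> are put below one
  number \<open>c\<close>; collecting \<open>c\<close> then collects \<open>y\<close>, by
  transitivity.\<close>

lemma coll_Suc_if_Pi: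
  assumes bc: "ball_closed n"
    and Pi: "\<And>A a. dfn (Pi n) (\<lambda>e. A (e 0) (e 1)) \<Longrightarrow> \<forall>x. x \<prec> a \<longrightarrow> (\<exists>y. A x y) \<Longrightarrow>
      \<exists>b. \<forall>x. x \<prec> a \<longrightarrow> (\<exists>y. y \<prec> b \<and> A x y)"
  shows "coll (Suc n)"
  unfolding coll_def
proof (intro allI impI)
  fix A a assume A: "dfn (Sig (Suc n)) (\<lambda>e. A (e 0) (e 1))" and ex: "\<forall>x. x \<prec> a \<longrightarrow> (\<exists>y. A x y)"
  obtain B where B: "dfn (Pi n) (\<lambda>e. B (e 0) (e 1) (e 2))" "\<And>x y. A x y \<longleftrightarrow> (\<exists>w. B w x y)"
    using contraction2[where A = A, OF bc A] by blast
  let ?A = "\<lambda>x c. \<exists>y. y \<prec> c \<and> (\<exists>w. w \<prec> c \<and> B w x y)"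
  have D: "dfn (Pi n) (\<lambda>e. B (f e) (g e) (h e))" if "tfn f" "tfn g" "tfn h" for f g h
    by (rule dfn3[where A = B, OF sub_closed_classes(3) B(1) that])
  have "dfn (Pi n) (\<lambda>e. ?A (e 0) (e 1))" by (intro dfn_Pi_bex[OF bc] D tfn_intros)
  moreover have "\<forall>x. x \<prec> a \<longrightarrow> (\<exists>c. ?A x c)"
  proof (intro allI impI)
    fix x assume "x \<prec> a"
    then obtain y w where "B w x y" using ex B(2) by blast
    moreover obtain c where "y \<prec> c" "w \<prec> c" using ex_upper2 by blast
    ultimately show "\<exists>c. ?A x c" by blast
  qed
  ultimately have "\<exists>b. \<forall>x. x \<prec> a \<longrightarrow> (\<exists>c. c \<prec> b \<and> ?A x c)" by (rule Pi[of ?A a])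
  then obtain b where b: "\<forall>x. x \<prec> a \<longrightarrow> (\<exists>c. c \<prec> b \<and> ?A x c)" by blast
  have "\<exists>y. y \<prec> b \<and> A x y" if x: "x \<prec> a" for x
  proof -
    obtain c y w where "c \<prec> b" "y \<prec> c" "B w x y" using b x by blast
    then show ?thesis using B(2) lt_trans by blast
  qed
  then show "\<exists>b. \<forall>x. x \<prec> a \<longrightarrow> (\<exists>y. y \<prec> b \<and> A x y)" by blast
qed

text \<open>The start has a matrix with no quantifier left to approximate, so \<open>z\<close> is a
  dummy; stage \<open>\<one>\<close> contains \<open>z = \<zero>\<close> and returns the matrix
  itself.\<close>

lemma coll_1_if_wr:
  assumes wr: "wr (Sigma0_cl (Sig 0))" shows "coll 1"
proof -
  have "coll (Suc 0)"
  proof (rule coll_Suc_if_Pi[OF ball_closed_0])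
    fix A a assume A: "dfn (Pi 0) (\<lambda>e. A (e 0) (e 1))" and ex: "\<forall>x. x \<prec> a \<longrightarrow> (\<exists>y. A x y)"
    have "dfn (Sigma0_cl (Sig 0)) (\<lambda>e. A (e 0) (e 1))"
      using dfn_mono[OF Delta0_subset_Sigma0_cl] A by simp
    then obtain \<beta> where "\<forall>x y. y \<prec> a \<longrightarrow> (\<exists>b. b \<prec> \<beta> \<and> (\<forall>z. z \<prec> x \<longrightarrow> A y b))"
      using wr_bound[where C = "\<lambda>y b z. A y b" and a = a and n = 0, OF _ wr] ex indn_Delta0
      by (auto simp: Sigma0_cl_Delta0)
    then show "\<exists>b. \<forall>x. x \<prec> a \<longrightarrow> (\<exists>y. y \<prec> b \<and> A x y)" using zero_lt_one by blast
  qed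
  then show ?thesis by simp
qed

text \<open>If no single \<open>b \<prec> \<beta>\<close> were a true witness for \<open>y\<close>,
  each would be refuted by some \<open>z\<close>. Collection at level n+1 bounds these
  \<open>z\<close> by one stage \<open>x\<close>, at which \<open>y\<close> would have no apparent
  witness below \<open>\<beta>\<close>, contrary to the choice of \<open>\<beta>\<close>.\<close>

lemma coll_step_if_wr:
  assumes wr: "wr (Sigma0_cl (Sig n))" and c: "coll (Suc n)" shows "coll (Suc (Suc n))"
proof (rule coll_Suc_if_Pi)
  show "ball_closed (Suc n)" using ball_closed_if_coll c by blast
  have bc: "ball_closed n" using ball_closed_if_coll coll_antimono[OF c] by blast
  fix A a assume A: "dfn (Pi (Suc n)) (\<lambda>e. A (e 0) (e 1))" and ex: "\<forall>x. x \<prec> a \<longrightarrow> (\<exists>y. A x y)"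
  obtain C where C: "dfn (Sig n) (\<lambda>e. C (e 0) (e 1) (e 2))" "\<And>x y. A x y \<longleftrightarrow> (\<forall>w. C w x y)"
    using contraction2_Pi[where A = A, OF bc A] by blast
  have D: "dfn (Sig n) (\<lambda>e. C (f e) (g e) (h e))" if "tfn f" "tfn g" "tfn h" for f g h
    by (rule dfn3[where A = C, OF sub_closed_classes(2) C(1) that])
  have "dfn (Sigma0_cl (Sig n)) (\<lambda>e. C (e 2) (e 0) (e 1))"
    by (rule dfn_mono[OF _ D]; (intro tfn_intros)?) (auto intro: Sigma0_cl.base)
  then obtain \<beta> where \<beta>: "\<forall>x y. y \<prec> a \<longrightarrow> (\<exists>b. b \<prec> \<beta> \<and> (\<forall>z. z \<prec> x \<longrightarrow> C z y b))"
    using wr_bound[where C = "\<lambda>y b z. C z y b" and a = a, OF indn_if_coll[OF c] wr] ex C(2) by blast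
  have "\<exists>b. b \<prec> \<beta> \<and> A y b" if y: "y \<prec> a" for y
  proof (rule ccontr)
    assume "\<not> ?thesis"
    then have "\<forall>b. b \<prec> \<beta> \<longrightarrow> (\<exists>z. \<not> C z y b)" using C(2) by blast
    moreover have "dfn (Sig (Suc n)) (\<lambda>e. \<not> C (e 1) y (e 0))"
      by (rule dfn_mono[OF Pi_subset_Sig_Suc], rule dfn_neg_Sig, intro D tfn_intros)
    ultimately obtain x where "\<forall>b. b \<prec> \<beta> \<longrightarrow> (\<exists>z. z \<prec> x \<and> \<not> C z y b)"
      using collD[where A = "\<lambda>b z. \<not> C z y b", OF c] by blast
    with \<beta> y show False by blast
  qed
  then show "\<exists>b. \<forall>x. x \<prec> a \<longrightarrow> (\<exists>y. y \<prec> b \<and> A x y)" by blast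
qed

lemma coll_if_wr_Sigma0: "wr (Sigma0_cl (Sig n)) \<Longrightarrow> coll (Suc (Suc n))"
proof (induction n)
  case 0
  then show ?case using coll_step_if_wr coll_1_if_wr by simp
next
  case (Suc n)
  have "wr (Sigma0_cl (Sig n))"
    by (rule wr_cong[OF dfn_mono[OF Sigma0_cl_mono[OF Sig_subset_Sig_Suc]] Suc.prems])
  then show ?case using Suc coll_step_if_wr by blast
qed

section \<open>Disjunctions of a Sigma and a Pi predicate\<close>

lemma dfn_SigOrPi: "dfn (Sig k) P \<Longrightarrow> dfn (Pi k) Q \<Longrightarrow> dfn (SigOrPi k) (\<lambda>e. P e \<or> Q e)"
  by (rule dfn_op2[where F = Disj and h = "(\<or>)" and \<Gamma> = "Sig k" and \<Delta> = "Pi k"]) (auto simp: SigOrPi_def)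

lemma dfn_SigOrPi_if_Sig:
  assumes "dfn (Sig k) P" shows "dfn (SigOrPi k) P"
  using dfn_SigOrPi[OF assms dfn_mono[OF Delta0_subset(2) dfn_const_pred[of False]]] by simp

lemma sub_closed_SigOrPi [simp]: "sub_closed (SigOrPi k)"
  using sub_closed_classes(2,3)[of k] by (auto simp: sub_closed_def SigOrPi_def)

lemma dfn_SigOrPi_cases:
  assumes "dfn (SigOrPi k) P"
  obtains Q R where "dfn (Sig k) Q" "dfn (Pi k) R" "P = (\<lambda>e. Q e \<or> R e)"
proof -
  obtain p q c where p: "p \<in> Sig k" "q \<in> Pi k" "\<And>e. P e \<longleftrightarrow> sat (mix e c) (Disj p q)"
    using assms unfolding dfn_def SigOrPi_def by blast
  show ?thesis
  proof (rule that)
    show "dfn (Sig k) (\<lambda>e. sat (mix e c) p)" "dfn (Pi k) (\<lambda>e. sat (mix e c) q)"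
      using p(1,2) unfolding dfn_def by blast+
    show "P = (\<lambda>e. sat (mix e c) p \<or> sat (mix e c) q)" using p(3) by auto
  qed
qed

text \<open>Placing Sigma_0(Sigma_(n+1)) inside Sigma_(n+2) already takes collection at level n+2.
  The induction supplies it, since Sigma_(n+1) or Pi_(n+1) disjunctions are Sigma_(n+2) and inherit
  weak regularity from the level above.\<close>

lemma coll_if_wr_SigOrPi: "wr (SigOrPi (Suc n)) \<Longrightarrow> coll (Suc (Suc n))"
proof (induction n)
  case 0
  have "wr (Sigma0_cl (Sig 0))"
    by (rule wr_cong[OF _ 0])
       (use dfn_SigOrPi_if_Sig dfn_mono[OF Delta0_subset(1)] in \<open>simp add: Sigma0_cl_Delta0\<close>)
  then show ?case by (rule coll_if_wr_Sigma0)
next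
  case (Suc n)
  have "wr (SigOrPi (Suc n))"
  proof (rule wr_cong[OF _ Suc.prems])
    fix P assume "dfn (SigOrPi (Suc n)) P"
    then obtain Q R where "dfn (Sig (Suc n)) Q" "dfn (Pi (Suc n)) R" "P = (\<lambda>e. Q e \<or> R e)"
      by (rule dfn_SigOrPi_cases)
    then have "dfn (Sig (Suc (Suc n))) P"
      using dfn_Sig_disj dfn_mono[OF Sig_subset_Sig_Suc] dfn_mono[OF Pi_subset_Sig_Suc] by simp
    then show "dfn (SigOrPi (Suc (Suc n))) P" by (rule dfn_SigOrPi_if_Sig)
  qed
  then have c: "coll (Suc (Suc n))" by (rule Suc.IH)
  have "wr (Sigma0_cl (Sig (Suc n)))"
    by (rule wr_cong[OF dfn_SigOrPi_if_Sig[OF dfn_Sigma0_Sig[OF c]] Suc.prems])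
  then show ?case by (rule coll_if_wr_Sigma0)
qed

section \<open>Coding finite sets\<close>

text \<open>The bound on the quotient makes divisibility \<open>\<Delta>\<^sub>0\<close>; for a nonzero divisor it is no restriction.\<close>

definition dv :: "'a \<Rightarrow> 'a \<Rightarrow> bool" where
  "dv x y \<longleftrightarrow> (\<exists>q. q \<prec> y \<oplus> \<one> \<and> y = x \<otimes> q)"

text \<open>The moduli of Goedel's beta function. A set is coded by a product of the moduli of its
  elements, so that membership is divisibility and adding an element is a multiplication.\<close>

definition modulus :: "'a \<Rightarrow> 'a \<Rightarrow> 'a" where "modulus v i = \<one> \<oplus> (i \<oplus> \<one>) \<otimes> v"

definition mem :: "'a \<Rightarrow> 'a \<Rightarrow> 'a \<Rightarrow> bool" where "mem v u i \<longleftrightarrow> dv (modulus v i) u"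

lemma dv_iff: "x \<noteq> \<zero> \<Longrightarrow> dv x y \<longleftrightarrow> (\<exists>q. y = x \<otimes> q)"
proof
  assume x: "x \<noteq> \<zero>" and "\<exists>q. y = x \<otimes> q"
  then obtain q where q: "y = x \<otimes> q" by blast
  obtain z where "x = z \<oplus> \<one>" using x eq_zero_or_succ by blast
  then have "y = z \<otimes> q \<oplus> q" using q by (simp add: ring.distrib_right)
  then have "q \<prec> y \<oplus> \<one>" by (simp add: lt_succ_iff)
  with q show "dv x y" unfolding dv_def by blast
qed (auto simp: dv_def)

lemma dfn_dv: "tfn f \<Longrightarrow> tfn g \<Longrightarrow> dfn (Sigma0_cl (Sig n)) (\<lambda>e. dv (f e) (g e))"
proof -
  have "dfn (Sigma0_cl (Sig n)) (\<lambda>e. dv (e 0) (e 1))" unfolding dv_def by (intro dfn_intros)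
  then show "tfn f \<Longrightarrow> tfn g \<Longrightarrow> dfn (Sigma0_cl (Sig n)) (\<lambda>e. dv (f e) (g e))"
    by (rule dfn2[where A = dv, OF sub_closed_classes(4)])
qed

lemma tfn_modulus: "tfn f \<Longrightarrow> tfn g \<Longrightarrow> tfn (\<lambda>e. modulus (f e) (g e))"
  unfolding modulus_def by (intro tfn_intros)

lemma dfn_mem: "tfn f \<Longrightarrow> tfn g \<Longrightarrow> tfn h \<Longrightarrow> dfn (Sigma0_cl (Sig n)) (\<lambda>e. mem (f e) (g e) (h e))"
  unfolding mem_def by (intro dfn_dv tfn_modulus)

lemma modulus_nonzero: "modulus v i \<noteq> \<zero>"
proof -
  have "\<one> \<preceq> modulus v i" by (simp add: modulus_def)
  then show ?thesis by (metis ord.less_le_trans lt_irrefl zero_lt_one)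
qed

lemma mult_le_cancel: "x \<noteq> \<zero> \<Longrightarrow> x \<otimes> y \<prec> x \<otimes> z \<longleftrightarrow> y \<prec> z"
  using mult_lt_mono[of x y z] mult_lt_mono[of x z y] lt_linear[of y z] ord.less_asym[of "x \<otimes> y" "x \<otimes> z"]
  by (auto simp: pos_iff mult_commute[of _ x])

text \<open>Takes the place of subtraction: since m*r is at most m*s, the difference of
  \<open>r\<close> and \<open>s\<close> exists and provides the quotient.\<close>

lemma dvd_cancel:
  assumes m: "m \<noteq> \<zero>" and eq: "u \<oplus> m \<otimes> r = m \<otimes> s"
  shows "\<exists>q. u = m \<otimes> q"
proof -
  have "r \<preceq> s"
  proof (rule ccontr)
    assume "\<not> r \<preceq> s"
    then have "m \<otimes> s \<prec> m \<otimes> r" using m by (simp add: mult_le_cancel)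
    moreover have "m \<otimes> r \<preceq> m \<otimes> s" unfolding eq[symmetric] by simp
    ultimately show False by simp
  qed
  then obtain d where "s = r \<oplus> d" using le_imp_diff by blast
  then have "u \<oplus> m \<otimes> r = m \<otimes> d \<oplus> m \<otimes> r" using eq by (simp add: distrib_left add_commute)
  then show ?thesis using add_cancel by blast
qed

text \<open>A Bezout identity without subtraction. With k = i+1, l = j+1 and moduli m = 1+kv, n =
  1+lv one has l*m - k*n = d; multiplied by k*q, the right side becomes k*v = m-1.\<close>

lemma modulus_identity:
  assumes v: "v = d \<otimes> q" and j: "j = i \<oplus> d"
  shows "\<one> \<oplus> (i \<oplus> \<one>) \<otimes> (j \<oplus> \<one>) \<otimes> q \<otimes> modulus v i
    = modulus v i \<oplus> (i \<oplus> \<one>) \<otimes> (i \<oplus> \<one>) \<otimes> q \<otimes> modulus v j"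
proof -
  define k where "k = i \<oplus> \<one>"
  have j': "j \<oplus> \<one> = k \<oplus> d" by (simp add: j k_def ring.add_ac)
  show ?thesis
    unfolding modulus_def j' k_def[symmetric] v
    by (simp add: ring.distrib_left ring.distrib_right ring.add_ac ring.mult_ac)
qed

text \<open>The difference of two indices below \<open>L\<close> divides \<open>v\<close>, so the
  Bezout identity applies; multiplied by \<open>u\<close> it serves both directions.\<close>

lemma modulus_coprime:
  assumes dv: "\<And>d. \<zero> \<prec> d \<Longrightarrow> d \<preceq> L \<Longrightarrow> \<exists>q. v = d \<otimes> q"
    and ij: "i \<prec> j" "j \<prec> L"
  shows "(\<exists>r. modulus v j \<otimes> u = modulus v i \<otimes> r) \<Longrightarrow> \<exists>q. u = modulus v i \<otimes> q"
    and "(\<exists>r. modulus v i \<otimes> u = modulus v j \<otimes> r) \<Longrightarrow> \<exists>q. u = modulus v j \<otimes> q"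
proof -
  obtain d where d: "j = i \<oplus> d" using lt_imp_diff ij(1) by metis
  have "\<zero> \<prec> d" using ij(1) d by (cases "d = \<zero>") (simp_all add: pos_iff)
  moreover have "d \<preceq> L" using ij(2) d le_add'[of d i] ord.order_trans[of d j L] by (simp add: le_def)
  ultimately obtain q where q: "v = d \<otimes> q" using dv by blast
  let ?m = "modulus v i" and ?n = "modulus v j" and ?c = "(i \<oplus> \<one>) \<otimes> (j \<oplus> \<one>) \<otimes> q"
    and ?d = "(i \<oplus> \<one>) \<otimes> (i \<oplus> \<one>) \<otimes> q"
  have "(\<one> \<oplus> ?c \<otimes> ?m) \<otimes> u = (?m \<oplus> ?d \<otimes> ?n) \<otimes> u"
    by (simp only: modulus_identity[OF q d])
  then have id: "u \<oplus> ?c \<otimes> (?m \<otimes> u) = ?m \<otimes> u \<oplus> ?d \<otimes> (?n \<otimes> u)"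
    by (simp only: ring.distrib_right ring.mult_1_left mult_assoc)
  show "\<exists>q. u = ?m \<otimes> q" if ex: "\<exists>r. ?n \<otimes> u = ?m \<otimes> r"
  proof -
    obtain r where "?n \<otimes> u = ?m \<otimes> r" using ex by blast
    then have "u \<oplus> ?m \<otimes> (?c \<otimes> u) = ?m \<otimes> (u \<oplus> ?d \<otimes> r)"
      using id by (simp only: distrib_left ring.mult.left_commute)
    then show ?thesis by (rule dvd_cancel[OF modulus_nonzero])
  qed
  show "\<exists>q. u = ?n \<otimes> q" if ex: "\<exists>r. ?m \<otimes> u = ?n \<otimes> r"
  proof -
    obtain r where "?m \<otimes> u = ?n \<otimes> r" using ex by blast
    then have "u \<oplus> ?n \<otimes> (?c \<otimes> r) = ?n \<otimes> (r \<oplus> ?d \<otimes> u)"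
      using id by (simp only: distrib_left ring.mult.left_commute)
    then show ?thesis by (rule dvd_cancel[OF modulus_nonzero])
  qed
qed

lemma mem_iff: "mem v u i \<longleftrightarrow> (\<exists>q. u = modulus v i \<otimes> q)"
  unfolding mem_def by (rule dv_iff[OF modulus_nonzero])

lemma mem_mult_modulus:
  assumes dv: "\<And>d. \<zero> \<prec> d \<Longrightarrow> d \<preceq> L \<Longrightarrow> \<exists>q. v = d \<otimes> q" and ik: "i \<prec> L" "k \<prec> L"
  shows "mem v (modulus v k \<otimes> u) i \<longleftrightarrow> i = k \<or> mem v u i"
proof
  assume m: "mem v (modulus v k \<otimes> u) i"
  show "i = k \<or> mem v u i"
  proof (cases "i = k")
    case False
    then have "i \<prec> k \<or> k \<prec> i" using lt_linear by blast
    then have "mem v u i"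
      using modulus_coprime(1)[OF dv, of L i k u] modulus_coprime(2)[OF dv, of L k i u] ik m
      unfolding mem_iff by blast
    then show ?thesis ..
  qed simp
next
  assume "i = k \<or> mem v u i"
  then show "mem v (modulus v k \<otimes> u) i"
    unfolding mem_iff by (auto simp: ring.mult.left_commute)
qed

section \<open>Existence of codes by Sigma_1 induction\<close>

lemma indn_Sigma1D:
  assumes "indn (Sig 1)" "dfn (Sigma0_cl (Sig 0)) (\<lambda>e. B (e 0) (e 1))"
    "\<exists>y. B y \<zero>" "\<And>x y. B y x \<Longrightarrow> \<exists>y'. B y' (x \<oplus> \<one>)"
  shows "\<exists>y. B y x"
proof (rule indnD[where A = "\<lambda>x. \<exists>y. B y x", OF assms(1)])
  have "dfn (Sig (Suc 0)) (\<lambda>e. B (e 0) (e 1))"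
    using dfn_mono[OF Delta0_subset(1)] assms(2) by (simp add: Sigma0_cl_Delta0)
  then have "dfn (Sig (Suc 0)) (\<lambda>e. \<exists>y. B y (e 0))" by (intro dfn_Sig_ex) simp
  then show "dfn (Sig 1) (\<lambda>e. \<exists>y. B y (e 0))" by simp
qed (use assms(3,4) in blast)+

text \<open>Stands in for a product: each step multiplies the previous witness by
  \<open>m L\<close>. It is applied to the numbers up to \<open>L\<close>, giving \<open>v\<close>,
  and then to the moduli, giving \<open>W\<close>.\<close>

lemma ex_common_multiple:
  assumes ind: "indn (Sig 1)" and m: "\<And>f. tfn f \<Longrightarrow> tfn (\<lambda>e. m (f e))" "\<And>i. m i \<noteq> \<zero>"
  shows "\<exists>v. v \<noteq> \<zero> \<and> (\<forall>i. i \<prec> L \<longrightarrow> dv (m i) v)"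
proof (rule indn_Sigma1D[where B = "\<lambda>v L. v \<noteq> \<zero> \<and> (\<forall>i. i \<prec> L \<longrightarrow> dv (m i) v)", OF ind])
  show "dfn (Sigma0_cl (Sig 0)) (\<lambda>e. e 0 \<noteq> \<zero> \<and> (\<forall>i. i \<prec> e 1 \<longrightarrow> dv (m i) (e 0)))"
    by (intro dfn_intros dfn_dv m)
  show "\<exists>v. v \<noteq> \<zero> \<and> (\<forall>i. i \<prec> \<zero> \<longrightarrow> dv (m i) v)"
    by (rule exI[of _ \<one>]) simp
  fix L v assume v: "v \<noteq> \<zero> \<and> (\<forall>i. i \<prec> L \<longrightarrow> dv (m i) v)"
  show "\<exists>v. v \<noteq> \<zero> \<and> (\<forall>i. i \<prec> L \<oplus> \<one> \<longrightarrow> dv (m i) v)"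
  proof (intro exI[of _ "m L \<otimes> v"] conjI allI impI)
    have "m L \<otimes> \<zero> \<prec> m L \<otimes> v" by (subst mult_le_cancel) (use v m(2)[of L] in \<open>simp_all add: pos_iff\<close>)
    then show "m L \<otimes> v \<noteq> \<zero>" by auto
    fix i assume "i \<prec> L \<oplus> \<one>"
    then have "i = L \<or> i \<prec> L" by (auto simp: lt_succ_iff le_def)
    then show "dv (m i) (m L \<otimes> v)"
    proof
      assume "i \<prec> L"
      then obtain q where "v = m i \<otimes> q" using v unfolding dv_def by blast
      then have "m L \<otimes> v = m i \<otimes> (m L \<otimes> q)" by (simp only: ring.mult.left_commute)
      then show ?thesis unfolding dv_iff[OF m(2)] by blast
    qed (auto simp: dv_iff[OF m(2)])
  qed
qed

lemma succ_nonzero: "x \<oplus> \<one> \<noteq> \<zero>"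
  using lt_add_one[of x] not_lt_zero by metis

lemma ex_division:
  assumes ind: "indn (Sig 1)" and W: "W \<noteq> \<zero>"
  shows "\<exists>q r. r \<prec> W \<and> u = W \<otimes> q \<oplus> r"
proof -
  have "\<exists>q. \<exists>r. r \<prec> W \<and> u = W \<otimes> q \<oplus> r"
  proof (rule indn_Sigma1D[where B = "\<lambda>q u. \<exists>r. r \<prec> W \<and> u = W \<otimes> q \<oplus> r", OF ind])
    show "dfn (Sigma0_cl (Sig 0)) (\<lambda>e. \<exists>r. r \<prec> W \<and> e 1 = W \<otimes> e 0 \<oplus> r)"
      by (intro dfn_intros)
    show "\<exists>q r. r \<prec> W \<and> \<zero> = W \<otimes> q \<oplus> r"
      by (rule exI[of _ \<zero>], rule exI[of _ \<zero>]) (use W in \<open>simp add: pos_iff\<close>)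
    fix u q assume "\<exists>r. r \<prec> W \<and> u = W \<otimes> q \<oplus> r"
    then obtain r where r: "r \<prec> W" "u = W \<otimes> q \<oplus> r" by blast
    show "\<exists>q r. r \<prec> W \<and> u \<oplus> \<one> = W \<otimes> q \<oplus> r"
    proof (cases "r \<oplus> \<one> \<prec> W")
      case True
      then show ?thesis using r(2) add_assoc by blast
    next
      case False
      with r(1) have "r \<oplus> \<one> = W"
        by (metis lt_succ_iff ord.leD ord.less_linear)
      then have "u \<oplus> \<one> = W \<otimes> (q \<oplus> \<one>) \<oplus> \<zero>"
        by (simp add: r(2) add_assoc distrib_left)
      moreover have "\<zero> \<prec> W" using W by (simp add: pos_iff)
      ultimately show ?thesis by blast
    qed
  qed
  then show ?thesis .
qed

text \<open>Codes are bounded by passing to the remainder modulo a common multiple \<open>W\<close> of the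
  moduli, which does not change membership below \<open>L\<close>.\<close>

lemma ex_codes:
  assumes ind: "indn (Sig 1)"
  obtains v W where "\<exists>u. u \<prec> W \<and> (\<forall>i. i \<prec> L \<longrightarrow> \<not> mem v u i)"
    and "\<And>u k. k \<prec> L \<Longrightarrow> \<exists>u'. u' \<prec> W \<and> (\<forall>i. i \<prec> L \<longrightarrow> (mem v u' i \<longleftrightarrow> i = k \<or> mem v u i))"
proof -
  obtain v where v: "v \<noteq> \<zero>" "\<And>i. i \<prec> L \<Longrightarrow> dv (i \<oplus> \<one>) v"
    using ex_common_multiple[where m = "\<lambda>i. i \<oplus> \<one>" and L = L, OF ind tfn_plus[OF _ tfn_const]]
      succ_nonzero by blast
  have dv: "\<exists>q. v = d \<otimes> q" if d: "\<zero> \<prec> d" "d \<preceq> L" for d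
  proof -
    obtain i where i: "d = i \<oplus> \<one>" using eq_zero_or_succ[of d] d(1) by auto
    then have "i \<prec> L" using d(2) lt_add_one[of i] ord.less_le_trans by blast
    then show ?thesis using v(2)[of i] i unfolding dv_def by blast
  qed
  obtain W where W: "W \<noteq> \<zero>" "\<And>i. i \<prec> L \<Longrightarrow> dv (modulus v i) W"
    using ex_common_multiple[where m = "modulus v" and L = L, OF ind tfn_modulus[OF tfn_const] modulus_nonzero]
    by blast
  have red: "\<exists>u'. u' \<prec> W \<and> (\<forall>i. i \<prec> L \<longrightarrow> (mem v u' i \<longleftrightarrow> mem v u i))" for u
  proof -
    obtain q r where r: "r \<prec> W" "u = W \<otimes> q \<oplus> r" using ex_division[OF ind W(1)] by blast
    have "mem v r i \<longleftrightarrow> mem v u i" if i: "i \<prec> L" for i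
    proof -
      obtain w where w: "W = modulus v i \<otimes> w" using W(2)[OF i] unfolding dv_def by blast
      then have u: "r \<oplus> modulus v i \<otimes> (w \<otimes> q) = u" using r(2) by (simp add: mult_assoc add_commute)
      show ?thesis
      proof
        assume "mem v r i"
        then obtain s where "r = modulus v i \<otimes> s" unfolding mem_iff by blast
        then have "u = modulus v i \<otimes> (s \<oplus> w \<otimes> q)" using u by (simp add: distrib_left)
        then show "mem v u i" unfolding mem_iff by blast
      next
        assume "mem v u i"
        then obtain s where "u = modulus v i \<otimes> s" unfolding mem_iff by blast
        with u dvd_cancel[OF modulus_nonzero] show "mem v r i" unfolding mem_iff by blast
      qed
    qed
    with r(1) show ?thesis by blast
  qed
  \<comment> \<open>The empty product \<open>\<one>\<close> codes the empty set: \<open>v\<close> is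
    nonzero, so every modulus exceeds \<open>\<one>\<close>.\<close>
  have "\<not> mem v \<one> i" for i
  proof
    assume "mem v \<one> i"
    then obtain q where q: "\<one> = modulus v i \<otimes> q" unfolding mem_iff by blast
    then have "q \<noteq> \<zero>" using zero_lt_one by (metis lt_irrefl mult_zero)
    then obtain p where "q = p \<oplus> \<one>" using eq_zero_or_succ by blast
    then have "\<one> = modulus v i \<otimes> p \<oplus> modulus v i" using q by (simp add: distrib_left)
    then have "modulus v i \<preceq> \<one>" using le_add'[of "modulus v i" "modulus v i \<otimes> p"] by simp
    moreover have "\<one> \<prec> modulus v i"
    proof -
      have "(i \<oplus> \<one>) \<otimes> \<zero> \<prec> (i \<oplus> \<one>) \<otimes> v"
        by (subst mult_le_cancel) (use v(1) succ_nonzero[of i] in \<open>simp_all add: pos_iff\<close>)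
      then have "\<one> \<oplus> \<zero> \<prec> modulus v i" unfolding modulus_def by (simp only: add_lt_cancel' mult_zero)
      then show ?thesis by simp
    qed
    ultimately show False by simp
  qed
  then have 1: "\<exists>u. u \<prec> W \<and> (\<forall>i. i \<prec> L \<longrightarrow> \<not> mem v u i)" using red[of \<one>] by blast
  have 2: "\<exists>u'. u' \<prec> W \<and> (\<forall>i. i \<prec> L \<longrightarrow> (mem v u' i \<longleftrightarrow> i = k \<or> mem v u i))" if k: "k \<prec> L" for u k
  proof -
    have "mem v (modulus v k \<otimes> u) i \<longleftrightarrow> i = k \<or> mem v u i" if "i \<prec> L" for i
      by (rule mem_mult_modulus[OF dv that k])
    then show ?thesis using red[of "modulus v k \<otimes> u"] by blast
  qed
  show ?thesis by (rule that[OF 1 2])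
qed

end

section \<open>Collection implies weak regularity\<close>

locale pi_cover = arith +
  fixes n :: nat and a :: 'a and P :: "'a \<Rightarrow> 'a \<Rightarrow> bool"
  assumes coll: "coll (Suc (Suc n))"
    and P: "dfn (Pi (Suc n)) (\<lambda>e. P (e 0) (e 1))"
    and cover: "\<And>x. \<exists>y. y \<prec> a \<and> P x y"
begin

text \<open>Base-\<open>a\<close> notation: for second components below \<open>a\<close> this is
  injective and orders the pairs lexicographically, \<open>b\<close> first. As
  \<open>b \<preceq> pr b y\<close>, quantifiers over \<open>b\<close> can be bounded by a bound on
  the code.\<close>

definition pr :: "'a \<Rightarrow> 'a \<Rightarrow> 'a" where "pr b y = a \<otimes> b \<oplus> y"

lemma a_nonzero: "a \<noteq> \<zero>"
  using cover by auto

lemma le_pr: "b \<preceq> pr b y"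
proof -
  obtain c where c: "a = c \<oplus> \<one>" using eq_zero_or_succ a_nonzero by blast
  have "pr b y = c \<otimes> b \<oplus> y \<oplus> b"
    by (subst pr_def, subst c) (simp only: ring.distrib_right ring.mult_1_left ring.add_ac)
  then show ?thesis by simp
qed

lemma pr_less: "y \<prec> a \<Longrightarrow> b \<prec> b' \<Longrightarrow> pr b y \<prec> pr b' y'"
proof -
  assume y: "y \<prec> a" and "b \<prec> b'"
  then obtain c where "b' = b \<oplus> c" "c \<noteq> \<zero>" using lt_imp_diff by (metis add_zero lt_irrefl)
  then obtain d where d: "b' = b \<oplus> (d \<oplus> \<one>)" using eq_zero_or_succ by blast
  have "pr b y \<prec> a \<otimes> b \<oplus> a" using y by (simp add: pr_def)
  also have "\<dots> \<preceq> pr b' y'"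
  proof -
    have "pr b' y' = a \<otimes> b \<oplus> a \<oplus> (a \<otimes> d \<oplus> y')" by (simp add: pr_def d distrib_left ring.add_ac)
    then show ?thesis by (simp only: le_add)
  qed
  finally show ?thesis .
qed

lemma pr_inj: "pr b y = pr b' y' \<Longrightarrow> y \<prec> a \<Longrightarrow> y' \<prec> a \<Longrightarrow> b = b' \<and> y = y'"
proof -
  assume eq: "pr b y = pr b' y'" and y: "y \<prec> a" "y' \<prec> a"
  have "b = b'" using lt_linear[of b b'] pr_less[of y b b' y'] pr_less[of y' b' b y] eq y by auto
  moreover from this have "y = y'" using eq add_cancel[of y "a \<otimes> b" y'] by (simp add: pr_def add_commute)
  ultimately show ?thesis ..
qed

text \<open>A code \<open>u\<close> represents, via \<open>pr\<close>, a set of pairs \<open>(b, y)\<close>, each being a commitment not to use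
  \<open>y\<close> as a value for any \<open>x\<close> above \<open>b\<close>. Here \<open>ok v u k\<close> says that the commitments below \<open>k\<close> still
  leave a value for every \<open>x\<close>, and \<open>free v u b y\<close> that those below \<open>pr b y\<close> together with
  \<open>(b, y)\<close> itself do. A greedy set makes every commitment that it can.\<close>

definition ok :: "'a \<Rightarrow> 'a \<Rightarrow> 'a \<Rightarrow> bool" where
  "ok v u k \<longleftrightarrow> (\<forall>x. \<exists>y. y \<prec> a \<and> P x y \<and> (\<forall>b. b \<prec> x \<longrightarrow> pr b y \<prec> k \<longrightarrow> \<not> mem v u (pr b y)))"

definition free :: "'a \<Rightarrow> 'a \<Rightarrow> 'a \<Rightarrow> 'a \<Rightarrow> bool" where
  "free v u b y \<longleftrightarrow> (\<forall>x. \<exists>y'. y' \<prec> a \<and> P x y' \<and> \<not> (b \<prec> x \<and> y' = y) \<and>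
     (\<forall>b'. b' \<prec> x \<longrightarrow> pr b' y' \<prec> pr b y \<longrightarrow> \<not> mem v u (pr b' y')))"

definition greedy :: "'a \<Rightarrow> 'a \<Rightarrow> 'a \<Rightarrow> bool" where
  "greedy v u k \<longleftrightarrow> ok v u k \<and>
     (\<forall>y. y \<prec> a \<longrightarrow> (\<forall>b. b \<prec> k \<longrightarrow> pr b y \<prec> k \<longrightarrow> \<not> mem v u (pr b y) \<longrightarrow> \<not> free v u b y))"

abbreviation "\<Delta> \<equiv> Sigma0_cl (Sig (Suc n))"

lemma bc: "ball_closed (Suc n)"
  using ball_closed_if_coll coll_antimono[OF coll] by blast

section \<open>The greedy process and its complexity\<close>

lemma tfn_pr: "tfn f \<Longrightarrow> tfn g \<Longrightarrow> tfn (\<lambda>e. pr (f e) (g e))"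
  unfolding pr_def by (intro tfn_intros)

lemma dfn_Delta0_Pi: "dfn (Sigma0_cl (Sig 0)) Q \<Longrightarrow> dfn (Pi (Suc n)) Q"
  by (rule dfn_mono[OF Delta0_subset(2)]) (simp add: Sigma0_cl_Delta0)

lemma dfn_Pi_\<Delta>: "dfn (Pi (Suc n)) Q \<Longrightarrow> dfn \<Delta> Q"
proof -
  assume "dfn (Pi (Suc n)) Q"
  then have "dfn \<Delta> (\<lambda>e. \<not> Q e)"
    unfolding dfn_Pi_iff by (rule dfn_mono[rotated]) (auto intro: Sigma0_cl.base)
  then have "dfn \<Delta> (\<lambda>e. \<not> \<not> Q e)" by (rule dfn_Sigma0_not)
  then show ?thesis by simp
qed

text \<open>The matrix under the unbounded quantifier over \<open>x\<close> is a bounded existential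
  one over Pi_(n+1), which stays Pi_(n+1) thanks to \<open>bc\<close>. Thus \<open>ok\<close> is
  Pi_(n+1), low enough for the available induction.\<close>

lemma dfn_ok: "tfn f \<Longrightarrow> tfn g \<Longrightarrow> tfn h \<Longrightarrow> dfn \<Delta> (\<lambda>e. ok (f e) (g e) (h e))"
proof -
  have "dfn (Pi (Suc n)) (\<lambda>e. ok (e 0) (e 1) (e 2))"
    unfolding ok_def
    by (intro dfn_Pi_all dfn_Pi_bex[OF bc] dfn_Pi_conj dfn2[where A = P, OF sub_closed_classes(3) P]
        dfn_Delta0_Pi dfn_intros tfn_pr dfn_mem)
  from dfn_Pi_\<Delta>[OF this] show "tfn f \<Longrightarrow> tfn g \<Longrightarrow> tfn h \<Longrightarrow> dfn \<Delta> (\<lambda>e. ok (f e) (g e) (h e))"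
    by (rule dfn3[where A = ok, OF sub_closed_classes(4)])
qed

lemma dfn_free: "tfn f \<Longrightarrow> tfn g \<Longrightarrow> tfn h \<Longrightarrow> tfn k \<Longrightarrow> dfn \<Delta> (\<lambda>e. free (f e) (g e) (h e) (k e))"
proof -
  have "dfn (Pi (Suc n)) (\<lambda>e. free (e 0) (e 1) (e 2) (e 3))"
    unfolding free_def
    by (intro dfn_Pi_all dfn_Pi_bex[OF bc] dfn_Pi_conj dfn2[where A = P, OF sub_closed_classes(3) P]
        dfn_Delta0_Pi dfn_intros tfn_pr dfn_mem)
  from dfn_Pi_\<Delta>[OF this]
  show "tfn f \<Longrightarrow> tfn g \<Longrightarrow> tfn h \<Longrightarrow> tfn k \<Longrightarrow> dfn \<Delta> (\<lambda>e. free (f e) (g e) (h e) (k e))"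
    by (rule dfn4[where A = free, OF sub_closed_classes(4)])
qed

lemma dfn_greedy: "tfn f \<Longrightarrow> tfn g \<Longrightarrow> tfn h \<Longrightarrow> dfn \<Delta> (\<lambda>e. greedy (f e) (g e) (h e))"
proof -
  have "dfn \<Delta> (\<lambda>e. greedy (e 0) (e 1) (e 2))"
    unfolding greedy_def by (intro dfn_intros dfn_ok dfn_free dfn_mem tfn_pr)
  then show "tfn f \<Longrightarrow> tfn g \<Longrightarrow> tfn h \<Longrightarrow> dfn \<Delta> (\<lambda>e. greedy (f e) (g e) (h e))"
    by (rule dfn3[where A = greedy, OF sub_closed_classes(4)])
qed

lemma indn_\<Delta>: "indn \<Delta>"
  by (rule indn_if_coll[OF coll])

lemma indn_Sig_1: "indn (Sig 1)"
proof (rule indn_mono[OF _ indn_\<Delta>])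
  have "Sig 1 \<subseteq> Sig (Suc n)" by (rule lift_Suc_mono_le[of Sig, OF Sig_subset_Sig_Suc]) simp
  then show "Sig 1 \<subseteq> \<Delta>" by (auto intro: Sigma0_cl.base)
qed

text \<open>The guard \<open>b \<prec> k\<close> in the definition, present to bound a quantifier,
  follows from \<open>pr b y \<prec> k\<close> by \<open>le_pr\<close>.\<close>

lemma greedyD: "greedy v u k \<Longrightarrow> y \<prec> a \<Longrightarrow> pr b y \<prec> k \<Longrightarrow> \<not> mem v u (pr b y) \<Longrightarrow> \<not> free v u b y"
  unfolding greedy_def using le_pr[of b y] ord.le_less_trans by blast

lemma greedyI:
  assumes "ok v u k" "\<And>b y. y \<prec> a \<Longrightarrow> pr b y \<prec> k \<Longrightarrow> \<not> mem v u (pr b y) \<Longrightarrow> \<not> free v u b y"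
  shows "greedy v u k"
  unfolding greedy_def using assms by blast

lemma free_cong:
  assumes "\<And>i. i \<prec> pr b y \<Longrightarrow> mem v u i \<longleftrightarrow> mem v' u' i"
  shows "free v u b y \<longleftrightarrow> free v' u' b y"
  by (simp add: free_def assms cong: imp_cong)

lemma ex_greedy: "\<exists>v u. greedy v u L"
proof -
  obtain v W where empty: "\<exists>u. u \<prec> W \<and> (\<forall>i. i \<prec> L \<longrightarrow> \<not> mem v u i)"
    and insert: "\<And>u k. k \<prec> L \<Longrightarrow>
      \<exists>u'. u' \<prec> W \<and> (\<forall>i. i \<prec> L \<longrightarrow> (mem v u' i \<longleftrightarrow> i = k \<or> mem v u i))"
    by (rule ex_codes[where L = L, OF indn_Sig_1]) (rule that)
  \<comment> \<open>\<open>v\<close> and \<open>W\<close> are fixed before the induction, so the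
    quantifier over codes is bounded and the formula stays in \<open>\<Delta>\<close>. The last
    conjunct says that nothing from \<open>k\<close> on has been committed, so the decision at
    \<open>k\<close> is still open.\<close>
  have "L \<preceq> L \<longrightarrow> (\<exists>u. u \<prec> W \<and> greedy v u L \<and> (\<forall>i. i \<prec> L \<longrightarrow> L \<preceq> i \<longrightarrow> \<not> mem v u i))"
  proof (rule indnD[where A = "\<lambda>k. k \<preceq> L \<longrightarrow>
      (\<exists>u. u \<prec> W \<and> greedy v u k \<and> (\<forall>i. i \<prec> L \<longrightarrow> k \<preceq> i \<longrightarrow> \<not> mem v u i))", OF indn_\<Delta>])
    show "dfn \<Delta> (\<lambda>e. e 0 \<preceq> L \<longrightarrow>
      (\<exists>u. u \<prec> W \<and> greedy v u (e 0) \<and> (\<forall>i. i \<prec> L \<longrightarrow> e 0 \<preceq> i \<longrightarrow> \<not> mem v u i)))"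
      by (intro dfn_intros dfn_greedy dfn_mem)
    obtain u where u: "u \<prec> W" "\<forall>i. i \<prec> L \<longrightarrow> \<not> mem v u i" using empty by blast
    have "greedy v u \<zero>" by (rule greedyI) (simp_all add: ok_def cover)
    with u show "\<zero> \<preceq> L \<longrightarrow> (\<exists>u. u \<prec> W \<and> greedy v u \<zero> \<and> (\<forall>i. i \<prec> L \<longrightarrow> \<zero> \<preceq> i \<longrightarrow> \<not> mem v u i))"
      by blast
  next
    fix k assume IH: "k \<preceq> L \<longrightarrow> (\<exists>u. u \<prec> W \<and> greedy v u k \<and> (\<forall>i. i \<prec> L \<longrightarrow> k \<preceq> i \<longrightarrow> \<not> mem v u i))"
    show "k \<oplus> \<one> \<preceq> L \<longrightarrow>
      (\<exists>u. u \<prec> W \<and> greedy v u (k \<oplus> \<one>) \<and> (\<forall>i. i \<prec> L \<longrightarrow> k \<oplus> \<one> \<preceq> i \<longrightarrow> \<not> mem v u i))"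
    proof
      assume "k \<oplus> \<one> \<preceq> L"
      then have kL: "k \<prec> L" using lt_add_one ord.less_le_trans by blast
      then obtain u where u: "u \<prec> W" "greedy v u k" "\<And>i. i \<prec> L \<Longrightarrow> k \<preceq> i \<Longrightarrow> \<not> mem v u i"
        using IH by (auto simp: le_def)
      have less: "i \<prec> k \<oplus> \<one> \<longleftrightarrow> i \<prec> k \<or> i = k" for i by (auto simp: lt_succ_iff le_def)
      have gt: "k \<preceq> i \<and> i \<noteq> k" if "k \<oplus> \<one> \<preceq> i" for i
      proof -
        have "k \<prec> i" using lt_add_one[of k] that by (rule ord.less_le_trans)
        then show ?thesis by auto
      qed
      show "\<exists>u. u \<prec> W \<and> greedy v u (k \<oplus> \<one>) \<and> (\<forall>i. i \<prec> L \<longrightarrow> k \<oplus> \<one> \<preceq> i \<longrightarrow> \<not> mem v u i)"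
      proof (cases "\<exists>b y. y \<prec> a \<and> pr b y = k \<and> free v u b y")
        case False
        have nk: "\<not> mem v u k" using u(3)[OF kL] by simp
        have "greedy v u (k \<oplus> \<one>)"
        proof (rule greedyI)
          show "ok v u (k \<oplus> \<one>)" unfolding ok_def
          proof
            fix x
            obtain y where y: "y \<prec> a" "P x y" "\<And>b. b \<prec> x \<Longrightarrow> pr b y \<prec> k \<Longrightarrow> \<not> mem v u (pr b y)"
              using u(2) unfolding greedy_def ok_def by blast
            have "\<not> mem v u (pr b y)" if "b \<prec> x" "pr b y \<prec> k \<oplus> \<one>" for b
              using that y(3) nk unfolding less by auto
            with y(1,2) show "\<exists>y. y \<prec> a \<and> P x y \<and>
              (\<forall>b. b \<prec> x \<longrightarrow> pr b y \<prec> k \<oplus> \<one> \<longrightarrow> \<not> mem v u (pr b y))" by blast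
          qed
          show "\<not> free v u b y" if "y \<prec> a" "pr b y \<prec> k \<oplus> \<one>" "\<not> mem v u (pr b y)" for b y
            using that False greedyD[OF u(2)] unfolding less by blast
        qed
        with u(1,3) gt show ?thesis by blast
      next
        case True
        then obtain b y where byk: "y \<prec> a" "pr b y = k" "free v u b y" by blast
        obtain u' where u': "u' \<prec> W" "\<And>i. i \<prec> L \<Longrightarrow> mem v u' i \<longleftrightarrow> i = k \<or> mem v u i"
          using insert[OF kL] by blast
        have below: "mem v u' i \<longleftrightarrow> mem v u i" if "i \<prec> k" for i
          using that u'(2)[of i] kL lt_trans by auto
        \<comment> \<open>Freeness of the pair coded by \<open>k\<close> is exactly
          \<open>ok\<close> at \<open>k \<oplus> \<one>\<close> for the enlarged code, as no other
          pair has code \<open>k\<close>. Earlier rejections persist because \<open>free\<close>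
          looks only at smaller codes.\<close>
        have "greedy v u' (k \<oplus> \<one>)"
        proof (rule greedyI)
          show "ok v u' (k \<oplus> \<one>)" unfolding ok_def
          proof
            fix x
            obtain y' where y': "y' \<prec> a" "P x y'" "\<not> (b \<prec> x \<and> y' = y)"
              "\<And>b'. b' \<prec> x \<Longrightarrow> pr b' y' \<prec> k \<Longrightarrow> \<not> mem v u (pr b' y')"
              using byk(3) unfolding free_def byk(2) by blast
            have "\<not> mem v u' (pr b' y')" if b': "b' \<prec> x" "pr b' y' \<prec> k \<oplus> \<one>" for b'
            proof -
              have "pr b' y' \<noteq> k"
              proof
                assume "pr b' y' = k"
                then have "pr b' y' = pr b y" using byk(2) by simp
                from pr_inj[OF this y'(1) byk(1)] y'(3) b'(1) show False by simp
              qed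
              then have "pr b' y' \<prec> k" using b'(2) less by blast
              then show ?thesis using below y'(4) b'(1) by blast
            qed
            with y'(1,2) show "\<exists>y'. y' \<prec> a \<and> P x y' \<and>
              (\<forall>b. b \<prec> x \<longrightarrow> pr b y' \<prec> k \<oplus> \<one> \<longrightarrow> \<not> mem v u' (pr b y'))" by blast
          qed
          show "\<not> free v u' b y" if yb: "y \<prec> a" "pr b y \<prec> k \<oplus> \<one>" "\<not> mem v u' (pr b y)" for b y
          proof -
            have "pr b y \<noteq> k" using yb(3) u'(2)[OF kL] by auto
            then have lk: "pr b y \<prec> k" using yb(2) less by blast
            then have "\<not> free v u b y" using yb below greedyD[OF u(2)] by blast
            moreover have "free v u' b y \<longleftrightarrow> free v u b y"
              by (rule free_cong) (use below lk lt_trans in blast)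
            ultimately show ?thesis by blast
          qed
        qed
        with u' u(3) gt show ?thesis by blast
      qed
    qed
  qed
  then show ?thesis by auto
qed

text \<open>A commitment made in one segment is free relative to the commitments before it, by
  \<open>ok\<close> for that segment. The other segment agrees on those, finds the pair free as well
  and, being greedy, commits to it.\<close>

lemma greedy_agree_step:
  assumes g: "greedy v u L" "greedy v' u' L'" and p: "pr b y \<prec> L" "pr b y \<prec> L'" and y: "y \<prec> a"
    and IH: "\<And>b' y'. y' \<prec> a \<Longrightarrow> pr b' y' \<prec> pr b y \<Longrightarrow> mem v u (pr b' y') \<longleftrightarrow> mem v' u' (pr b' y')"
    and mem: "mem v u (pr b y)"
  shows "mem v' u' (pr b y)"
proof (rule ccontr)
  assume "\<not> mem v' u' (pr b y)"
  then have "\<not> free v' u' b y" using greedyD[OF g(2) y p(2)] by blast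
  moreover have "free v' u' b y" unfolding free_def
  proof
    fix x
    obtain y' where y': "y' \<prec> a" "P x y'" "\<And>b. b \<prec> x \<Longrightarrow> pr b y' \<prec> L \<Longrightarrow> \<not> mem v u (pr b y')"
      using g(1) unfolding greedy_def ok_def by blast
    have "\<not> (b \<prec> x \<and> y' = y)" using y'(3) p(1) mem by blast
    moreover have "\<not> mem v' u' (pr b' y')" if "b' \<prec> x" "pr b' y' \<prec> pr b y" for b'
      using that IH[OF y'(1)] y'(3) p(1) lt_trans by blast
    ultimately show "\<exists>y'. y' \<prec> a \<and> P x y' \<and> \<not> (b \<prec> x \<and> y' = y) \<and>
        (\<forall>b'. b' \<prec> x \<longrightarrow> pr b' y' \<prec> pr b y \<longrightarrow> \<not> mem v' u' (pr b' y'))"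
      using y'(1,2) by blast
  qed
  ultimately show False by blast
qed

lemma greedy_agree:
  assumes g: "greedy v u L" "greedy v' u' L'" and "y \<prec> a" "pr b y \<prec> L" "pr b y \<prec> L'"
  shows "mem v u (pr b y) \<longleftrightarrow> mem v' u' (pr b y)"
proof -
  \<comment> \<open>Induction on codes. The equivalence is spelled out as two implications and both
    quantifiers are bounded, to match the closure rules for \<open>\<Delta>\<close>.\<close>
  let ?A = "\<lambda>p. \<forall>y. y \<prec> a \<longrightarrow> (\<forall>b. b \<prec> p \<longrightarrow> pr b y \<prec> p \<longrightarrow> pr b y \<prec> L \<longrightarrow> pr b y \<prec> L' \<longrightarrow>
    (mem v u (pr b y) \<longrightarrow> mem v' u' (pr b y)) \<and> (mem v' u' (pr b y) \<longrightarrow> mem v u (pr b y)))"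
  have "?A (pr b y \<oplus> \<one>)"
  proof (rule indnD[where A = ?A, OF indn_\<Delta>])
    show "dfn \<Delta> (\<lambda>e. ?A (e 0))" by (intro dfn_intros dfn_mem tfn_pr)
    fix p assume IH: "?A p"
    have IH': "mem v u (pr b y) \<longleftrightarrow> mem v' u' (pr b y)"
      if "y \<prec> a" "pr b y \<prec> p" "pr b y \<prec> L" "pr b y \<prec> L'" for b y
      using IH that le_pr[of b y] ord.le_less_trans by blast
    show "?A (p \<oplus> \<one>)"
    proof (intro allI impI)
      fix y b assume y: "y \<prec> a" and b: "pr b y \<prec> p \<oplus> \<one>" and L: "pr b y \<prec> L" "pr b y \<prec> L'"
      have p: "i \<prec> p" if "i \<prec> pr b y" for i
        using that b unfolding lt_succ_iff by (rule ord.less_le_trans)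
      have "mem v' u' (pr b y)" if "mem v u (pr b y)"
        by (rule greedy_agree_step[OF g L y _ that]) (use IH' p L lt_trans in blast)
      moreover have "mem v u (pr b y)" if "mem v' u' (pr b y)"
        by (rule greedy_agree_step[OF g(2,1) L(2,1) y _ that]) (use IH' p L lt_trans in blast)
      ultimately show "(mem v u (pr b y) \<longrightarrow> mem v' u' (pr b y)) \<and> (mem v' u' (pr b y) \<longrightarrow> mem v u (pr b y))"
        by blast
    qed
  qed simp
  moreover have "b \<prec> pr b y \<oplus> \<one>" using le_pr by (simp add: lt_succ_iff)
  ultimately show ?thesis using assms(3-5) lt_add_one by blast
qed

lemma regular: "\<exists>y. y \<prec> a \<and> (\<forall>b. \<exists>x. b \<prec> x \<and> P x y)"
proof -
  \<comment> \<open>Sigma_(n+2), since \<open>greedy\<close> is Delta_(n+2) under collection; this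
    is what allows the commitment points of all \<open>y\<close> to be bounded.\<close>
  let ?Q = "\<lambda>y L. \<exists>v u. greedy v u L \<and> (\<exists>b. b \<prec> L \<and> pr b y \<prec> L \<and> mem v u (pr b y))"
  have "\<not> (\<forall>y. y \<prec> a \<longrightarrow> (\<exists>L. ?Q y L))"
  proof
    assume all: "\<forall>y. y \<prec> a \<longrightarrow> (\<exists>L. ?Q y L)"
    have "dfn (Sig (Suc (Suc n))) (\<lambda>e. ?Q (e 0) (e 1))"
      by (intro dfn_Sig_ex dfn_Sigma0_Sig[OF coll] dfn_intros dfn_greedy dfn_mem tfn_pr)
    from collD[where A = ?Q, OF coll this all]
    obtain B where B: "\<And>y. y \<prec> a \<Longrightarrow> \<exists>L. L \<prec> B \<and> ?Q y L" by blast
    obtain v u where g: "greedy v u B" using ex_greedy by blast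
    \<comment> \<open>\<open>ok\<close> is read at \<open>x = B\<close>, where every commitment with
      \<open>b \<prec> B\<close> is in force; the value found there cannot have been committed below
      \<open>B\<close>.\<close>
    then obtain y where y: "y \<prec> a" "\<And>b. b \<prec> B \<Longrightarrow> pr b y \<prec> B \<Longrightarrow> \<not> mem v u (pr b y)"
      unfolding greedy_def ok_def by blast
    obtain L v' u' b where L: "L \<prec> B" "greedy v' u' L" "b \<prec> L" "pr b y \<prec> L" "mem v' u' (pr b y)"
      using B[OF y(1)] by blast
    then have "b \<prec> B" "pr b y \<prec> B" using lt_trans by blast+
    with y L greedy_agree[OF g L(2) y(1)] show False by blast
  qed
  then obtain y where y: "y \<prec> a" "\<And>L. \<not> ?Q y L" by blast
  have "\<exists>x. b \<prec> x \<and> P x y" for b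
  proof -
    \<comment> \<open>Just long enough for the pair \<open>(b, y)\<close> itself to have been
      decided.\<close>
    let ?L = "pr b y \<oplus> \<one>"
    obtain v u where g: "greedy v u ?L" using ex_greedy by blast
    have nm: "\<not> mem v u (pr b' y)" if "pr b' y \<prec> ?L" for b'
      using y(2)[of ?L] g that le_pr[of b' y] ord.le_less_trans by blast
    then have "\<not> free v u b y" using greedyD[OF g y(1), of b] lt_add_one by blast
    then obtain x where x: "\<And>y'. y' \<prec> a \<Longrightarrow> P x y' \<Longrightarrow>
      (b \<prec> x \<and> y' = y) \<or> (\<exists>b'. b' \<prec> x \<and> pr b' y' \<prec> pr b y \<and> mem v u (pr b' y'))"
      unfolding free_def by blast
    \<comment> \<open>\<open>ok\<close> gives a value at this \<open>x\<close> that respects all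
      commitments made; the failure of \<open>free\<close> leaves only \<open>y' = y\<close> and
      \<open>b \<prec> x\<close> for it.\<close>
    obtain y' where y': "y' \<prec> a" "P x y'" "\<And>b. b \<prec> x \<Longrightarrow> pr b y' \<prec> ?L \<Longrightarrow> \<not> mem v u (pr b y')"
      using g unfolding greedy_def ok_def by blast
    have "\<not> (\<exists>b'. b' \<prec> x \<and> pr b' y' \<prec> pr b y \<and> mem v u (pr b' y'))"
      using y'(3) lt_trans[OF _ lt_add_one] by blast
    then have "b \<prec> x \<and> y' = y" using x[OF y'(1,2)] by blast
    with y'(2) show ?thesis by blast
  qed
  with y(1) show ?thesis by blast
qed

end

context arith
begin

lemma wr_SigOrPi_if_coll:
  assumes c: "coll (Suc (Suc n))" shows "wr (SigOrPi (Suc n))"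
  unfolding wr_def
proof (intro allI impI)
  fix A a assume A: "dfn (SigOrPi (Suc n)) (\<lambda>e. A (e 0) (e 1))" and ex: "\<forall>x. \<exists>y. y \<prec> a \<and> A x y"
  obtain Q R where QR: "dfn (Sig (Suc n)) Q" "dfn (Pi (Suc n)) R" "(\<lambda>e. A (e 0) (e 1)) = (\<lambda>e. Q e \<or> R e)"
    using A by (rule dfn_SigOrPi_cases)
  define S where "S x y = Q (case_nat x (case_nat y (\<lambda>_. \<zero>)))" for x y
  define T where "T x y = R (case_nat x (case_nat y (\<lambda>_. \<zero>)))" for x y
  have AST: "A x y \<longleftrightarrow> S x y \<or> T x y" for x y
    using fun_cong[OF QR(3), of "case_nat x (case_nat y (\<lambda>_. \<zero>))"] by (simp add: S_def T_def)
  have efn: "efn (\<lambda>e. case_nat (f e) (case_nat (g e) (\<lambda>_. \<zero>)))" if "tfn f" "tfn g" for f g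
    by (intro efn_case efn_const that)
  have dS: "dfn (Sig (Suc n)) (\<lambda>e. S (f e) (g e))" if "tfn f" "tfn g" for f g
    unfolding S_def by (rule dfn_subst[OF sub_closed_classes(2) QR(1) efn[OF that]])
  have dT: "dfn (Pi (Suc n)) (\<lambda>e. T (f e) (g e))" if "tfn f" "tfn g" for f g
    unfolding T_def by (rule dfn_subst[OF sub_closed_classes(3) QR(2) efn[OF that]])
  show "\<exists>y. y \<prec> a \<and> (\<forall>b. \<exists>x. b \<prec> x \<and> A x y)"
  proof (cases "\<exists>y. y \<prec> a \<and> (\<forall>b. \<exists>x. b \<prec> x \<and> S x y)")
    case True
    then show ?thesis using AST by blast
  next
    case False
    then have no: "\<forall>y. y \<prec> a \<longrightarrow> (\<exists>b. \<forall>x. x \<preceq> b \<or> \<not> S x y)"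
      by (metis ord.not_le)
    \<comment> \<open>Negating the Sigma part gives Pi_(n+1), which absorbs the quantifier over
      \<open>x\<close>; for this disjunct the bounds \<open>b\<close> are within reach of the given
      collection.\<close>
    have "dfn (Pi (Suc n)) (\<lambda>e. \<forall>x. x \<preceq> e 1 \<or> \<not> S x (e 0))"
    proof -
      have "dfn (Pi (Suc n)) (\<lambda>e. e 0 \<preceq> e (Suc 1))"
        by (rule dfn_mono[OF Delta0_subset(2)], subst Sigma0_cl_Delta0[symmetric], intro dfn_Sigma0_le tfn_intros)
      moreover have "dfn (Pi (Suc n)) (\<lambda>e. \<not> S (e 0) (e (Suc 0)))"
        by (intro dfn_neg_Sig dS tfn_intros)
      ultimately show ?thesis by (intro dfn_Pi_all dfn_Pi_disj)
    qed
    from collD[where A = "\<lambda>y b. \<forall>x. x \<preceq> b \<or> \<not> S x y", OF c dfn_mono[OF Pi_subset_Sig_Suc this] no]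
    obtain B where B: "\<And>y. y \<prec> a \<Longrightarrow> \<exists>b. b \<prec> B \<and> (\<forall>x. x \<preceq> b \<or> \<not> S x y)" by blast
    have noS: "\<not> S (x \<oplus> B) y" if y: "y \<prec> a" for x y
    proof -
      obtain b where b: "b \<prec> B" "\<forall>x. x \<preceq> b \<or> \<not> S x y" using B[OF y] by blast
      then have "b \<prec> x \<oplus> B" using le_add' ord.less_le_trans by blast
      with b(2) show ?thesis by (meson ord.not_le)
    qed
    \<comment> \<open>Translation by \<open>B\<close> removes the Sigma disjunct at every argument,
      so that \<open>cover\<close> holds for all \<open>x\<close> and not only eventually.\<close>
    interpret pi_cover zero one plus times lt n a "\<lambda>x y. T (x \<oplus> B) y"
    proof unfold_locales
      show "coll (Suc (Suc n))" by (rule c)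
      show "dfn (Pi (Suc n)) (\<lambda>e. T (e 0 \<oplus> B) (e 1))" by (intro dT tfn_intros)
      show "\<exists>y. y \<prec> a \<and> T (x \<oplus> B) y" for x using ex AST noS by blast
    qed
    obtain y where y: "y \<prec> a" "\<And>b. \<exists>x. b \<prec> x \<and> T (x \<oplus> B) y" using regular by blast
    have "\<exists>x. b \<prec> x \<and> A x y" for b
    proof -
      obtain x where "b \<prec> x" "T (x \<oplus> B) y" using y(2) by blast
      moreover have "b \<prec> x \<oplus> B" using \<open>b \<prec> x\<close> le_add ord.less_le_trans by blast
      ultimately show ?thesis using AST by blast
    qed
    with y(1) show ?thesis by blast
  qed
qed

lemma wr_Sigma0_if_coll:
  assumes c: "coll (Suc (Suc n))" shows "wr (Sigma0_cl (Sig n))"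
  by (rule wr_cong[OF dfn_SigOrPi_if_Sig[OF dfn_Sigma0_Sig[OF coll_antimono[OF c]]] wr_SigOrPi_if_coll[OF c]])

text \<open>In a model of bounded induction each of the three theories amounts to
  \<open>coll (n + 2)\<close>; this lemma and its converse, uniform in \<open>T\<close>, yield all
  implications between them.\<close>

lemma coll_if_models:
  assumes "T \<in> {WR (Sigma0_cl (Sig n)), WR (SigOrPi (n + 1)), BSig (n + 2)}"
    and "\<And>q e. q \<in> T \<Longrightarrow> sat e q"
  shows "coll (n + 2)"
  using assms(1)
proof (elim insertE emptyE)
  assume "T = WR (Sigma0_cl (Sig n))"
  then have "wr (Sigma0_cl (Sig n))" using assms(2) by (intro wr_if_sat_WRax) (auto simp: WR_def)
  then show ?thesis using coll_if_wr_Sigma0 by simp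
next
  assume "T = WR (SigOrPi (n + 1))"
  then have "wr (SigOrPi (Suc n))" using assms(2) by (intro wr_if_sat_WRax) (auto simp: WR_def)
  then show ?thesis using coll_if_wr_SigOrPi by simp
next
  assume "T = BSig (n + 2)"
  then show ?thesis using assms(2) by (intro coll_if_sat_Coll) (auto simp: BSig_def)
qed

lemma models_if_coll:
  assumes "T \<in> {WR (Sigma0_cl (Sig n)), WR (SigOrPi (n + 1)), BSig (n + 2)}"
    and c: "coll (n + 2)" and q: "q \<in> T"
  shows "sat e q"
  using assms(1)
proof (elim insertE emptyE)
  assume "T = WR (Sigma0_cl (Sig n))"
  then show ?thesis using q c sat_WRax_if_wr[OF _ wr_Sigma0_if_coll] by (auto simp: WR_def IDelta0)
next
  assume "T = WR (SigOrPi (n + 1))"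
  then show ?thesis using q c sat_WRax_if_wr[OF _ wr_SigOrPi_if_coll] by (auto simp: WR_def IDelta0)
next
  assume "T = BSig (n + 2)"
  then show ?thesis using q c sat_Coll_if_coll by (auto simp: BSig_def IDelta0)
qed

end

theorem theorem5p7:
  fixes n :: nat
  shows "EquivTh (WR (Sigma0_cl (Sig n))) (WR (SigOrPi (n + 1)))
       \<and> EquivTh (WR (SigOrPi (n + 1))) (BSig (n + 2))
       \<and> EquivTh (WR (Sigma0_cl (Sig n))) (BSig (n + 2))"
proof -
  let ?Ts = "{WR (Sigma0_cl (Sig n)), WR (SigOrPi (n + 1)), BSig (n + 2)}"
  have *: "Prov T (ucl q)" if T: "T \<in> ?Ts" and U: "U \<in> ?Ts" and q: "q \<in> U" for T U q
  proof (rule completeness)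
    show "PAminus \<subseteq> T" using T by (auto simp: WR_def BSig_def IDelta0_def)
    fix zero one :: nat and plus times lt e
    assume M: "\<And>q e. q \<in> T \<Longrightarrow> interp.sat zero one plus times lt e q"
    interpret arith zero one plus times lt
      by unfold_locales (use M T in \<open>auto simp: WR_def BSig_def\<close>)
    show "interp.sat zero one plus times lt e q"
      by (rule models_if_coll[OF U coll_if_models[OF T M] q])
  qed
  show ?thesis
    unfolding EquivTh_def by (intro conjI ballI; rule *[rotated 2], assumption; simp)
qed

end
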